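(* Let $\Omega$ be a connected open subset of $\mathbf{C}$, and let $f\colon\Omega\to\mathbf{C}^m$ be a continuous map. Assume that $\overline\partial f=Af$ on $\Omega\setminus f^{-1}(0)$ in the sense of distributions, where $A$ is an $m\times m$ matrix whose entries are $(0,1)$-forms with $L^p$ coefficients on $\Omega\setminus f^{-1}(0)$. If $2<p\le\infty$ and $f\not\equiv0$, then $f$ has isolated zeros in $\Omega$, and $\overline\partial f=Af$ holds on $\Omega$ in the sense of distributions, where $A$ is set to be zero on $f^{-1}(0)$.
   Context: Here $f^{-1}(0)=\{z\in\Omega: f(z)=0\in\mathbf{C}^m\}$, and $f$ is regarded as a column vector. *)

theory Defs
  imports "HOL-Analysis.Analysis"
begin

primrec Ck :: "nat \<Rightarrow> ('a::real_normed_vector \<Rightarrow> 'b::real_normed_vector) \<Rightarrow> bool" where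
  "Ck 0 \<phi> \<longleftrightarrow> continuous_on UNIV \<phi>"
| "Ck (Suc k) \<phi> \<longleftrightarrow>
    (\<forall>x. \<phi> differentiable (at x)) \<and> (\<forall>v. Ck k (\<lambda>x. frechet_derivative \<phi> (at x) v))"

(* Differentiability is real differentiability on the plane, not complex differentiability. *)
definition test_function :: "complex set \<Rightarrow> (complex \<Rightarrow> complex) \<Rightarrow> bool" where
  "test_function U \<phi> \<longleftrightarrow>
    (\<forall>k. Ck k \<phi>) \<and> compact (closure {z. \<phi> z \<noteq> 0}) \<and> closure {z. \<phi> z \<noteq> 0} \<subseteq> U"

definition dbar :: "(complex \<Rightarrow> complex) \<Rightarrow> complex \<Rightarrow> complex" where
  "dbar \<phi> z =
    (frechet_derivative \<phi> (at z) 1 + \<i> * frechet_derivative \<phi> (at z) \<i>) / 2"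

definition locally_integrable :: "complex set \<Rightarrow> (complex \<Rightarrow> complex) \<Rightarrow> bool" where
  "locally_integrable U u \<longleftrightarrow> (\<forall>K. compact K \<and> K \<subseteq> U \<longrightarrow> integrable (lebesgue_on K) u)"

(* The distribution on U given by a locally integrable function, as a functional
   on test functions. *)
definition regular_distribution ::
    "complex set \<Rightarrow> (complex \<Rightarrow> complex) \<Rightarrow> (complex \<Rightarrow> complex) \<Rightarrow> complex" where
  "regular_distribution U u \<phi> = integral\<^sup>L (lebesgue_on U) (\<lambda>z. u z * \<phi> z)"

definition distributional_dbar ::
    "((complex \<Rightarrow> complex) \<Rightarrow> complex) \<Rightarrow> (complex \<Rightarrow> complex) \<Rightarrow> complex" where
  "distributional_dbar T \<phi> = - T (dbar \<phi>)"

(* A (0,1)-form v d(conj z) is represented by its coefficient v.  Local integrability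
   is demanded explicitly because the integral of a non-integrable function is 0 here. *)
definition dbar_eq_distributionally ::
    "complex set \<Rightarrow> (complex \<Rightarrow> complex) \<Rightarrow> (complex \<Rightarrow> complex) \<Rightarrow> bool" where
  "dbar_eq_distributionally U u v \<longleftrightarrow>
    locally_integrable U u \<and> locally_integrable U v \<and>
    (\<forall>\<phi>. test_function U \<phi> \<longrightarrow>
      distributional_dbar (regular_distribution U u) \<phi> = regular_distribution U v \<phi>)"

definition in_Lp :: "ennreal \<Rightarrow> complex set \<Rightarrow> (complex \<Rightarrow> complex) \<Rightarrow> bool" where
  "in_Lp p U a \<longleftrightarrow> a \<in> borel_measurable (lebesgue_on U) \<and>
    (if p = \<infinity> then \<exists>C. AE z in lebesgue_on U. norm (a z) \<le> C
     else integrable (lebesgue_on U) (\<lambda>z. norm (a z) powr enn2real p))"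

(* The matrix A of (0,1)-forms is again represented by its coefficient functions, and the
   vector equation is read componentwise. *)
definition solves_dbar_system ::
    "complex set \<Rightarrow> (complex \<Rightarrow> complex ^ 'm ^ 'm) \<Rightarrow> (complex \<Rightarrow> complex ^ 'm) \<Rightarrow> bool" where
  "solves_dbar_system U A f \<longleftrightarrow>
    (\<forall>i. dbar_eq_distributionally U (\<lambda>z. f z $ i) (\<lambda>z. (A z *v f z) $ i))"

end

theory Submission
  imports Defs "HOL-Complex_Analysis.Complex_Analysis" "HOL-Real_Asymp.Real_Asymp"
begin

text \<open>
  On a small disc the matrix \<^emph>\<open>A\<close>, extended by 0 to the zero set, has so little mass against the
  Cauchy kernel (this is where p > 2 enters) that there is a continuous, invertible matrix \<^emph>\<open>C\<close>,
  close to the identity, with dbar C = - C A. By the Leibniz rule g = C f satisfies dbar g = 0 off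
  the zeros of f, so g is holomorphic there by Weyl's lemma. Each component of g is continuous on
  the disc and vanishes wherever f does; hence Rado's theorem makes it holomorphic on the whole
  disc. As C is invertible, f and g have the same zeros. These are therefore isolated unless f
  vanishes identically on the disc, and connectedness excludes the latter. The equation holds
  across the isolated zeros because subtracting a Cauchy transform of the right-hand side leaves a
  continuous function that is holomorphic off finitely many points.

  The analysis rests on two devices. Firstly, the integral of a first derivative of a compactly
  supported C^1 function vanishes, by translation invariance. Secondly, a test function times the
  smooth kernel cnj z / (|z|^2 + e^2) is again a test function. Inserting it into the weak equation
  and letting e tend to 0 gives a Cauchy--Pompeiu formula for weak solutions (weak_cauchy_pompeiu).
  Weyl's lemma is its special case with right-hand side 0. Integrating it by Fubini's theorem gives
  the Leibniz rule for a Cauchy transform times a weak solution (weak_leibniz_cauchy_transform).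
  The rows of C are fixed points of a contraction (integrating_row_exists).

  Rado's theorem is proved by an energy estimate: a Caccioppoli inequality, localised to the set
  where |g| is not small, shows that g' is square integrable off the zeros of g. This allows a
  cutoff at the level sets of |g| to be removed from the weak equation (energy_finite_off_zeros,
  rado).
\<close>

section \<open>Smooth functions and cutoffs\<close>

lemma Ck_SucI:
  assumes "\<And>x. (\<phi> has_derivative D x) (at x)" and "\<And>v. Ck k (\<lambda>x. D x v)"
  shows "Ck (Suc k) \<phi>"
proof -
  have "frechet_derivative \<phi> (at x) = D x" for x
    using frechet_derivative_at[OF assms(1)] by (rule sym)
  then have "(\<lambda>x. frechet_derivative \<phi> (at x) v) = (\<lambda>x. D x v)" for v
    by presburger
  moreover have "\<phi> differentiable (at x)" for x
    using assms(1) by (rule differentiableI)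
  ultimately show ?thesis
    using assms(2) by simp
qed

lemma Ck_Suc_has_derivative:
  assumes "Ck (Suc k) \<phi>"
  shows "(\<phi> has_derivative frechet_derivative \<phi> (at x)) (at x)"
proof -
  have "\<phi> differentiable (at x)"
    using assms by simp
  then show ?thesis
    unfolding frechet_derivative_works .
qed

lemma Ck_SucD: "Ck (Suc k) \<phi> \<Longrightarrow> Ck k (\<lambda>x. frechet_derivative \<phi> (at x) v)"
  by simp

lemma Ck_Suc_imp_Ck: "Ck (Suc k) \<phi> \<Longrightarrow> Ck k \<phi>"
proof (induction k arbitrary: \<phi>)
  case 0
  have "isCont \<phi> x" for x
    using has_derivative_continuous[OF Ck_Suc_has_derivative[OF 0]] .
  then show ?case
    by (simp add: continuous_at_imp_continuous_on)
next
  case (Suc k)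
  show ?case
    by (rule Ck_SucI[OF Ck_Suc_has_derivative[OF Suc.prems] Suc.IH[OF Ck_SucD[OF Suc.prems]]])
qed

lemma Ck_imp_continuous_on: "Ck k \<phi> \<Longrightarrow> continuous_on S \<phi>"
proof (induction k)
  case 0
  then have "continuous_on UNIV \<phi>" by simp
  then show ?case by (rule continuous_on_subset) simp
next
  case (Suc k)
  then show ?case using Ck_Suc_imp_Ck[of k \<phi>] by simp
qed

lemma Ck_const: "Ck k (\<lambda>x. c)"
proof (induction k arbitrary: c)
  case (Suc k)
  show ?case by (intro Ck_SucI[where D = "\<lambda>x v. 0"] has_derivative_const Suc.IH)
qed simp

lemma Ck_bounded_linear_compose:
  assumes "bounded_linear L" and "Ck k f"
  shows "Ck k (\<lambda>x. L (f x))"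
  using assms(2)
proof (induction k arbitrary: f)
  case 0
  then show ?case
    using bounded_linear.continuous_on[OF assms(1)] by auto
next
  case (Suc k)
  show ?case
    by (intro Ck_SucI[where D = "\<lambda>x v. L (frechet_derivative f (at x) v)"] Suc.IH
        bounded_linear.has_derivative[OF assms(1)] Ck_Suc_has_derivative[OF Suc.prems] Ck_SucD[OF Suc.prems])
qed

lemma Ck_id: "Ck k (\<lambda>x. x)"
  by (cases k) (auto intro!: Ck_SucI[where D = "\<lambda>x v. v"] Ck_const simp del: Ck.simps(2))

lemma Ck_add:
  "Ck k f \<Longrightarrow> Ck k g \<Longrightarrow> Ck k (\<lambda>x. f x + g x)"
proof (induction k arbitrary: f g)
  case 0
  then show ?case by (auto intro: continuous_intros)
next
  case (Suc k)
  show ?case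
    by (intro Ck_SucI[where D = "\<lambda>x v. frechet_derivative f (at x) v + frechet_derivative g (at x) v"]
        Suc.IH has_derivative_add Ck_Suc_has_derivative[OF Suc.prems(1)] Ck_Suc_has_derivative[OF Suc.prems(2)]
        Ck_SucD[OF Suc.prems(1)] Ck_SucD[OF Suc.prems(2)])
qed

lemma Ck_uminus: "Ck k f \<Longrightarrow> Ck k (\<lambda>x. - f x)"
  by (rule Ck_bounded_linear_compose[OF bounded_linear_minus[OF bounded_linear_ident]])

lemma Ck_diff: "Ck k f \<Longrightarrow> Ck k g \<Longrightarrow> Ck k (\<lambda>x. f x - g x)"
  using Ck_add[of k f "\<lambda>x. - g x"] Ck_uminus[of k g] by simp

lemma (in bounded_bilinear) Ck_prod:
  "Ck k f \<Longrightarrow> Ck k g \<Longrightarrow> Ck k (\<lambda>x. prod (f x) (g x))"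
proof (induction k arbitrary: f g)
  case 0
  then show ?case by (auto intro: continuous_on)
next
  case (Suc k)
  show ?case
    by (intro Ck_SucI[where D = "\<lambda>x v. prod (f x) (frechet_derivative g (at x) v)
            + prod (frechet_derivative f (at x) v) (g x)"] Ck_add Suc.IH FDERIV
        Ck_Suc_has_derivative[OF Suc.prems(1)] Ck_Suc_has_derivative[OF Suc.prems(2)]
        Ck_SucD[OF Suc.prems(1)] Ck_SucD[OF Suc.prems(2)]
        Ck_Suc_imp_Ck[OF Suc.prems(1)] Ck_Suc_imp_Ck[OF Suc.prems(2)])
qed

lemmas Ck_mult = bounded_bilinear.Ck_prod[OF bounded_bilinear_mult]
lemmas Ck_scaleR = bounded_bilinear.Ck_prod[OF bounded_bilinear_scaleR]
lemmas Ck_inner = bounded_bilinear.Ck_prod[OF bounded_bilinear_inner]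

lemma Ck_inverse:
  fixes f :: "'a::real_normed_vector \<Rightarrow> 'b::real_normed_field"
  assumes "Ck k f" and "\<And>x. f x \<noteq> 0"
  shows "Ck k (\<lambda>x. inverse (f x))"
  using assms(1)
proof (induction k)
  case 0
  then show ?case using assms(2) by (auto intro: continuous_intros)
next
  case (Suc k)
  have "Ck k (\<lambda>x. inverse (f x))"
    using Suc.IH Ck_Suc_imp_Ck[OF Suc.prems] by simp
  then show ?case
    by (intro Ck_SucI[where D = "\<lambda>x v. - (inverse (f x) * frechet_derivative f (at x) v * inverse (f x))"]
        Ck_uminus Ck_mult Ck_SucD[OF Suc.prems] Deriv.has_derivative_inverse[OF assms(2) Ck_Suc_has_derivative[OF Suc.prems]])
qed

lemma Ck_compose_real:
  fixes f :: "real \<Rightarrow> 'b::real_normed_vector" and g :: "'a::real_normed_vector \<Rightarrow> real"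
  assumes "\<And>k. Ck k f" and "Ck k g"
  shows "Ck k (\<lambda>x. f (g x))"
  using assms
proof (induction k arbitrary: f)
  case 0
  then have "continuous_on UNIV f" "continuous_on UNIV g"
    using Ck_imp_continuous_on[of 0 f] Ck_imp_continuous_on[of 0 g] by simp_all
  then show ?case
    using continuous_on_compose2[of UNIV f UNIV g] by simp
next
  case (Suc k)
  let ?f' = "\<lambda>y. frechet_derivative f (at y) 1"
  have f: "(f has_derivative (\<lambda>h. h *\<^sub>R ?f' y)) (at y)" for y
  proof -
    have d: "(f has_derivative frechet_derivative f (at y)) (at y)"
      using Suc.prems(1)[of "Suc 0"] by (rule Ck_Suc_has_derivative)
    have "frechet_derivative f (at y) h = h *\<^sub>R ?f' y" for h
      using linear_cmul[OF has_derivative_linear[OF d], of h 1] by simp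
    then have "frechet_derivative f (at y) = (\<lambda>h. h *\<^sub>R ?f' y)"
      by blast
    with d show ?thesis
      by argo
  qed
  have "Ck k (\<lambda>x. ?f' (g x))"
  proof (rule Suc.IH)
    show "Ck k g"
      using Suc.prems(2) by (rule Ck_Suc_imp_Ck)
    show "Ck k ?f'" for k
      using Suc.prems(1)[of "Suc k"] by (rule Ck_SucD)
  qed
  then show ?case
    by (intro Ck_SucI[where D = "\<lambda>x v. frechet_derivative g (at x) v *\<^sub>R ?f' (g x)"]
        Ck_scaleR Ck_SucD[OF Suc.prems(2)]
        has_derivative_compose[OF Ck_Suc_has_derivative[OF Suc.prems(2)] f])
qed

text \<open>The classical non-analytic smooth function: the family is closed under differentiation,
  which turns smoothness at the origin into an induction.\<close>

definition flat :: "nat \<Rightarrow> real \<Rightarrow> real" where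
  "flat n x = (if 0 < x then inverse x ^ n * exp (- inverse x) else 0)"

lemma flat_has_derivative:
  "(flat n has_real_derivative flat (n + 2) x - real n * flat (n + 1) x) (at x)"
proof -
  consider "x > 0" | "x < 0" | "x = 0" by linarith
  then show ?thesis
  proof cases
    case 1
    have "((\<lambda>x. inverse x ^ n * exp (- inverse x)) has_real_derivative
        flat (n + 2) x - real n * flat (n + 1) x) (at x)"
    proof -
      have "x ^ (n - 1) * x = x ^ n" if "n > 0"
        using that by (cases n) auto
      with 1 show ?thesis
        by (cases "n = 0") (auto intro!: derivative_eq_intros simp: flat_def field_simps power2_eq_square)
    qed
    then show ?thesis
      by (rule DERIV_cong_ev[THEN iffD1, rotated 3])
        (use eventually_gt_at_top 1 in \<open>auto simp: flat_def intro!: eventually_nhds_in_open[THEN eventually_mono, of "{0<..}"]\<close>)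
  next
    case 2
    have "((\<lambda>x. 0) has_real_derivative flat (n + 2) x - real n * flat (n + 1) x) (at x)"
      using 2 by (auto simp: flat_def)
    then show ?thesis
      by (rule DERIV_cong_ev[THEN iffD1, rotated 3])
        (use 2 in \<open>auto simp: flat_def intro!: eventually_nhds_in_open[THEN eventually_mono, of "{..<0}"]\<close>)
  next
    case 3
    have "((\<lambda>h::real. inverse h ^ n * exp (- inverse h) / h) \<longlongrightarrow> 0) (at_right 0)"
      by real_asymp
    then have r: "((\<lambda>h. flat n h / h) \<longlongrightarrow> 0) (at_right 0)"
      by (rule Lim_transform_eventually)
        (auto simp: flat_def eventually_at_filter)
    have l: "((\<lambda>h. flat n h / h) \<longlongrightarrow> 0) (at_left 0)"
      by (rule Lim_transform_eventually[OF tendsto_const])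
        (auto simp: flat_def eventually_at_filter)
    from l r have "((\<lambda>h. flat n h / h) \<longlongrightarrow> 0) (at 0)"
      by (simp add: filterlim_at_split)
    then show ?thesis
      using 3 by (simp add: has_field_derivative_iff flat_def)
  qed
qed

lemma Ck_flat: "Ck k (flat n)"
proof (induction k arbitrary: n)
  case 0
  then show ?case
    by (auto intro!: DERIV_isCont[OF flat_has_derivative] continuous_at_imp_continuous_on)
next
  case (Suc k)
  show ?case
    by (intro Ck_SucI[where D = "\<lambda>x v. (flat (n + 2) x - real n * flat (n + 1) x) * v"]
        Ck_mult Ck_diff Ck_const Suc.IH flat_has_derivative[THEN has_field_derivative_imp_has_derivative])
qed

text \<open>The step decreases from 1 to 0 between 1 and 4, the squares of the relative radii 1 and 2 of
  the cutoff below, which is applied to a squared distance.\<close>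

definition smooth_step :: "real \<Rightarrow> real" where
  "smooth_step t = flat 0 (4 - t) * inverse (flat 0 (4 - t) + flat 0 (t - 1))"

lemma flat_0_nonneg: "0 \<le> flat 0 x" and flat_0_pos_iff: "0 < flat 0 x \<longleftrightarrow> 0 < x"
  by (auto simp: flat_def)

lemma smooth_step_denominator_pos: "0 < flat 0 (4 - t) + flat 0 (t - 1)"
  using flat_0_nonneg[of "4 - t"] flat_0_nonneg[of "t - 1"] flat_0_pos_iff[of "4 - t"] flat_0_pos_iff[of "t - 1"]
  by (cases "t < 4") auto

lemma Ck_smooth_step: "Ck k smooth_step"
proof -
  have "Ck k (\<lambda>t. flat 0 (4 - t))"
    by (rule Ck_compose_real[OF Ck_flat Ck_diff[OF Ck_const Ck_id]])
  moreover have "Ck k (\<lambda>t. flat 0 (t - 1))"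
    by (rule Ck_compose_real[OF Ck_flat Ck_diff[OF Ck_id Ck_const]])
  ultimately have "Ck k (\<lambda>t. flat 0 (4 - t) * inverse (flat 0 (4 - t) + flat 0 (t - 1)))"
    by (intro Ck_mult Ck_inverse Ck_add less_imp_neq[OF smooth_step_denominator_pos, symmetric])
  then show ?thesis
    unfolding smooth_step_def[abs_def] .
qed

definition bump :: "complex \<Rightarrow> real \<Rightarrow> complex \<Rightarrow> complex" where
  "bump a r z = of_real (smooth_step (inner (z - a) (z - a) * inverse r ^ 2))"

lemma Ck_bump: "Ck k (bump a r)"
proof -
  have "Ck k (\<lambda>z::complex. inner (z - a) (z - a) * inverse r ^ 2)"
    by (intro Ck_mult Ck_inner Ck_diff Ck_id Ck_const)
  from Ck_compose_real[OF Ck_smooth_step this]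
  have "Ck k (\<lambda>z. smooth_step (inner (z - a) (z - a) * inverse r ^ 2))" .
  from Ck_bounded_linear_compose[OF bounded_linear_of_real this] show ?thesis
    unfolding bump_def[abs_def] .
qed

lemma bump_arg: "r > 0 \<Longrightarrow> inner (z - a) (z - a) * inverse r ^ 2 = (norm (z - a) / r)\<^sup>2"
  by (simp add: power2_norm_eq_inner[symmetric] power_divide field_simps)

lemma bump_eq_1:
  assumes "0 < r" "norm (z - a) \<le> r"
  shows "bump a r z = 1"
proof -
  have "(norm (z - a) / r)\<^sup>2 \<le> 1"
    using assms by (auto intro!: power_le_one)
  then have "smooth_step ((norm (z - a) / r)\<^sup>2) = 1"
    using smooth_step_denominator_pos[of "(norm (z - a) / r)\<^sup>2"]
    by (simp add: smooth_step_def flat_def[of 0 "_ - 1"])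
  then show ?thesis
    by (simp add: bump_def bump_arg[OF assms(1)])
qed

lemma bump_eq_0:
  assumes "0 < r" "2 * r \<le> norm (z - a)"
  shows "bump a r z = 0"
proof -
  have "2 \<le> norm (z - a) / r"
    using assms by (simp add: field_simps)
  then have "2 ^ 2 \<le> (norm (z - a) / r)\<^sup>2"
    by (intro power_mono) auto
  then show ?thesis
    by (simp add: bump_def bump_arg[OF assms(1)] smooth_step_def flat_def[of 0 "4 - _"])
qed

section \<open>Test functions and integration over the plane\<close>

lemma open_nonzero_set:
  fixes f :: "'a::topological_space \<Rightarrow> 'b::real_normed_vector"
  assumes "continuous_on D f" "open D"
  shows "open {z \<in> D. f z \<noteq> 0}"
  using continuous_open_preimage[OF assms, of "- {0}"] by (simp add: vimage_def Int_def open_Compl)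

lemma continuous_measurable_lebesgue:
  "continuous_on UNIV f \<Longrightarrow> f \<in> borel_measurable lebesgue"
  by (intro measurable_completion) (simp add: borel_measurable_continuous_onI)

lemma integrable_continuous_compact:
  fixes f :: "complex \<Rightarrow> complex"
  assumes "continuous_on UNIV f" "compact K" "\<And>z. z \<notin> K \<Longrightarrow> f z = 0"
  shows "integrable lebesgue f"
proof -
  have "integrable lborel (\<lambda>z. indicator K z *\<^sub>R f z)"
    using assms by (intro borel_integrable_compact continuous_on_subset[OF assms(1)]) auto
  moreover have "(\<lambda>z. indicator K z *\<^sub>R f z) = f"
    using assms(3) by (auto simp: indicator_def fun_eq_iff)
  ultimately show ?thesis
    using assms(1) by (subst integrable_completion) (simp_all add: borel_measurable_continuous_onI)
qed

lemma bounded_continuous_compact_support: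
  fixes f :: "'a::topological_space \<Rightarrow> 'b::real_normed_vector"
  assumes "continuous_on UNIV f" "compact K" "\<And>z. z \<notin> K \<Longrightarrow> f z = 0"
  shows "\<exists>B>0. \<forall>z. norm (f z) \<le> B"
proof -
  have "bounded (f ` K)"
    using assms by (intro compact_imp_bounded compact_continuous_image continuous_on_subset[OF assms(1)]) auto
  then obtain B where B: "B > 0" "\<And>z. z \<in> K \<Longrightarrow> norm (f z) \<le> B"
    by (auto simp: bounded_pos)
  have "norm (f z) \<le> B" for z
    using assms(3)[of z] B by (cases "z \<in> K") auto
  with B(1) show ?thesis by blast
qed

lemma integral_translate:
  fixes f :: "complex \<Rightarrow> complex"
  assumes "f \<in> borel_measurable borel"
  shows "(\<integral>z. f (a + z) \<partial>lebesgue) = (\<integral>z. f z \<partial>lebesgue)"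
proof -
  have "(\<integral>z. f z \<partial>lborel) = (\<integral>z. f z \<partial>(distr lborel borel ((+) a)))"
    by (simp add: lborel_distr_plus)
  also have "\<dots> = (\<integral>z. f (a + z) \<partial>lborel)"
    using assms by (subst integral_distr) auto
  finally show ?thesis
    using assms by (simp add: integral_completion)
qed

lemma nn_integral_translate:
  fixes f :: "complex \<Rightarrow> ennreal"
  assumes "f \<in> borel_measurable borel"
  shows "(\<integral>\<^sup>+z. f (a + z) \<partial>lborel) = (\<integral>\<^sup>+z. f z \<partial>lborel)"
proof -
  have "(\<integral>\<^sup>+z. f z \<partial>lborel) = (\<integral>\<^sup>+z. f z \<partial>(distr lborel borel ((+) a)))"
    by (simp add: lborel_distr_plus)
  also have "\<dots> = (\<integral>\<^sup>+z. f (a + z) \<partial>lborel)"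
    using assms by (subst nn_integral_distr) auto
  finally show ?thesis ..
qed

lemma integral_affine:
  fixes f :: "complex \<Rightarrow> complex"
  assumes [measurable]: "f \<in> borel_measurable borel" and c: "c > 0"
  shows "(\<integral>z. f z \<partial>lebesgue) = c\<^sup>2 *\<^sub>R (\<integral>z. f (a + c *\<^sub>R z) \<partial>lebesgue)"
proof -
  have "(\<integral>z. f z \<partial>lborel) = (\<integral>z. f z \<partial>(density (distr lborel borel (\<lambda>x. a + c *\<^sub>R x)) (\<lambda>_. \<bar>c\<bar>^DIM(complex))))"
    using lborel_affine[of c a] c by simp
  also have "\<dots> = (\<integral>z. c\<^sup>2 *\<^sub>R f (a + c *\<^sub>R z) \<partial>lborel)"
    using c by (subst integral_density) (auto simp: integral_distr)
  finally show ?thesis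
    by (simp add: integral_completion)
qed

lemma test_function_iff:
  "test_function U \<phi> \<longleftrightarrow>
    (\<forall>k. Ck k \<phi>) \<and> (\<exists>K. compact K \<and> K \<subseteq> U \<and> (\<forall>z. z \<notin> K \<longrightarrow> \<phi> z = 0))"
proof
  assume "test_function U \<phi>"
  then show "(\<forall>k. Ck k \<phi>) \<and> (\<exists>K. compact K \<and> K \<subseteq> U \<and> (\<forall>z. z \<notin> K \<longrightarrow> \<phi> z = 0))"
    unfolding test_function_def
    by (intro conjI exI[of _ "closure {z. \<phi> z \<noteq> 0}"]) (use closure_subset[of "{z. \<phi> z \<noteq> 0}"] in auto)
next
  assume r: "(\<forall>k. Ck k \<phi>) \<and> (\<exists>K. compact K \<and> K \<subseteq> U \<and> (\<forall>z. z \<notin> K \<longrightarrow> \<phi> z = 0))"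
  then obtain K where K: "compact K" "K \<subseteq> U" "\<And>z. z \<notin> K \<Longrightarrow> \<phi> z = 0"
    by blast
  have "closure {z. \<phi> z \<noteq> 0} \<subseteq> K"
    using K by (intro closure_minimal compact_imp_closed) auto
  moreover from this have "compact (closure {z. \<phi> z \<noteq> 0})"
    using bounded_subset[OF compact_imp_bounded[OF K(1)]] by (simp add: compact_eq_bounded_closed)
  ultimately show "test_function U \<phi>"
    using K r unfolding test_function_def by auto
qed

lemma has_derivative_zero_outside:
  fixes f :: "'a::real_normed_vector \<Rightarrow> 'b::real_normed_vector"
  assumes "closed K" "\<And>z. z \<notin> K \<Longrightarrow> f z = 0" "z \<notin> K"
  shows "(f has_derivative (\<lambda>_. 0)) (at z)"
  by (rule has_derivative_transform_within_open[of "\<lambda>_. 0" _ _ UNIV "- K"])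
    (use assms in \<open>auto simp: open_Compl\<close>)

lemma frechet_derivative_zero_outside:
  assumes "closed K" "\<And>z. z \<notin> K \<Longrightarrow> f z = 0" "z \<notin> K"
  shows "frechet_derivative f (at z) v = 0"
proof -
  have "(f has_derivative (\<lambda>_. 0)) (at z)"
    by (rule has_derivative_zero_outside[OF assms(1) _ assms(3)]) (rule assms(2))
  then have "(\<lambda>_. 0) = frechet_derivative f (at z)"
    by (rule frechet_derivative_at)
  then show ?thesis
    by (rule fun_cong[THEN sym])
qed

lemma dbar_zero_outside:
  assumes "closed K" "\<And>z. z \<notin> K \<Longrightarrow> f z = 0" "z \<notin> K"
  shows "dbar f z = 0"
proof -
  have "frechet_derivative f (at z) v = 0" for v
    by (rule frechet_derivative_zero_outside[OF assms(1) _ assms(3)]) (rule assms(2))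
  then show ?thesis
    unfolding dbar_def by simp
qed

lemma test_function_support:
  assumes "test_function U \<phi>"
  shows "\<exists>K. compact K \<and> K \<subseteq> U \<and> (\<forall>z. z \<notin> K \<longrightarrow> \<phi> z = 0 \<and> dbar \<phi> z = 0)"
proof -
  from assms obtain K where K: "compact K" "K \<subseteq> U" "\<And>z. z \<notin> K \<Longrightarrow> \<phi> z = 0"
    unfolding test_function_iff by blast
  moreover have "dbar \<phi> z = 0" if "z \<notin> K" for z
    by (rule dbar_zero_outside[OF compact_imp_closed[OF K(1)] _ that]) (rule K(3))
  ultimately show ?thesis by blast
qed

lemma test_function_Ck: "test_function U \<phi> \<Longrightarrow> Ck k \<phi>"
  unfolding test_function_def by blast

lemma test_function_mult:
  assumes "test_function U \<phi>" "\<And>k. Ck k \<psi>"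
  shows "test_function U (\<lambda>z. \<phi> z * \<psi> z)"
proof -
  obtain K where "compact K" "K \<subseteq> U" "\<And>z. z \<notin> K \<Longrightarrow> \<phi> z = 0"
    using assms(1) unfolding test_function_iff by blast
  moreover have "Ck k (\<lambda>z. \<phi> z * \<psi> z)" for k
    using assms by (intro Ck_mult) (simp_all add: test_function_def)
  ultimately show ?thesis
    unfolding test_function_iff by (metis mult_zero_left)
qed

lemma test_function_mono: "test_function U \<phi> \<Longrightarrow> U \<subseteq> V \<Longrightarrow> test_function V \<phi>"
  unfolding test_function_def by blast

lemma Ck_dbar: "Ck (Suc k) \<phi> \<Longrightarrow> Ck k (dbar \<phi>)"
proof -
  assume a: "Ck (Suc k) \<phi>"
  have "Ck k (\<lambda>z. (frechet_derivative \<phi> (at z) 1 + \<i> * frechet_derivative \<phi> (at z) \<i>) * inverse 2)"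
    by (intro Ck_mult Ck_add Ck_const Ck_SucD[OF a])
  then show ?thesis
    unfolding dbar_def[abs_def] divide_inverse .
qed

lemma continuous_on_dbar: "Ck (Suc 0) \<phi> \<Longrightarrow> continuous_on S (dbar \<phi>)"
  by (rule Ck_imp_continuous_on[OF Ck_dbar])

lemma dbar_eqI:
  assumes "(f has_derivative D) (at z)"
  shows "dbar f z = (D 1 + \<i> * D \<i>) / 2"
  unfolding dbar_def frechet_derivative_at[OF assms, symmetric] ..

lemma dbar_mult:
  assumes "(f has_derivative D) (at z)" "(g has_derivative E) (at z)"
  shows "dbar (\<lambda>z. f z * g z) z = dbar f z * g z + f z * dbar g z"
  unfolding dbar_eqI[OF has_derivative_mult[OF assms]] dbar_eqI[OF assms(1)] dbar_eqI[OF assms(2)]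
  by (simp add: field_simps)

lemma dbar_mult_Ck:
  assumes "Ck (Suc 0) f" "Ck (Suc 0) g"
  shows "dbar (\<lambda>z. f z * g z) z = dbar f z * g z + f z * dbar g z"
  by (rule dbar_mult[OF Ck_Suc_has_derivative[OF assms(1)] Ck_Suc_has_derivative[OF assms(2)]])

text \<open>Translation invariance makes the integral of every difference quotient vanish, and the
  quotients converge dominatedly; this replaces the divergence theorem.\<close>

lemma has_vector_derivative_quotient:
  assumes "(g has_vector_derivative d) (at 0)"
  shows "((\<lambda>t. (g t - g 0) /\<^sub>R t) \<longlongrightarrow> d) (at 0)"
proof -
  have "((\<lambda>t. norm (g (0 + t) - g 0 - t *\<^sub>R d) / norm t) \<longlongrightarrow> 0) (at 0)"
    using assms unfolding has_vector_derivative_def has_derivative_at by blast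
  then have "((\<lambda>t. norm ((g t - g 0) /\<^sub>R t - d)) \<longlongrightarrow> 0) (at 0)"
  proof (rule Lim_transform_eventually)
    have "norm (g (0 + t) - g 0 - t *\<^sub>R d) / norm t = norm ((g t - g 0) /\<^sub>R t - d)" if "t \<noteq> 0" for t
    proof -
      have "(g t - g 0) /\<^sub>R t - d = (g t - g 0 - t *\<^sub>R d) /\<^sub>R t"
        using that by (simp add: scaleR_diff_right)
      then show ?thesis by (simp add: divide_inverse)
    qed
    then show "\<forall>\<^sub>F t in at 0. norm (g (0 + t) - g 0 - t *\<^sub>R d) / norm t = norm ((g t - g 0) /\<^sub>R t - d)"
      by (simp add: eventually_at_filter)
  qed
  then show ?thesis
    by (rule Lim_null[THEN iffD2, OF tendsto_norm_zero_cancel])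
qed

lemma integral_directional_derivative_eq_0:
  fixes \<psi> :: "complex \<Rightarrow> complex"
  assumes C1: "Ck (Suc 0) \<psi>" and K: "compact K" and out: "\<And>z. z \<notin> K \<Longrightarrow> \<psi> z = 0"
  shows "(\<integral>z. frechet_derivative \<psi> (at z) v \<partial>lebesgue) = 0"
proof -
  define G where "G z = frechet_derivative \<psi> (at z) v" for z
  have "Ck 0 G"
    unfolding G_def[abs_def] by (rule Ck_SucD[OF C1])
  then have G: "continuous_on UNIV G"
    by simp
  have G0: "G z = 0" if "z \<notin> K" for z
    unfolding G_def by (rule frechet_derivative_zero_outside[OF compact_imp_closed[OF K] _ that]) (rule out)
  have "\<exists>B>0. \<forall>z. norm (G z) \<le> B"
    by (rule bounded_continuous_compact_support[OF G K]) (rule G0)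
  then obtain B where B: "B > 0" "\<And>z. norm (G z) \<le> B"
    by blast
  have \<psi>: "continuous_on UNIV \<psi>"
    by (rule Ck_imp_continuous_on[OF C1])
  have int\<psi>: "integrable lebesgue \<psi>"
    by (rule integrable_continuous_compact[OF \<psi> K]) (rule out)
  define h where "h n = inverse (real (Suc n))" for n
  have h: "h n > 0" "h n \<le> 1" for n
    by (auto simp: h_def field_simps)
  define s where "s n z = (\<psi> (h n *\<^sub>R v + z) - \<psi> z) /\<^sub>R h n" for n z
  have int0: "(\<integral>z. s n z \<partial>lebesgue) = 0" for n
  proof -
    have "compact ((+) (- h n *\<^sub>R v) ` K)"
      using K by (rule compact_translation)
    moreover have "\<psi> (h n *\<^sub>R v + z) = 0" if "z \<notin> (+) (- h n *\<^sub>R v) ` K" for z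
      using that by (intro out) (auto simp: image_iff)
    ultimately have "integrable lebesgue (\<lambda>z. \<psi> (h n *\<^sub>R v + z))"
      by (intro integrable_continuous_compact[where K = "(+) (- h n *\<^sub>R v) ` K"] continuous_on_compose2[OF \<psi>] continuous_intros) auto
    moreover have "(\<integral>z. \<psi> (h n *\<^sub>R v + z) \<partial>lebesgue) = (\<integral>z. \<psi> z \<partial>lebesgue)"
      using \<psi> by (intro integral_translate borel_measurable_continuous_onI)
    ultimately show ?thesis
      using int\<psi> unfolding s_def by simp
  qed
  obtain R where R: "K \<subseteq> ball 0 R"
    using compact_imp_bounded[OF K] bounded_subset_ballD by blast
  define K' where "K' = cball (0::complex) (R + norm v)"
  have K': "compact K'"
    by (simp add: K'_def)
  have s0: "s n z = 0" if "z \<notin> K'" for n z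
  proof -
    have "norm (h n *\<^sub>R v) \<le> norm v"
      using h[of n] by (simp add: mult_left_le_one_le)
    moreover have "norm z > R + norm v"
      using that by (simp add: K'_def)
    moreover have "norm z \<le> norm (h n *\<^sub>R v + z) + norm (h n *\<^sub>R v)"
      using norm_triangle_ineq4[of "h n *\<^sub>R v + z" "h n *\<^sub>R v"] by simp
    ultimately have "R \<le> norm (h n *\<^sub>R v + z)" "R \<le> norm z"
      using norm_ge_zero[of v] by linarith+
    then have "h n *\<^sub>R v + z \<notin> K" "z \<notin> K"
      using R by fastforce+
    then show ?thesis
      by (simp add: s_def out)
  qed
  have bound: "norm (s n z) \<le> B" for n z
  proof -
    have "norm (\<psi> (z + h n *\<^sub>R v) - \<psi> (z + 0 *\<^sub>R v)) \<le> B * norm (h n - 0)"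
    proof (rule differentiable_bound[where S = UNIV and f = "\<lambda>t. \<psi> (z + t *\<^sub>R v)" and f' = "\<lambda>t h. h *\<^sub>R G (z + t *\<^sub>R v)"])
      fix t :: real
      have "((\<lambda>t. \<psi> (z + t *\<^sub>R v)) has_derivative (\<lambda>h. frechet_derivative \<psi> (at (z + t *\<^sub>R v)) (h *\<^sub>R v))) (at t)"
        by (rule has_derivative_compose[OF _ Ck_Suc_has_derivative[OF C1]]) (auto intro!: derivative_eq_intros)
      then show "((\<lambda>t. \<psi> (z + t *\<^sub>R v)) has_derivative (\<lambda>h. h *\<^sub>R G (z + t *\<^sub>R v))) (at t within UNIV)"
        unfolding G_def linear_cmul[OF has_derivative_linear[OF Ck_Suc_has_derivative[OF C1]]] by simp
      show "onorm (\<lambda>h. h *\<^sub>R G (z + t *\<^sub>R v)) \<le> B"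
      proof (rule onorm_bound)
        show "norm (h *\<^sub>R G (z + t *\<^sub>R v)) \<le> B * norm h" for h
          using mult_left_mono[OF B(2), of "\<bar>h\<bar>"] by (simp add: mult.commute)
      qed (use B in simp)
    qed auto
    then show ?thesis
      using h[of n] by (simp add: s_def add.commute divide_inverse_commute[symmetric] pos_divide_le_eq)
  qed
  have lim: "(\<lambda>n. s n z) \<longlonglongrightarrow> G z" for z
  proof -
    have "((\<lambda>t. \<psi> (z + t *\<^sub>R v)) has_vector_derivative G z) (at 0)"
    proof -
      have "((\<lambda>t. \<psi> (z + t *\<^sub>R v)) has_derivative (\<lambda>h. frechet_derivative \<psi> (at (z + 0 *\<^sub>R v)) (h *\<^sub>R v))) (at 0)"
        by (rule has_derivative_compose[OF _ Ck_Suc_has_derivative[OF C1]]) (auto intro!: derivative_eq_intros)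
      then show ?thesis
        unfolding G_def linear_cmul[OF has_derivative_linear[OF Ck_Suc_has_derivative[OF C1]]] has_vector_derivative_def
        by simp
    qed
    from has_vector_derivative_quotient[OF this]
    have "((\<lambda>t. (\<psi> (z + t *\<^sub>R v) - \<psi> z) /\<^sub>R t) \<longlongrightarrow> G z) (at 0)"
      by simp
    moreover have "filterlim h (at 0) sequentially"
    proof (rule filterlim_atI)
      show "h \<longlonglongrightarrow> 0"
        unfolding h_def[abs_def] by (rule LIMSEQ_inverse_real_of_nat)
      show "\<forall>\<^sub>F n in sequentially. h n \<noteq> 0"
        using less_imp_neq[OF h(1), symmetric] by (rule always_eventually[OF allI])
    qed
    ultimately have "(\<lambda>n. (\<psi> (z + h n *\<^sub>R v) - \<psi> z) /\<^sub>R h n) \<longlonglongrightarrow> G z"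
      by (rule filterlim_compose)
    then show ?thesis
      by (simp add: s_def add.commute)
  qed
  have "(\<lambda>n. \<integral>z. s n z \<partial>lebesgue) \<longlonglongrightarrow> (\<integral>z. G z \<partial>lebesgue)"
  proof (rule integral_dominated_convergence[where w = "\<lambda>z. indicator K' z *\<^sub>R B"])
    show "G \<in> borel_measurable lebesgue"
      by (rule continuous_measurable_lebesgue[OF G])
    show "s n \<in> borel_measurable lebesgue" for n
      unfolding s_def[abs_def]
      by (intro continuous_measurable_lebesgue continuous_intros continuous_on_compose2[OF \<psi>]) auto
    have "integrable lborel (\<lambda>z. indicator K' z *\<^sub>R B)"
      by (intro borel_integrable_compact K') auto
    then show "integrable lebesgue (\<lambda>z. indicator K' z *\<^sub>R B)"
      using borel_compact[OF K'] by (subst integrable_completion) auto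
    show "AE z in lebesgue. (\<lambda>n. s n z) \<longlonglongrightarrow> G z"
      using lim by simp
    show "AE z in lebesgue. norm (s n z) \<le> indicator K' z *\<^sub>R B" for n
      using bound s0 by (auto simp: indicator_def)
  qed
  then show ?thesis
    unfolding int0 G_def[symmetric] by (simp add: LIMSEQ_const_iff)
qed

lemma integral_dbar_eq_0:
  fixes \<psi> :: "complex \<Rightarrow> complex"
  assumes C1: "Ck (Suc 0) \<psi>" and K: "compact K" and out: "\<And>z. z \<notin> K \<Longrightarrow> \<psi> z = 0"
  shows "(\<integral>z. dbar \<psi> z \<partial>lebesgue) = 0"
proof -
  have "frechet_derivative \<psi> (at z) v = 0" if "z \<notin> K" for z v
    by (rule frechet_derivative_zero_outside[OF compact_imp_closed[OF K] _ that]) (rule out)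
  moreover have "continuous_on UNIV (\<lambda>z. frechet_derivative \<psi> (at z) v)" for v
    using Ck_SucD[OF C1, of v] by simp
  ultimately have "integrable lebesgue (\<lambda>z. frechet_derivative \<psi> (at z) v)" for v
    by (intro integrable_continuous_compact[OF _ K])
  then show ?thesis
    using integral_directional_derivative_eq_0[OF C1 K out]
    unfolding dbar_def by simp
qed

lemma locally_integrable_mult_continuous:
  assumes v: "locally_integrable U v" and t: "continuous_on U t"
  shows "locally_integrable U (\<lambda>z. t z * v z)"
  unfolding locally_integrable_def
proof safe
  fix K assume K: "compact K" "K \<subseteq> U"
  have i: "integrable (lebesgue_on K) v"
    using v K by (simp add: locally_integrable_def)
  have tK: "continuous_on K t"
    using t K(2) by (rule continuous_on_subset)
  have "bounded (t ` K)"
    using tK K(1) by (intro compact_imp_bounded compact_continuous_image)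
  then obtain B where B: "B > 0" "\<And>z. z \<in> K \<Longrightarrow> norm (t z) \<le> B"
    by (auto simp: bounded_pos)
  have Kl: "K \<in> sets lebesgue"
    using borel_compact[OF K(1)] by simp
  have mt: "t \<in> borel_measurable (lebesgue_on K)"
    by (rule continuous_imp_measurable_on_sets_lebesgue[OF tK Kl])
  show "integrable (lebesgue_on K) (\<lambda>z. t z * v z)"
  proof (rule Bochner_Integration.integrable_bound)
    show "integrable (lebesgue_on K) (\<lambda>z. B * norm (v z))"
      using i by simp
    show "(\<lambda>z. t z * v z) \<in> borel_measurable (lebesgue_on K)"
      by (intro borel_measurable_times mt borel_measurable_integrable[OF i])
    show "AE z in lebesgue_on K. norm (t z * v z) \<le> norm (B * norm (v z))"
    proof (rule AE_I2)
      fix z assume "z \<in> space (lebesgue_on K)"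
      then have "norm (t z) * norm (v z) \<le> B * norm (v z)"
        using B(2)[of z] by (intro mult_right_mono) auto
      then show "norm (t z * v z) \<le> norm (B * norm (v z))"
        using B(1) by (simp add: norm_mult abs_mult)
    qed
  qed
qed

text \<open>Test functions vanish off a compact subset of their domain, so pairings are taken over the
  whole plane.\<close>

lemma integrable_locally_integrable_mult:
  assumes "locally_integrable U u" "compact K" "K \<subseteq> U" "continuous_on UNIV \<psi>" "\<And>z. z \<notin> K \<Longrightarrow> \<psi> z = 0"
  shows "integrable lebesgue (\<lambda>z. u z * \<psi> z)"
proof -
  have "locally_integrable U (\<lambda>z. \<psi> z * u z)"
    by (rule locally_integrable_mult_continuous[OF assms(1) continuous_on_subset[OF assms(4)]]) simp
  then have "integrable (lebesgue_on K) (\<lambda>z. \<psi> z * u z)"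
    using assms(2,3) by (simp add: locally_integrable_def)
  moreover have "K \<in> sets lebesgue"
    using borel_compact[OF assms(2)] by simp
  ultimately have "integrable lebesgue (\<lambda>z. indicator K z *\<^sub>R (\<psi> z * u z))"
    by (simp add: integrable_restrict_space)
  moreover have "(\<lambda>z. indicator K z *\<^sub>R (\<psi> z * u z)) = (\<lambda>z. u z * \<psi> z)"
    using assms(5) by (auto simp: fun_eq_iff indicator_def)
  ultimately show ?thesis by simp
qed

lemma integrable_mult_test:
  assumes "locally_integrable U u" "test_function U \<phi>"
  shows "integrable lebesgue (\<lambda>z. u z * \<phi> z)" "integrable lebesgue (\<lambda>z. u z * dbar \<phi> z)"
proof -
  obtain K where "compact K" "K \<subseteq> U" "\<And>z. z \<notin> K \<Longrightarrow> \<phi> z = 0" "\<And>z. z \<notin> K \<Longrightarrow> dbar \<phi> z = 0"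
    using test_function_support[OF assms(2)] by blast
  then show "integrable lebesgue (\<lambda>z. u z * \<phi> z)" "integrable lebesgue (\<lambda>z. u z * dbar \<phi> z)"
    using integrable_locally_integrable_mult[OF assms(1)]
      Ck_imp_continuous_on[OF test_function_Ck[OF assms(2)]] continuous_on_dbar[OF test_function_Ck[OF assms(2)]]
    by simp_all
qed

lemma regular_distribution_eq:
  assumes "U \<in> sets lebesgue" "\<And>z. z \<notin> U \<Longrightarrow> \<psi> z = 0"
  shows "regular_distribution U u \<psi> = (\<integral>z. u z * \<psi> z \<partial>lebesgue)"
proof -
  have "(\<lambda>z. indicator U z *\<^sub>R (u z * \<psi> z)) = (\<lambda>z. u z * \<psi> z)"
    using assms(2) by (auto simp: fun_eq_iff indicator_def)
  then show ?thesis
    unfolding regular_distribution_def using assms(1) by (simp add: integral_restrict_space)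
qed

lemma dbar_eq_distributionally_iff:
  assumes "open U"
  shows "dbar_eq_distributionally U u v \<longleftrightarrow>
    locally_integrable U u \<and> locally_integrable U v \<and>
    (\<forall>\<phi>. test_function U \<phi> \<longrightarrow> (\<integral>z. u z * dbar \<phi> z \<partial>lebesgue) = - (\<integral>z. v z * \<phi> z \<partial>lebesgue))"
proof -
  have U: "U \<in> sets lebesgue"
    using assms by simp
  have "regular_distribution U u (dbar \<phi>) = (\<integral>z. u z * dbar \<phi> z \<partial>lebesgue)"
    "regular_distribution U v \<phi> = (\<integral>z. v z * \<phi> z \<partial>lebesgue)" if t: "test_function U \<phi>" for \<phi>
  proof -
    obtain K where "compact K" "K \<subseteq> U" "\<And>z. z \<notin> K \<Longrightarrow> \<phi> z = 0" "\<And>z. z \<notin> K \<Longrightarrow> dbar \<phi> z = 0"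
      using test_function_support[OF t] by blast
    then have "\<And>z. z \<notin> U \<Longrightarrow> \<phi> z = 0" "\<And>z. z \<notin> U \<Longrightarrow> dbar \<phi> z = 0"
      by blast+
    then show "regular_distribution U u (dbar \<phi>) = (\<integral>z. u z * dbar \<phi> z \<partial>lebesgue)"
      "regular_distribution U v \<phi> = (\<integral>z. v z * \<phi> z \<partial>lebesgue)"
      using regular_distribution_eq[OF U, of "dbar \<phi>" u] regular_distribution_eq[OF U, of \<phi> v] by simp_all
  qed
  then have "distributional_dbar (regular_distribution U u) \<phi> = regular_distribution U v \<phi> \<longleftrightarrow>
      (\<integral>z. u z * dbar \<phi> z \<partial>lebesgue) = - (\<integral>z. v z * \<phi> z \<partial>lebesgue)" if "test_function U \<phi>" for \<phi>
    unfolding distributional_dbar_def using that neg_equal_iff_equal[of "\<integral>z. u z * dbar \<phi> z \<partial>lebesgue" "- (\<integral>z. v z * \<phi> z \<partial>lebesgue)"]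
    by simp
  then show ?thesis
    unfolding dbar_eq_distributionally_def by (simp cong: conj_cong)
qed

lemma locally_integrable_continuous_on:
  assumes "continuous_on U u"
  shows "locally_integrable U u"
  unfolding locally_integrable_def
proof safe
  fix K assume K: "compact K" "K \<subseteq> U"
  have i: "integrable lborel (\<lambda>z. indicator K z *\<^sub>R u z)"
    using K assms by (intro borel_integrable_compact continuous_on_subset[OF assms])
  from i have "integrable lebesgue (\<lambda>z. indicator K z *\<^sub>R u z)"
    by (rule iffD2[OF integrable_completion[OF borel_measurable_integrable[OF i]]])
  then show "integrable (lebesgue_on K) u"
    using borel_compact[OF K(1)] by (simp add: integrable_restrict_space)
qed

section \<open>Integrability of powers of the distance\<close>

lemma nn_integral_even_finite:
  fixes f :: "real \<Rightarrow> ennreal"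
  assumes [measurable]: "f \<in> borel_measurable borel" and even: "\<And>x. f (- x) = f x"
    and fin: "(\<integral>\<^sup>+x. f x * indicator {0..} x \<partial>lborel) < \<infinity>"
  shows "(\<integral>\<^sup>+x. f x \<partial>lborel) < \<infinity>"
proof -
  define h where "h x = f x * indicator {0..} x" for x
  have [measurable]: "h \<in> borel_measurable borel"
    unfolding h_def[abs_def] by measurable
  have reflect: "(\<integral>\<^sup>+x. h (- x) \<partial>lborel) = (\<integral>\<^sup>+x. h x \<partial>lborel)"
    using nn_integral_real_affine[of h "-1" 0] by simp
  have "f x = h x \<or> f x = h (- x)" for x
    by (cases "0 \<le> x") (auto simp: h_def even)
  then have "f x \<le> h x + h (- x)" for x
    by (metis add_increasing add_increasing2 order_refl zero_le)
  then have "(\<integral>\<^sup>+x. f x \<partial>lborel) \<le> (\<integral>\<^sup>+x. h x + h (- x) \<partial>lborel)"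
    by (intro nn_integral_mono)
  also have "\<dots> = (\<integral>\<^sup>+x. h x \<partial>lborel) + (\<integral>\<^sup>+x. h (- x) \<partial>lborel)"
    by (intro nn_integral_add) auto
  also have "\<dots> < \<infinity>"
    using fin[folded h_def] by (simp add: reflect)
  finally show ?thesis .
qed

lemma nn_integral_abs_powr_finite:
  assumes "0 < \<sigma>" "\<sigma> < 1"
  shows "(\<integral>\<^sup>+x. ennreal (\<bar>x\<bar> powr (-\<sigma>)) * indicator {-1..1} x \<partial>lborel) < \<infinity>"
proof (rule nn_integral_even_finite)
  have "((\<lambda>x. x powr (-\<sigma>)) has_integral (1 powr (-\<sigma> + 1) / (-\<sigma> + 1))) {0..1}"
    using assms by (intro has_integral_powr_from_0) auto
  then have "(\<integral>\<^sup>+x. ennreal (x powr (-\<sigma>)) * indicator {0..1} x \<partial>lborel) = ennreal (1 powr (-\<sigma> + 1) / (-\<sigma> + 1))"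
    by (intro nn_integral_has_integral_lebesgue') auto
  then have "(\<integral>\<^sup>+x. ennreal (x powr (-\<sigma>)) * indicator {0..1} x \<partial>lborel) < \<infinity>"
    by simp
  also have "(\<integral>\<^sup>+x. ennreal (x powr (-\<sigma>)) * indicator {0..1} x \<partial>lborel)
      = (\<integral>\<^sup>+x. (ennreal (\<bar>x\<bar> powr (-\<sigma>)) * indicator {-1..1} x) * indicator {0..} x \<partial>lborel)"
    by (intro nn_integral_cong) (auto simp: indicator_def)
  finally show "(\<integral>\<^sup>+x. (ennreal (\<bar>x\<bar> powr (-\<sigma>)) * indicator {-1..1} x) * indicator {0..} x \<partial>lborel) < \<infinity>" .
qed (auto simp: indicator_def)

lemma nn_integral_inverse_1_plus_square_finite:
  "(\<integral>\<^sup>+x. ennreal (inverse (1 + x\<^sup>2)) \<partial>(lborel :: real measure)) < \<infinity>"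
proof (rule nn_integral_even_finite)
  have "(\<integral>\<^sup>+x. ennreal (inverse (1 + x\<^sup>2)) * indicator {0..} x \<partial>lborel) = ennreal (pi / 2 - arctan 0)"
    by (rule nn_integral_FTC_atLeast) (auto intro!: DERIV_arctan tendsto_arctan_at_top)
  then show "(\<integral>\<^sup>+x. ennreal (inverse (1 + x\<^sup>2)) * indicator {0..} x \<partial>(lborel :: real measure)) < \<infinity>"
    by simp
qed auto

lemma nn_integral_Re_Im_product:
  fixes f :: "real \<Rightarrow> ennreal"
  assumes "f \<in> borel_measurable borel"
  shows "(\<integral>\<^sup>+z. f (Re z) * f (Im z) \<partial>lborel) = (\<integral>\<^sup>+x. f x \<partial>lborel) * (\<integral>\<^sup>+x. f x \<partial>lborel)"
proof -
  have "(\<Prod>b\<in>Basis. f (z \<bullet> b)) = f (Re z) * f (Im z)" for z :: complex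
    by (simp add: Basis_complex_def inner_complex_def)
  moreover have "(\<integral>\<^sup>+z. (\<Prod>b\<in>Basis. f (z \<bullet> b)) \<partial>(lborel :: complex measure)) = (\<Prod>b\<in>(Basis :: complex set). (\<integral>\<^sup>+x. f x \<partial>lborel))"
    using assms by (intro nn_integral_lborel_prod) auto
  ultimately show ?thesis
    by (simp add: power2_eq_square)
qed

text \<open>Since |z| dominates both |Re z| and |Im z|, the kernel is at most a product of two
  one-dimensional powers with exponent below 1.\<close>

lemma nn_integral_norm_powr_unit_disc_finite:
  assumes "0 < \<tau>" "\<tau> < 2"
  shows "(\<integral>\<^sup>+z. ennreal (norm z powr (-\<tau>)) * indicator (cball 0 1) z \<partial>(lborel :: complex measure)) < \<infinity>"
proof -
  define g where "g x = ennreal (\<bar>x\<bar> powr (-(\<tau> / 2))) * indicator {-1..1} x" for x :: real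
  \<comment> \<open>The value at the origin is raised so that the product bound below also holds on the axes,
    where powr returns 0.\<close>
  define f where "f x = (if x = 0 then top else g x)" for x :: real
  have [measurable]: "g \<in> borel_measurable borel"
    unfolding g_def[abs_def] by measurable
  have [measurable]: "f \<in> borel_measurable borel"
    unfolding f_def[abs_def] by measurable
  have "(\<integral>\<^sup>+x. f x \<partial>lborel) = (\<integral>\<^sup>+x. g x \<partial>lborel)"
    by (intro nn_integral_cong_AE eventually_mono[OF AE_lborel_singleton[of 0]]) (simp add: f_def)
  also have "\<dots> < \<infinity>"
    unfolding g_def using assms by (intro nn_integral_abs_powr_finite) auto
  finally have fin: "(\<integral>\<^sup>+x. f x \<partial>lborel) < \<infinity>" .
  have "ennreal (norm z powr (-\<tau>)) * indicator (cball 0 1) z \<le> f (Re z) * f (Im z)" for z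
  proof (cases "z = 0 \<or> norm z > 1")
    case True
    then show ?thesis by auto
  next
    case False
    then have z: "z \<noteq> 0" "norm z \<le> 1" "\<bar>Re z\<bar> \<le> 1" "\<bar>Im z\<bar> \<le> 1"
      using abs_Re_le_cmod[of z] abs_Im_le_cmod[of z] by linarith+
    have pos: "0 < f x" if "\<bar>x\<bar> \<le> 1" for x
      using that by (auto simp: f_def g_def indicator_def abs_le_iff ennreal_zero_less_top)
    show ?thesis
    proof (cases "Re z = 0 \<or> Im z = 0")
      case True
      have "f (Re z) * f (Im z) = top"
      proof -
        have "f 0 = top" "f (Re z) \<noteq> 0" "f (Im z) \<noteq> 0"
          using pos[OF z(3)] pos[OF z(4)] by (auto simp: f_def)
        then show ?thesis
          using True by (auto simp: ennreal_top_mult ennreal_mult_top)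
      qed
      then show ?thesis by simp
    next
      case False
      have "norm z powr (-\<tau>) = norm z powr (-(\<tau> / 2)) * norm z powr (-(\<tau> / 2))"
        by (simp flip: powr_add)
      also have "\<dots> \<le> \<bar>Re z\<bar> powr (-(\<tau> / 2)) * \<bar>Im z\<bar> powr (-(\<tau> / 2))"
        using False assms z by (intro mult_mono powr_mono2' abs_Re_le_cmod abs_Im_le_cmod) auto
      finally show ?thesis
        using False z by (auto simp: f_def g_def indicator_def abs_le_iff ennreal_mult[symmetric] intro!: ennreal_leI)
    qed
  qed
  then have "(\<integral>\<^sup>+z. ennreal (norm z powr (-\<tau>)) * indicator (cball 0 1) z \<partial>(lborel :: complex measure))
      \<le> (\<integral>\<^sup>+z. f (Re z) * f (Im z) \<partial>lborel)"
    by (intro nn_integral_mono)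
  also have "\<dots> = (\<integral>\<^sup>+x. f x \<partial>lborel) * (\<integral>\<^sup>+x. f x \<partial>lborel)"
    by (rule nn_integral_Re_Im_product) measurable
  also have "\<dots> < \<infinity>"
    using fin by (simp add: ennreal_mult_less_top)
  finally show ?thesis .
qed

text \<open>Within distance 1 of z the integral is a translate of the one at the origin; farther away the
  kernel is at most 1. Hence the bound is uniform in z.\<close>

lemma nn_integral_norm_powr_bounded:
  assumes "0 < \<tau>" "\<tau> < 2" and [measurable]: "S \<in> sets borel" and "emeasure lborel S < \<infinity>"
  shows "\<exists>C\<ge>0. \<forall>z::complex. (\<integral>\<^sup>+w. ennreal (norm (z - w) powr (-\<tau>)) * indicator S w \<partial>lborel) \<le> ennreal C"
proof -
  define I where "I = (\<integral>\<^sup>+z. ennreal (norm z powr (-\<tau>)) * indicator (cball 0 1) z \<partial>(lborel :: complex measure))"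
  have [measurable]: "cball (0::complex) 1 \<in> sets borel"
    by simp
  have I: "I < \<infinity>"
    unfolding I_def by (rule nn_integral_norm_powr_unit_disc_finite[OF assms(1,2)])
  have "(\<integral>\<^sup>+w. ennreal (norm (z - w) powr (-\<tau>)) * indicator S w \<partial>lborel) \<le> I + emeasure lborel S" for z
  proof -
    have "ennreal (norm (z - w) powr (-\<tau>)) * indicator S w
        \<le> ennreal (norm (-z + w) powr (-\<tau>)) * indicator (cball 0 1) (-z + w) + indicator S w" for w
    proof (cases "norm (-z + w) \<le> 1")
      case True
      then show ?thesis
        by (auto simp: indicator_def norm_minus_commute)
    next
      case False
      then have "norm (z - w) powr (-\<tau>) \<le> 1 powr (-\<tau>)"
        using assms(1) by (intro powr_mono2') (auto simp: norm_minus_commute)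
      then show ?thesis
        using False by (auto simp: indicator_def ennreal_le_1)
    qed
    then have "(\<integral>\<^sup>+w. ennreal (norm (z - w) powr (-\<tau>)) * indicator S w \<partial>lborel)
        \<le> (\<integral>\<^sup>+w. ennreal (norm (-z + w) powr (-\<tau>)) * indicator (cball 0 1) (-z + w) + indicator S w \<partial>lborel)"
      by (intro nn_integral_mono)
    also have "\<dots> = (\<integral>\<^sup>+w. ennreal (norm (-z + w) powr (-\<tau>)) * indicator (cball 0 1) (-z + w) \<partial>lborel) + emeasure lborel S"
      by (subst nn_integral_add) (simp_all, measurable)
    also have "(\<integral>\<^sup>+w. ennreal (norm (-z + w) powr (-\<tau>)) * indicator (cball 0 1) (-z + w) \<partial>lborel) = I"
      unfolding I_def by (rule nn_integral_translate) measurable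
    finally show ?thesis .
  qed
  moreover have "I + emeasure lborel S = ennreal (enn2real (I + emeasure lborel S))"
    using I assms(4) by (simp add: less_top)
  ultimately show ?thesis
    by (intro exI[of _ "enn2real (I + emeasure lborel S)"]) simp
qed

section \<open>The regularised Cauchy kernel\<close>

text \<open>The dbar-derivative of the regularised kernel with parameter 1 and pole 0; see
  dbar_reg_kernel.\<close>

definition mass_density :: "complex \<Rightarrow> real" where
  "mass_density z = inverse (1 + (norm z)\<^sup>2) ^ 2"

text \<open>The number pi. It enters as the total mass of an approximate identity.\<close>

definition cauchy_mass :: real where
  "cauchy_mass = (\<integral>z. mass_density z \<partial>lebesgue)"

lemma mass_density_pos: "0 < mass_density z"
  unfolding mass_density_def
  by (intro zero_less_power positive_imp_inverse_positive add_pos_nonneg) simp_all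

lemma continuous_mass_density: "continuous_on UNIV mass_density"
proof -
  have "1 + (norm z)\<^sup>2 \<noteq> 0" for z :: complex
    by (rule less_imp_neq[OF add_pos_nonneg, THEN not_sym]) simp_all
  then show ?thesis
    unfolding mass_density_def[abs_def] by (intro continuous_intros) auto
qed

lemma integrable_mass_density: "integrable lebesgue mass_density"
proof -
  have [measurable]: "mass_density \<in> borel_measurable borel"
    by (rule borel_measurable_continuous_onI[OF continuous_mass_density])
  have "mass_density z \<le> inverse (1 + (Re z)\<^sup>2) * inverse (1 + (Im z)\<^sup>2)" for z
  proof -
    have "(1 + (Re z)\<^sup>2) * (1 + (Im z)\<^sup>2) \<le> (1 + (norm z)\<^sup>2) ^ 2"
      unfolding cmod_power2 power2_eq_square[of "1 + _"]
      by (intro mult_mono) auto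
    moreover have "0 < (1 + (Re z)\<^sup>2) * (1 + (Im z)\<^sup>2)"
      by (intro mult_pos_pos) (auto intro: add_pos_nonneg)
    ultimately show ?thesis
      unfolding mass_density_def power_inverse[symmetric]
      by (metis inverse_mult_distrib le_imp_inverse_le power_inverse)
  qed
  then have "(\<integral>\<^sup>+z. ennreal (mass_density z) \<partial>lborel)
      \<le> (\<integral>\<^sup>+z. ennreal (inverse (1 + (Re z)\<^sup>2)) * ennreal (inverse (1 + (Im z)\<^sup>2)) \<partial>lborel)"
    by (intro nn_integral_mono) (simp add: ennreal_mult[symmetric] ennreal_leI add_nonneg_nonneg)
  also have "\<dots> < \<infinity>"
    using nn_integral_inverse_1_plus_square_finite
    by (subst nn_integral_Re_Im_product[of "\<lambda>x. ennreal (inverse (1 + x\<^sup>2))"]) (auto simp: ennreal_mult_less_top)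
  finally have "integrable lborel mass_density"
    using mass_density_pos by (intro integrableI_nonneg) (auto intro: less_imp_le)
  then show ?thesis
    by (subst integrable_completion) auto
qed

lemma cauchy_mass_pos: "0 < cauchy_mass"
proof -
  have "cauchy_mass \<noteq> 0"
  proof
    assume "cauchy_mass = 0"
    then have "AE z in lebesgue. mass_density z = 0"
      unfolding cauchy_mass_def
      using integral_nonneg_eq_0_iff_AE[OF integrable_mass_density] mass_density_pos less_imp_le by blast
    moreover have "mass_density z \<noteq> 0" for z
      using mass_density_pos[of z] by simp
    ultimately have "ae_filter (lebesgue :: complex measure) = bot"
      by (simp add: trivial_limit_def)
    then show False
      by (simp add: ae_filter_eq_bot_iff)
  qed
  moreover have "0 \<le> cauchy_mass"
    unfolding cauchy_mass_def using mass_density_pos by (intro integral_nonneg_AE) (auto intro: less_imp_le)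
  ultimately show ?thesis by simp
qed

text \<open>A smooth substitute for the Cauchy kernel 1 / (z - w). The squared distance is written as
  (z - w) * cnj (z - w) so that smoothness follows from the closure rules for products and
  inverses.\<close>

definition reg_kernel :: "real \<Rightarrow> complex \<Rightarrow> complex \<Rightarrow> complex" where
  "reg_kernel e w z = cnj (z - w) * inverse ((z - w) * cnj (z - w) + of_real (e\<^sup>2))"

lemma reg_kernel_denominator: "(z - w) * cnj (z - w) + of_real (e\<^sup>2) = of_real ((norm (z - w))\<^sup>2 + e\<^sup>2)"
  by (simp only: of_real_add complex_norm_square)

lemma reg_kernel_denominator_nonzero:
  assumes "e > 0"
  shows "(z - w) * cnj (z - w) + of_real (e\<^sup>2) \<noteq> 0"
proof -
  have "0 < (norm (z - w))\<^sup>2 + e\<^sup>2"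
    using assms by (intro add_nonneg_pos) auto
  then show ?thesis
    unfolding reg_kernel_denominator of_real_eq_0_iff by (rule less_imp_neq[THEN not_sym])
qed

lemma Ck_reg_kernel:
  assumes "e > 0"
  shows "Ck k (reg_kernel e w)"
proof -
  have "Ck k (\<lambda>z. z - w)"
    by (intro Ck_diff Ck_id Ck_const)
  moreover from Ck_bounded_linear_compose[OF bounded_linear_cnj this] have "Ck k (\<lambda>z. cnj (z - w))" .
  ultimately have "Ck k (\<lambda>z. cnj (z - w) * inverse ((z - w) * cnj (z - w) + of_real (e\<^sup>2)))"
    by (intro Ck_mult[of k "\<lambda>z. cnj (z - w)"] Ck_inverse reg_kernel_denominator_nonzero[OF assms]
        Ck_add[of k "\<lambda>z. (z - w) * cnj (z - w)"] Ck_mult[of k "\<lambda>z. z - w"] Ck_const)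
  then show ?thesis
    unfolding reg_kernel_def[abs_def] .
qed

lemma dbar_reg_kernel:
  assumes "e > 0"
  shows "dbar (reg_kernel e w) z = of_real (e\<^sup>2 * inverse ((norm (z - w))\<^sup>2 + e\<^sup>2) ^ 2)"
proof -
  define D where "D z = (z - w) * cnj (z - w) + of_real (e\<^sup>2)" for z
  have D: "D z \<noteq> 0"
    unfolding D_def by (rule reg_kernel_denominator_nonzero[OF assms])
  have c: "((\<lambda>z. cnj (z - w)) has_derivative (\<lambda>h. cnj h)) (at z)"
    by (intro bounded_linear.has_derivative[OF bounded_linear_cnj]) (auto intro!: derivative_eq_intros)
  have i: "((\<lambda>z. z - w) has_derivative (\<lambda>h. h)) (at z)"
    by (auto intro!: derivative_eq_intros)
  have "(D has_derivative (\<lambda>h. (z - w) * cnj h + h * cnj (z - w))) (at z)"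
    unfolding D_def[abs_def]
    by (rule has_derivative_eq_rhs[OF has_derivative_add[OF has_derivative_mult[OF i c] has_derivative_const]]) simp
  from has_derivative_mult[OF c Deriv.has_derivative_inverse[OF D this]]
  have der: "(reg_kernel e w has_derivative (\<lambda>h. cnj (z - w) * - (inverse (D z) * ((z - w) * cnj h + h * cnj (z - w)) * inverse (D z))
      + cnj h * inverse (D z))) (at z)"
    unfolding reg_kernel_def[abs_def] D_def[abs_def] .
  have alg: "(b * - (v * (a * cnj 1 + 1 * b) * v) + cnj 1 * v + \<i> * (b * - (v * (a * cnj \<i> + \<i> * b) * v) + cnj \<i> * v)) / 2
      = v - b * a * v * v" for a b v :: complex
    by (simp add: field_simps)
  have "dbar (reg_kernel e w) z = inverse (D z) - cnj (z - w) * (z - w) * inverse (D z) * inverse (D z)"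
    by (rule trans[OF dbar_eqI[OF der] alg])
  also have "\<dots> = (D z - cnj (z - w) * (z - w)) * inverse (D z) * inverse (D z)"
    using D by (simp add: left_diff_distrib)
  also have "\<dots> = of_real (e\<^sup>2) * inverse (D z) ^ 2"
    by (simp add: D_def mult.commute power2_eq_square mult.assoc)
  finally show ?thesis
    unfolding D_def reg_kernel_denominator by simp
qed

lemma norm_reg_kernel:
  "norm (reg_kernel e w z) = norm (z - w) * inverse ((norm (z - w))\<^sup>2 + e\<^sup>2)"
  unfolding reg_kernel_def reg_kernel_denominator norm_mult norm_inverse norm_of_real complex_mod_cnj
  by (simp add: abs_of_nonneg)

lemma norm_reg_kernel_le:
  assumes "e > 0"
  shows "norm (reg_kernel e w z) \<le> norm (1 / (z - w))" "norm (reg_kernel e w z) \<le> 1 / e"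
proof -
  define t where "t = norm (z - w)"
  have t: "t \<ge> 0"
    by (simp add: t_def)
  have p: "0 < t\<^sup>2 + e\<^sup>2"
    using assms by (intro add_nonneg_pos) auto
  have "t * inverse (t\<^sup>2 + e\<^sup>2) \<le> 1 / t"
    using t p by (cases "t = 0") (auto simp: field_simps power2_eq_square)
  then show "norm (reg_kernel e w z) \<le> norm (1 / (z - w))"
    by (simp add: norm_reg_kernel norm_divide t_def)
  have "2 * (t * e) \<le> t\<^sup>2 + e\<^sup>2" "0 \<le> t * e"
    using sum_squares_bound[of t e] assms t by (simp_all add: mult.assoc)
  then have "t * e \<le> t\<^sup>2 + e\<^sup>2"
    by linarith
  then show "norm (reg_kernel e w z) \<le> 1 / e"
    using p assms by (simp add: norm_reg_kernel t_def[symmetric] field_simps)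
qed

text \<open>In terms of t = norm (z - w) / e this says that t powr s is at most 1 + t^2.\<close>

lemma norm_cauchy_minus_reg_kernel_le:
  assumes e: "e > 0" and s: "0 < s" "s \<le> 2"
  shows "norm (1 / (z - w) - reg_kernel e w z) \<le> e powr s * norm (z - w) powr (-1 - s)"
proof (cases "z = w")
  case True
  then show ?thesis by (simp add: reg_kernel_def)
next
  case False
  define t where "t = norm (z - w)"
  have t: "t > 0"
    using False by (simp add: t_def)
  have p: "0 < t\<^sup>2 + e\<^sup>2"
    using assms by (intro add_nonneg_pos) auto
  define D where "D = (z - w) * cnj (z - w) + of_real (e\<^sup>2)"
  have D: "D \<noteq> 0" "norm D = t\<^sup>2 + e\<^sup>2"
  proof -
    show "D \<noteq> 0"
      unfolding D_def by (rule reg_kernel_denominator_nonzero[OF e])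
    show "norm D = t\<^sup>2 + e\<^sup>2"
      unfolding D_def reg_kernel_denominator norm_of_real t_def by simp
  qed
  have "1 / (z - w) - reg_kernel e w z = of_real (e\<^sup>2) / ((z - w) * D)"
    using False D(1) unfolding reg_kernel_def D_def[symmetric]
    by (simp add: field_simps) (simp add: D_def algebra_simps)
  then have n: "norm (1 / (z - w) - reg_kernel e w z) = e\<^sup>2 / (t * (t\<^sup>2 + e\<^sup>2))"
    using D(2) by (simp add: norm_divide norm_mult t_def norm_power)
  have "(t / e) powr s \<le> (t / e)\<^sup>2 + 1"
  proof (cases "t / e \<le> 1")
    case True
    then have "(t / e) powr s \<le> 1"
      using s t e by (intro powr_le1) auto
    then show ?thesis by (smt (verit) zero_le_power2)
  next
    case False
    then have "(t / e) powr s \<le> (t / e) powr 2"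
      using s by (intro powr_mono) auto
    then show ?thesis using t e by (simp add: powr_numeral)
  qed
  then have "t powr s / e powr s \<le> (t\<^sup>2 + e\<^sup>2) / e\<^sup>2"
    using t e by (simp add: powr_divide power_divide field_simps)
  then have k: "e\<^sup>2 * t powr s \<le> e powr s * (t\<^sup>2 + e\<^sup>2)"
    using e by (simp add: field_simps)
  have "e\<^sup>2 / (t * (t\<^sup>2 + e\<^sup>2)) \<le> e powr s / (t * t powr s)"
  proof (rule mult_imp_div_pos_le)
    show "0 < t * (t\<^sup>2 + e\<^sup>2)"
      using p t by simp
    have "e\<^sup>2 * (t * t powr s) \<le> e powr s * (t * (t\<^sup>2 + e\<^sup>2))"
      using mult_left_mono[OF k, of t] t by (simp add: mult_ac)
    then show "e\<^sup>2 \<le> e powr s / (t * t powr s) * (t * (t\<^sup>2 + e\<^sup>2))"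
      using t by (simp add: pos_le_divide_eq)
  qed
  also have "\<dots> = e powr s * t powr (-1 - s)"
    using t by (simp add: powr_diff powr_minus field_simps)
  finally show ?thesis
    unfolding n by (simp add: t_def)
qed

text \<open>The sequence along which the regularisation is removed.\<close>

definition reg_seq :: "nat \<Rightarrow> real" where
  "reg_seq n = inverse (real (Suc n))"

lemma reg_seq_pos: "reg_seq n > 0"
  by (simp add: reg_seq_def)

lemma reg_seq_tendsto: "reg_seq \<longlonglongrightarrow> 0"
  unfolding reg_seq_def[abs_def] by (rule LIMSEQ_inverse_real_of_nat)

lemma reg_kernel_tendsto: "(\<lambda>n. reg_kernel (reg_seq n) w z) \<longlonglongrightarrow> 1 / (z - w)"
proof (cases "z = w")
  case True
  then show ?thesis by (simp add: reg_kernel_def)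
next
  case False
  have "(\<lambda>n. cnj (z - w) * inverse ((z - w) * cnj (z - w) + of_real ((reg_seq n)\<^sup>2)))
      \<longlonglongrightarrow> cnj (z - w) * inverse ((z - w) * cnj (z - w) + of_real (0\<^sup>2))"
  proof (intro tendsto_intros reg_seq_tendsto)
    show "(z - w) * cnj (z - w) + of_real (0\<^sup>2) \<noteq> 0"
    proof -
      have "(z - w) * cnj (z - w) \<noteq> 0"
        using False by (intro no_zero_divisors) (simp_all del: complex_cnj_diff)
      then show ?thesis
        by (simp only: power_zero_numeral of_real_0 add_0_right not_False_eq_True)
    qed
  qed
  also have "cnj (z - w) * inverse ((z - w) * cnj (z - w) + of_real (0\<^sup>2)) = 1 / (z - w)"
  proof -
    have "b * inverse (a * b + of_real (0\<^sup>2)) = 1 / a" if "b \<noteq> 0" for a b :: complex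
      using that by (simp add: field_simps)
    then show ?thesis
      using False by (simp del: complex_cnj_diff)
  qed
  finally show ?thesis
    unfolding reg_kernel_def .
qed

lemma continuous_reg_kernel: "e > 0 \<Longrightarrow> continuous_on S (reg_kernel e w)"
  by (rule Ck_imp_continuous_on[OF Ck_reg_kernel])

text \<open>The densities dbar (reg_kernel e w) form an approximate identity at w,
  as the substitution z = w + e x shows.\<close>

lemma integral_dbar_reg_kernel_tendsto:
  fixes \<psi> :: "complex \<Rightarrow> complex"
  assumes \<psi>: "continuous_on UNIV \<psi>" and K: "compact K" and out: "\<And>z. z \<notin> K \<Longrightarrow> \<psi> z = 0"
  shows "(\<lambda>n. \<integral>z. \<psi> z * dbar (reg_kernel (reg_seq n) w) z \<partial>lebesgue) \<longlonglongrightarrow> of_real cauchy_mass * \<psi> w"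
proof -
  have "\<exists>B>0. \<forall>z. norm (\<psi> z) \<le> B"
    by (rule bounded_continuous_compact_support[OF \<psi> K]) (rule out)
  then obtain B where B: "B > 0" "\<And>z. norm (\<psi> z) \<le> B"
    by blast
  have eq: "(\<integral>z. \<psi> z * dbar (reg_kernel e w) z \<partial>lebesgue) = (\<integral>z. \<psi> (w + e *\<^sub>R z) * of_real (mass_density z) \<partial>lebesgue)"
    if e: "e > 0" for e
  proof -
    have "continuous_on UNIV (\<lambda>z. \<psi> z * dbar (reg_kernel e w) z)"
      by (intro continuous_on_mult \<psi> continuous_on_dbar Ck_reg_kernel e)
    then have "(\<integral>z. \<psi> z * dbar (reg_kernel e w) z \<partial>lebesgue)
        = e\<^sup>2 *\<^sub>R (\<integral>z. \<psi> (w + e *\<^sub>R z) * dbar (reg_kernel e w) (w + e *\<^sub>R z) \<partial>lebesgue)"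
      by (intro integral_affine borel_measurable_continuous_onI e)
    also have "\<dots> = (\<integral>z. e\<^sup>2 *\<^sub>R (\<psi> (w + e *\<^sub>R z) * dbar (reg_kernel e w) (w + e *\<^sub>R z)) \<partial>lebesgue)"
      by simp
    also have "\<dots> = (\<integral>z. \<psi> (w + e *\<^sub>R z) * of_real (mass_density z) \<partial>lebesgue)"
    proof (rule Bochner_Integration.integral_cong[OF refl])
      fix z
      have norm_eq: "(norm (w + e *\<^sub>R z - w))\<^sup>2 + e\<^sup>2 = e\<^sup>2 * (1 + (norm z)\<^sup>2)"
        using e by (simp add: power_mult_distrib algebra_simps)
      have alg: "a * (a * inverse (a * N) ^ 2) = inverse N ^ 2" if "a \<noteq> 0" for a N :: real
        using that by (cases "N = 0") (auto simp: power2_eq_square field_simps)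
      have "e\<^sup>2 * (e\<^sup>2 * inverse ((norm (w + e *\<^sub>R z - w))\<^sup>2 + e\<^sup>2) ^ 2) = mass_density z"
        unfolding mass_density_def norm_eq by (rule alg) (use e in simp)
      then show "e\<^sup>2 *\<^sub>R (\<psi> (w + e *\<^sub>R z) * dbar (reg_kernel e w) (w + e *\<^sub>R z)) = \<psi> (w + e *\<^sub>R z) * of_real (mass_density z)"
        unfolding dbar_reg_kernel[OF e] scaleR_conv_of_real by (metis mult.left_commute of_real_mult)
    qed
    finally show ?thesis .
  qed
  have md: "mass_density \<in> borel_measurable lebesgue"
    by (rule continuous_measurable_lebesgue[OF continuous_mass_density])
  have "(\<lambda>n. \<integral>z. \<psi> (w + reg_seq n *\<^sub>R z) * of_real (mass_density z) \<partial>lebesgue)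
      \<longlonglongrightarrow> (\<integral>z. \<psi> w * of_real (mass_density z) \<partial>lebesgue)"
  proof (rule integral_dominated_convergence[where w = "\<lambda>z. B * mass_density z"])
    show "(\<lambda>z. \<psi> w * of_real (mass_density z)) \<in> borel_measurable lebesgue"
      using md by measurable
    have "continuous_on UNIV (\<lambda>z. \<psi> (w + reg_seq n *\<^sub>R z) * of_real (mass_density z))" for n
      by (intro continuous_on_mult continuous_on_of_real continuous_mass_density continuous_on_compose2[OF \<psi>] continuous_intros) auto
    then show "(\<lambda>z. \<psi> (w + reg_seq n *\<^sub>R z) * of_real (mass_density z)) \<in> borel_measurable lebesgue" for n
      by (rule continuous_measurable_lebesgue)
    show "integrable lebesgue (\<lambda>z. B * mass_density z)"
      using integrable_mass_density by simp
    have "(\<lambda>n. \<psi> (w + reg_seq n *\<^sub>R z) * of_real (mass_density z)) \<longlonglongrightarrow> \<psi> w * of_real (mass_density z)" for z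
    proof -
      have "(\<lambda>n. w + reg_seq n *\<^sub>R z) \<longlonglongrightarrow> w + 0 *\<^sub>R z"
        by (intro tendsto_intros reg_seq_tendsto)
      then have "(\<lambda>n. \<psi> (w + reg_seq n *\<^sub>R z)) \<longlonglongrightarrow> \<psi> w"
        using continuous_on_tendsto_compose[OF \<psi>, of _ w] by simp
      then show ?thesis
        by (intro tendsto_intros)
    qed
    then show "AE z in lebesgue. (\<lambda>n. \<psi> (w + reg_seq n *\<^sub>R z) * of_real (mass_density z)) \<longlonglongrightarrow> \<psi> w * of_real (mass_density z)"
      by simp
    have "norm (\<psi> (w + reg_seq n *\<^sub>R z) * of_real (mass_density z)) \<le> B * mass_density z" for n z
      unfolding norm_mult norm_of_real abs_of_pos[OF mass_density_pos]
      by (intro mult_right_mono B less_imp_le[OF mass_density_pos])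
    then show "AE z in lebesgue. norm (\<psi> (w + reg_seq n *\<^sub>R z) * of_real (mass_density z)) \<le> B * mass_density z" for n
      by simp
  qed
  moreover have "(\<integral>z. \<psi> w * of_real (mass_density z) \<partial>lebesgue) = of_real cauchy_mass * \<psi> w"
    unfolding cauchy_mass_def by simp
  ultimately show ?thesis
    by (simp only: eq[OF reg_seq_pos])
qed

section \<open>The Cauchy transform on the Kato class\<close>

lemma measurable_divide_diff:
  fixes g :: "complex \<Rightarrow> complex"
  assumes [measurable]: "g \<in> borel_measurable lebesgue"
  shows "(\<lambda>z. g z / (z - w)) \<in> borel_measurable lebesgue" "(\<lambda>z. g z / (w - z)) \<in> borel_measurable lebesgue"
proof -
  have [measurable]: "(\<lambda>z. z - w) \<in> borel_measurable lebesgue" "(\<lambda>z. w - z) \<in> borel_measurable lebesgue"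
    by (intro continuous_measurable_lebesgue continuous_intros)+
  show "(\<lambda>z. g z / (z - w)) \<in> borel_measurable lebesgue" "(\<lambda>z. g z / (w - z)) \<in> borel_measurable lebesgue"
    by measurable
qed


abbreviation riesz_integrand :: "real \<Rightarrow> (complex \<Rightarrow> complex) \<Rightarrow> complex \<Rightarrow> complex \<Rightarrow> ennreal" where
  "riesz_integrand s a z w \<equiv> ennreal (norm (a w) * norm (z - w) powr (-1 - s))"

text \<open>A quantitative form of membership in the Kato class. The exponent \<^emph>\<open>s\<close> leaves room for
  uniform smallness on small discs.\<close>

definition kato :: "real \<Rightarrow> real \<Rightarrow> (complex \<Rightarrow> complex) \<Rightarrow> bool" where
  "kato s M a \<longleftrightarrow> integrable lebesgue a \<and>
    (\<forall>z. (\<integral>\<^sup>+w. riesz_integrand s a z w \<partial>lebesgue) \<le> ennreal M)"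

definition cauchy_transform :: "(complex \<Rightarrow> complex) \<Rightarrow> complex \<Rightarrow> complex" where
  "cauchy_transform a z = (\<integral>w. a w / (z - w) \<partial>lebesgue) / of_real cauchy_mass"

lemma measurable_riesz_integrand:
  assumes [measurable]: "a \<in> borel_measurable lebesgue"
  shows "(\<lambda>w. norm (a w) * norm (z - w) powr (-1 - s)) \<in> borel_measurable lebesgue"
proof -
  have [measurable]: "(\<lambda>w. norm (z - w) powr (-1 - s)) \<in> borel_measurable lebesgue"
    by (intro measurable_completion) measurable
  show ?thesis by measurable
qed

text \<open>For s > 0 the Cauchy kernel is at most 1 plus the kernel with exponent - 1 - s.\<close>

lemma kato_nn_integral_le:
  assumes "kato s M a" "s > 0" "M \<ge> 0"
  shows "(\<integral>\<^sup>+w. ennreal (norm (a w / (z - w))) \<partial>lebesgue) \<le> ennreal ((\<integral>w. norm (a w) \<partial>lebesgue) + M)"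
proof -
  have ia: "integrable lebesgue a"
    using assms by (simp add: kato_def)
  note [measurable] = borel_measurable_integrable[OF ia] measurable_riesz_integrand[OF borel_measurable_integrable[OF ia]]
  have "norm (a w / (z - w)) \<le> norm (a w) + norm (a w) * norm (z - w) powr (-1 - s)" for w
  proof -
    have "1 / norm (z - w) \<le> 1 + norm (z - w) powr (-1 - s)"
    proof (cases "norm (z - w) \<ge> 1 \<or> z = w")
      case True
      then have "1 / norm (z - w) \<le> 1"
        by (auto simp: divide_le_eq_1)
      then show ?thesis
        using powr_ge_zero[of "norm (z - w)" "-1 - s"] by linarith
    next
      case False
      then have "norm (z - w) powr (-1) \<le> norm (z - w) powr (-1 - s)"
        using assms(2) by (intro powr_mono') auto
      then show ?thesis
        using False by (simp add: powr_minus divide_inverse)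
    qed
    from mult_left_mono[OF this, of "norm (a w)"] show ?thesis
      by (simp add: norm_divide distrib_left)
  qed
  then have "(\<integral>\<^sup>+w. ennreal (norm (a w / (z - w))) \<partial>lebesgue)
      \<le> (\<integral>\<^sup>+w. ennreal (norm (a w)) + riesz_integrand s a z w \<partial>lebesgue)"
    by (intro nn_integral_mono) (simp add: ennreal_plus[symmetric] ennreal_leI del: ennreal_plus)
  also have "\<dots> = (\<integral>\<^sup>+w. ennreal (norm (a w)) \<partial>lebesgue) + (\<integral>\<^sup>+w. riesz_integrand s a z w \<partial>lebesgue)"
    by (intro nn_integral_add) measurable
  also have "(\<integral>\<^sup>+w. ennreal (norm (a w)) \<partial>lebesgue) = ennreal (\<integral>w. norm (a w) \<partial>lebesgue)"
    by (rule nn_integral_eq_integral) (use ia in auto)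
  also have "\<dots> + (\<integral>\<^sup>+w. riesz_integrand s a z w \<partial>lebesgue)
      \<le> ennreal (\<integral>w. norm (a w) \<partial>lebesgue) + ennreal M"
    using assms(1) by (intro add_left_mono) (simp add: kato_def)
  also have "\<dots> = ennreal ((\<integral>w. norm (a w) \<partial>lebesgue) + M)"
    using assms(3) by (intro ennreal_plus[symmetric] integral_nonneg_AE) auto
  finally show ?thesis .
qed

lemma kato_integrable_divide:
  assumes "kato s M a" "s > 0" "M \<ge> 0"
  shows "integrable lebesgue (\<lambda>w. a w / (z - w))"
proof (rule integrableI_bounded)
  show "(\<lambda>w. a w / (z - w)) \<in> borel_measurable lebesgue"
    using assms(1) by (intro measurable_divide_diff(2) borel_measurable_integrable) (simp add: kato_def)
  show "(\<integral>\<^sup>+w. ennreal (norm (a w / (z - w))) \<partial>lebesgue) < \<infinity>"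
    using kato_nn_integral_le[OF assms, of z] by (simp add: le_less_trans)
qed

text \<open>The transforms with the regularised kernel are continuous, and they converge uniformly because
  the error of the kernel is at most e powr s times the kernel in the definition of kato.\<close>

lemma continuous_cauchy_transform:
  assumes k: "kato s M a" "s > 0" "M \<ge> 0" and s2: "s \<le> 2"
  shows "continuous_on UNIV (cauchy_transform a)"
proof -
  have ia: "integrable lebesgue a"
    using k by (simp add: kato_def)
  have ma: "a \<in> borel_measurable lebesgue"
    by (rule borel_measurable_integrable[OF ia])
  define T where "T n z = (\<integral>w. a w * reg_kernel (reg_seq n) w z \<partial>lebesgue)" for n z
  have sym: "reg_kernel e w z = - reg_kernel e z w" for e w z
  proof -
    have "(z - w) * cnj (z - w) = (w - z) * cnj (w - z)"
      by (simp add: algebra_simps)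
    moreover have "cnj (z - w) = - cnj (w - z)"
      by simp
    ultimately show ?thesis
      unfolding reg_kernel_def by (metis mult_minus_left)
  qed
  have mk: "(\<lambda>w. a w * reg_kernel (reg_seq n) w z) \<in> borel_measurable lebesgue" for n z
    unfolding sym[of _ _ z]
    by (intro borel_measurable_times ma borel_measurable_uminus continuous_measurable_lebesgue continuous_reg_kernel reg_seq_pos)
  have nk: "norm (a w * reg_kernel (reg_seq n) w z) \<le> norm (a w) * (1 / reg_seq n)" for n w z
    unfolding norm_mult by (intro mult_left_mono norm_reg_kernel_le reg_seq_pos) simp
  have ik: "integrable lebesgue (\<lambda>w. a w * reg_kernel (reg_seq n) w z)" for n z
    by (rule Bochner_Integration.integrable_bound[of lebesgue "\<lambda>w. norm (a w) * (1 / reg_seq n)"])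
      (use ia mk nk reg_seq_pos[of n] in \<open>auto simp: abs_of_pos abs_mult simp del: norm_mult\<close>)
  have contT: "continuous_on UNIV (T n)" for n
    unfolding continuous_on_sequentially
  proof (intro allI ballI impI, elim conjE)
    fix x :: "nat \<Rightarrow> complex" and z
    assume x: "x \<longlonglongrightarrow> z"
    show "(T n \<circ> x) \<longlonglongrightarrow> T n z"
      unfolding T_def comp_def
    proof (rule integral_dominated_convergence[where w = "\<lambda>w. norm (a w) * (1 / reg_seq n)"])
      show "integrable lebesgue (\<lambda>w. norm (a w) * (1 / reg_seq n))"
        using ia by simp
      have "(\<lambda>i. a w * reg_kernel (reg_seq n) w (x i)) \<longlonglongrightarrow> a w * reg_kernel (reg_seq n) w z" for w
      proof (rule tendsto_mult_left)
        show "(\<lambda>i. reg_kernel (reg_seq n) w (x i)) \<longlonglongrightarrow> reg_kernel (reg_seq n) w z"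
          by (rule continuous_on_tendsto_compose[OF continuous_reg_kernel[OF reg_seq_pos, where S = UNIV] x]) auto
      qed
      then show "AE w in lebesgue. (\<lambda>i. a w * reg_kernel (reg_seq n) w (x i)) \<longlonglongrightarrow> a w * reg_kernel (reg_seq n) w z"
        by simp
    qed (use mk nk in \<open>auto intro!: AE_I2\<close>)
  qed
  have close: "dist (T n z) (\<integral>w. a w / (z - w) \<partial>lebesgue) \<le> reg_seq n powr s * M" for n z
  proof -
    have id: "integrable lebesgue (\<lambda>w. a w / (z - w))"
      by (rule kato_integrable_divide[OF k])
    have diff: "integrable lebesgue (\<lambda>w. a w / (z - w) - a w * reg_kernel (reg_seq n) w z)"
      using id ik by simp
    note [measurable] = measurable_riesz_integrand[OF ma]
    have "ennreal (norm ((\<integral>w. a w / (z - w) \<partial>lebesgue) - T n z))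
        = ennreal (norm (\<integral>w. a w / (z - w) - a w * reg_kernel (reg_seq n) w z \<partial>lebesgue))"
      unfolding T_def using id ik by simp
    also have "\<dots> \<le> (\<integral>\<^sup>+w. ennreal (norm (a w / (z - w) - a w * reg_kernel (reg_seq n) w z)) \<partial>lebesgue)"
      by (rule integral_norm_bound_ennreal[OF diff])
    also have "\<dots> \<le> (\<integral>\<^sup>+w. ennreal (reg_seq n powr s) * riesz_integrand s a z w \<partial>lebesgue)"
    proof (rule nn_integral_mono)
      fix w
      have "a w / (z - w) - a w * reg_kernel (reg_seq n) w z = a w * (1 / (z - w) - reg_kernel (reg_seq n) w z)"
        by (simp add: algebra_simps)
      then have "norm (a w / (z - w) - a w * reg_kernel (reg_seq n) w z) \<le> norm (a w) * (reg_seq n powr s * norm (z - w) powr (-1 - s))"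
        using mult_left_mono[OF norm_cauchy_minus_reg_kernel_le[OF reg_seq_pos[of n] k(2) s2, of z w], of "norm (a w)"]
        by (simp add: norm_mult)
      then show "ennreal (norm (a w / (z - w) - a w * reg_kernel (reg_seq n) w z))
          \<le> ennreal (reg_seq n powr s) * riesz_integrand s a z w"
        by (simp add: ennreal_mult[symmetric] ennreal_leI mult.left_commute)
    qed
    also have "\<dots> = ennreal (reg_seq n powr s) * (\<integral>\<^sup>+w. riesz_integrand s a z w \<partial>lebesgue)"
      by (intro nn_integral_cmult) measurable
    also have "\<dots> \<le> ennreal (reg_seq n powr s) * ennreal M"
      using k(1) by (intro mult_left_mono) (auto simp: kato_def)
    also have "\<dots> = ennreal (reg_seq n powr s * M)"
      using k(3) by (simp add: ennreal_mult)
    finally show ?thesis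
      using k(3) by (simp add: dist_norm norm_minus_commute)
  qed
  have "(\<lambda>n. reg_seq n powr s * M) \<longlonglongrightarrow> 0 powr s * M"
    using k(2) reg_seq_pos less_imp_le
    by (intro tendsto_intros tendsto_powr' reg_seq_tendsto) (auto simp: reg_seq_def)
  then have lim0: "(\<lambda>n. reg_seq n powr s * M) \<longlonglongrightarrow> 0"
    by simp
  have "uniform_limit UNIV T (\<lambda>z. \<integral>w. a w / (z - w) \<partial>lebesgue) sequentially"
  proof (rule uniform_limitI)
    fix e :: real assume "e > 0"
    then have "\<forall>\<^sub>F n in sequentially. reg_seq n powr s * M < e"
      by (rule order_tendstoD(2)[OF lim0])
    then show "\<forall>\<^sub>F n in sequentially. \<forall>z\<in>UNIV. dist (T n z) (\<integral>w. a w / (z - w) \<partial>lebesgue) < e"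
      by (rule eventually_mono) (auto intro: le_less_trans[OF close])
  qed
  then have "continuous_on UNIV (\<lambda>z. \<integral>w. a w / (z - w) \<partial>lebesgue)"
    by (rule uniform_limit_theorem[rotated]) (use contT in auto)
  then show ?thesis
    unfolding cauchy_transform_def[abs_def] using cauchy_mass_pos by (intro continuous_intros) auto
qed

lemma kato_mult_bounded:
  assumes k: "kato s M a" "M \<ge> 0" and b: "b \<in> borel_measurable lebesgue" "\<And>w. norm (b w) \<le> B" and B: "B \<ge> 0"
  shows "kato s (B * M) (\<lambda>w. b w * a w)"
proof -
  have ia: "integrable lebesgue a"
    using k by (simp add: kato_def)
  have le: "norm (b w * a w) \<le> B * norm (a w)" for w
    unfolding norm_mult by (intro mult_right_mono b) simp
  have "integrable lebesgue (\<lambda>w. b w * a w)"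
  proof (rule Bochner_Integration.integrable_bound)
    show "integrable lebesgue (\<lambda>w. B * norm (a w))"
      using ia by simp
    show "AE w in lebesgue. norm (b w * a w) \<le> norm (B * norm (a w))"
      using le B by (intro AE_I2) (simp add: abs_mult)
  qed (intro borel_measurable_times b borel_measurable_integrable[OF ia])
  moreover have "(\<integral>\<^sup>+w. ennreal (norm (b w * a w) * norm (z - w) powr (-1 - s)) \<partial>lebesgue) \<le> ennreal (B * M)" for z
  proof -
    note [measurable] = measurable_riesz_integrand[OF borel_measurable_integrable[OF ia]]
    have "(\<integral>\<^sup>+w. ennreal (norm (b w * a w) * norm (z - w) powr (-1 - s)) \<partial>lebesgue)
        \<le> (\<integral>\<^sup>+w. ennreal B * riesz_integrand s a z w \<partial>lebesgue)"
    proof (rule nn_integral_mono)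
      fix w
      show "ennreal (norm (b w * a w) * norm (z - w) powr (-1 - s)) \<le> ennreal B * riesz_integrand s a z w"
        using mult_right_mono[OF le[of w], of "norm (z - w) powr (-1 - s)"] B
        by (simp add: ennreal_mult[symmetric] ennreal_leI mult.assoc)
    qed
    also have "\<dots> = ennreal B * (\<integral>\<^sup>+w. riesz_integrand s a z w \<partial>lebesgue)"
      by (intro nn_integral_cmult) measurable
    also have "\<dots> \<le> ennreal B * ennreal M"
      using k by (intro mult_left_mono) (auto simp: kato_def)
    also have "\<dots> = ennreal (B * M)"
      using k B by (simp add: ennreal_mult)
    finally show ?thesis .
  qed
  ultimately show ?thesis
    by (simp add: kato_def)
qed

lemma kato_add:
  assumes "kato s M a" "M \<ge> 0" "kato s N b" "N \<ge> 0"
  shows "kato s (M + N) (\<lambda>w. a w + b w)"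
proof -
  have ia: "integrable lebesgue a" "integrable lebesgue b"
    using assms by (simp_all add: kato_def)
  have "(\<integral>\<^sup>+w. ennreal (norm (a w + b w) * norm (z - w) powr (-1 - s)) \<partial>lebesgue) \<le> ennreal (M + N)" for z
  proof -
    note [measurable] = ia[THEN borel_measurable_integrable, THEN measurable_riesz_integrand]
    have "(\<integral>\<^sup>+w. ennreal (norm (a w + b w) * norm (z - w) powr (-1 - s)) \<partial>lebesgue)
        \<le> (\<integral>\<^sup>+w. riesz_integrand s a z w + riesz_integrand s b z w \<partial>lebesgue)"
    proof (rule nn_integral_mono)
      fix w
      show "ennreal (norm (a w + b w) * norm (z - w) powr (-1 - s))
          \<le> riesz_integrand s a z w + riesz_integrand s b z w"
        using mult_right_mono[OF norm_triangle_ineq[of "a w" "b w"], of "norm (z - w) powr (-1 - s)"]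
        by (simp add: ennreal_plus[symmetric] ennreal_leI distrib_right del: ennreal_plus)
    qed
    also have "\<dots> = (\<integral>\<^sup>+w. riesz_integrand s a z w \<partial>lebesgue)
        + (\<integral>\<^sup>+w. riesz_integrand s b z w \<partial>lebesgue)"
      by (intro nn_integral_add) measurable
    also have "\<dots> \<le> ennreal M + ennreal N"
      using assms by (intro add_mono) (auto simp: kato_def)
    finally show ?thesis
      using assms by simp
  qed
  with ia show ?thesis
    by (simp add: kato_def)
qed

lemma kato_sum:
  assumes "finite I" "\<And>i. i \<in> I \<Longrightarrow> kato s M (f i)" "M \<ge> 0"
  shows "kato s (real (card I) * M) (\<lambda>w. \<Sum>i\<in>I. f i w)"
  using assms
proof (induction I rule: finite_induct)
  case empty
  then show ?case by (simp add: kato_def)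
next
  case (insert i I)
  have "kato s (M + real (card I) * M) (\<lambda>w. f i w + (\<Sum>i\<in>I. f i w))"
    using insert by (intro kato_add) auto
  moreover have "M + real (card I) * M = real (card (insert i I)) * M"
    using insert by (simp add: algebra_simps)
  ultimately show ?case
    using insert by simp
qed

lemma kato_restrict:
  assumes k: "kato s M a" "M \<ge> 0" and S: "S \<in> sets lebesgue"
  shows "kato s M (\<lambda>w. indicator S w * a w)"
proof -
  have "kato s (1 * M) (\<lambda>w. indicator S w * a w)"
    using S by (intro kato_mult_bounded k) (auto simp: indicator_def)
  then show ?thesis by simp
qed

text \<open>The comparison point \<^emph>\<open>c + r\<close> lies on the boundary of the disc, hence differs from every
  point of it; it controls the part of the kernel far from \<^emph>\<open>z\<close>.\<close>

lemma kato_small_on_disc: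
  assumes k: "kato s M a" "s > 0" "M \<ge> 0" and r: "r > 0"
  shows "(\<integral>\<^sup>+w. ennreal (norm (indicator (ball c r) w * a w / (z - w))) \<partial>lebesgue) \<le> ennreal (2 * (2 * r) powr s * M)"
proof -
  define c' where "c' = c + of_real r"
  have ia: "integrable lebesgue a"
    using k by (simp add: kato_def)
  note [measurable] = measurable_riesz_integrand[OF borel_measurable_integrable[OF ia]]
  have cancel: "x powr s * x powr (-1 - s) = 1 / x" if "x > 0" for x :: real
    using that by (simp flip: powr_add add: powr_minus divide_inverse)
  have pt: "1 / norm (z - w) \<le> (2 * r) powr s * norm (z - w) powr (-1 - s) + (2 * r) powr s * norm (c' - w) powr (-1 - s)"
    if w: "w \<in> ball c r" for w
  proof -
    have c': "0 < norm (c' - w)" "norm (c' - w) \<le> 2 * r"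
    proof -
      have "norm (c' - c) = r" using r by (simp add: c'_def)
      moreover have "norm (c - w) < r" using w by (simp add: dist_norm)
      ultimately show "0 < norm (c' - w)" "norm (c' - w) \<le> 2 * r"
        using norm_triangle_ineq[of "c' - w" "w - c"] norm_triangle_ineq[of "c' - c" "c - w"] r
        by (auto simp: norm_minus_commute[of w c] simp del: zero_less_norm_iff)
    qed
    show ?thesis
    proof (cases "z = w")
      case False
      show ?thesis
      proof (cases "norm (z - w) \<le> 2 * r")
        case True
        have "1 / norm (z - w) = norm (z - w) powr s * norm (z - w) powr (-1 - s)"
          using False by (intro cancel[symmetric]) simp
        also have "\<dots> \<le> (2 * r) powr s * norm (z - w) powr (-1 - s)"
          using True k(2) by (intro mult_right_mono powr_mono2) auto
        finally show ?thesis
          by (intro add_increasing2) auto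
      next
        case far: False
        have "1 / norm (z - w) \<le> 1 / (2 * r)"
          using far r False by (intro divide_left_mono) auto
        also have "\<dots> = (2 * r) powr s * (2 * r) powr (-1 - s)"
          using r by (intro cancel[symmetric]) simp
        also have "\<dots> \<le> (2 * r) powr s * norm (c' - w) powr (-1 - s)"
          using c' k(2) by (intro mult_left_mono powr_mono2') auto
        finally show ?thesis
          by (intro add_increasing) auto
      qed
    qed simp
  qed
  have "(\<integral>\<^sup>+w. ennreal (norm (indicator (ball c r) w * a w / (z - w))) \<partial>lebesgue)
      \<le> (\<integral>\<^sup>+w. ennreal ((2 * r) powr s) * riesz_integrand s a z w
        + ennreal ((2 * r) powr s) * riesz_integrand s a c' w \<partial>lebesgue)"
  proof (rule nn_integral_mono)
    fix w
    show "ennreal (norm (indicator (ball c r) w * a w / (z - w)))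
        \<le> ennreal ((2 * r) powr s) * riesz_integrand s a z w
        + ennreal ((2 * r) powr s) * riesz_integrand s a c' w"
    proof (cases "w \<in> ball c r")
      case True
      from mult_left_mono[OF pt[OF True], of "norm (a w)"]
      have "norm (a w / (z - w)) \<le> (2 * r) powr s * (norm (a w) * norm (z - w) powr (-1 - s))
          + (2 * r) powr s * (norm (a w) * norm (c' - w) powr (-1 - s))"
        by (simp add: norm_divide algebra_simps)
      then show ?thesis
        using True by (simp add: ennreal_mult[symmetric] ennreal_plus[symmetric] ennreal_leI del: ennreal_plus)
    qed simp
  qed
  also have "\<dots> = ennreal ((2 * r) powr s) * (\<integral>\<^sup>+w. riesz_integrand s a z w \<partial>lebesgue)
      + ennreal ((2 * r) powr s) * (\<integral>\<^sup>+w. riesz_integrand s a c' w \<partial>lebesgue)"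
    by (simp add: nn_integral_add nn_integral_cmult)
  also have "\<dots> \<le> ennreal ((2 * r) powr s) * ennreal M + ennreal ((2 * r) powr s) * ennreal M"
    using k(1) by (intro add_mono mult_left_mono) (auto simp: kato_def)
  also have "\<dots> = ennreal (2 * (2 * r) powr s * M)"
    using k(3) by (simp add: ennreal_mult[symmetric] ennreal_plus[symmetric] del: ennreal_plus)
  finally show ?thesis .
qed

lemma young_crude:
  fixes x y p q :: real
  assumes "p > 1" "q > 1" "1 / p + 1 / q = 1" "x \<ge> 0" "y \<ge> 0"
  shows "x * y \<le> x powr p + y powr q"
proof -
  have "x * y \<le> x powr p / p + y powr q / q"
    using assms by (intro Youngs_inequality) auto
  also have "\<dots> \<le> x powr p + y powr q"
    using assms by (intro add_mono) (auto simp: divide_le_eq mult_le_cancel_left1)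
  finally show ?thesis .
qed

text \<open>The choice of \<^emph>\<open>s\<close> makes (1 + s) q < 2 for the exponent q conjugate to p, which is where
  p > 2 is needed.\<close>

lemma kato_of_Lp:
  fixes a :: "complex \<Rightarrow> complex" and p :: real
  assumes p: "p > 2" and m: "a \<in> borel_measurable lebesgue"
    and i: "integrable lebesgue (\<lambda>w. norm (a w) powr p)"
    and S: "S \<in> sets borel" "emeasure lborel S < \<infinity>" "\<And>w. w \<notin> S \<Longrightarrow> a w = 0"
  shows "\<exists>M\<ge>0. kato ((p - 2) / (2 * p)) M a"
proof -
  define s where "s = (p - 2) / (2 * p)"
  define q where "q = p / (p - 1)"
  define \<tau> where "\<tau> = (1 + s) * q"
  have s: "s > 0"
    using p by (simp add: s_def)
  have q: "q > 1" "1 / p + 1 / q = 1"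
    using p by (auto simp: q_def field_simps)
  have \<tau>: "0 < \<tau>" "\<tau> < 2"
  proof -
    have "\<tau> = (3 * p - 2) / (2 * (p - 1))"
      using p by (simp add: \<tau>_def s_def q_def field_simps)
    then show "0 < \<tau>" "\<tau> < 2"
      using p by (simp_all add: pos_divide_less_eq)
  qed
  obtain C where C: "C \<ge> 0" "\<And>z::complex. (\<integral>\<^sup>+w. ennreal (norm (z - w) powr (-\<tau>)) * indicator S w \<partial>lborel) \<le> ennreal C"
    using nn_integral_norm_powr_bounded[OF \<tau> S(1,2)] by blast
  have [measurable]: "S \<in> sets borel" by fact
  have [measurable]: "a \<in> borel_measurable lebesgue" by fact
  have Sl: "S \<in> sets lebesgue" using S(1) by simp
  have ia: "integrable lebesgue a"
  proof (rule Bochner_Integration.integrable_bound)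
    show "integrable lebesgue (\<lambda>w. norm (a w) powr p + indicator S w)"
      using i S Sl by (intro Bochner_Integration.integrable_add integrable_real_indicator) auto
    show "AE w in lebesgue. norm (a w) \<le> norm (norm (a w) powr p + indicator S w)"
    proof (rule AE_I2)
      fix w
      have "norm (a w) \<le> norm (a w) powr p + 1"
      proof (cases "norm (a w) \<le> 1")
        case False
        then have "norm (a w) powr 1 \<le> norm (a w) powr p"
          using p by (intro powr_mono) auto
        then show ?thesis using False by simp
      qed (auto intro: add_increasing)
      then show "norm (a w) \<le> norm (norm (a w) powr p + indicator S w)"
        using S(3)[of w] by (cases "w \<in> S") auto
    qed
  qed fact
  define M where "M = (\<integral>w. norm (a w) powr p \<partial>lebesgue) + C"
  have M: "M \<ge> 0"
    using C(1) by (auto simp: M_def intro!: add_nonneg_nonneg integral_nonneg_AE)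
  have "(\<integral>\<^sup>+w. riesz_integrand s a z w \<partial>lebesgue) \<le> ennreal M" for z
  proof -
    have [measurable]: "(\<lambda>w. ennreal (norm (z - w) powr (-\<tau>)) * indicator S w) \<in> borel_measurable borel"
      by measurable
    have "(\<integral>\<^sup>+w. riesz_integrand s a z w \<partial>lebesgue)
        \<le> (\<integral>\<^sup>+w. ennreal (norm (a w) powr p) + ennreal (norm (z - w) powr (-\<tau>)) * indicator S w \<partial>lebesgue)"
    proof (rule nn_integral_mono)
      fix w
      have "(norm (z - w) powr (-1 - s)) powr q = norm (z - w) powr (-\<tau>)"
        by (simp add: powr_powr \<tau>_def algebra_simps)
      then have "norm (a w) * norm (z - w) powr (-1 - s) \<le> norm (a w) powr p + norm (z - w) powr (-\<tau>)"
        using young_crude[of p q "norm (a w)" "norm (z - w) powr (-1 - s)"] p q by simp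
      then show "riesz_integrand s a z w
          \<le> ennreal (norm (a w) powr p) + ennreal (norm (z - w) powr (-\<tau>)) * indicator S w"
        using S(3)[of w] by (cases "w \<in> S") (auto simp: ennreal_plus[symmetric] ennreal_leI simp del: ennreal_plus)
    qed
    also have "\<dots> = (\<integral>\<^sup>+w. ennreal (norm (a w) powr p) \<partial>lebesgue)
        + (\<integral>\<^sup>+w. ennreal (norm (z - w) powr (-\<tau>)) * indicator S w \<partial>lebesgue)"
    proof (rule nn_integral_add)
      show "(\<lambda>w. ennreal (norm (z - w) powr (-\<tau>)) * indicator S w) \<in> borel_measurable lebesgue"
        by (intro measurable_completion) simp
    qed measurable
    also have "(\<integral>\<^sup>+w. ennreal (norm (a w) powr p) \<partial>lebesgue) = ennreal (\<integral>w. norm (a w) powr p \<partial>lebesgue)"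
      by (rule nn_integral_eq_integral) (use i in auto)
    also have "\<dots> + (\<integral>\<^sup>+w. ennreal (norm (z - w) powr (-\<tau>)) * indicator S w \<partial>lebesgue)
        \<le> ennreal (\<integral>w. norm (a w) powr p \<partial>lebesgue) + ennreal C"
      using C(2)[of z] by (intro add_left_mono) (simp add: nn_integral_completion)
    also have "\<dots> = ennreal M"
      unfolding M_def using C(1) by (intro ennreal_plus[symmetric] integral_nonneg_AE) auto
    finally show ?thesis .
  qed
  with M ia show ?thesis
    unfolding s_def[symmetric] kato_def by blast
qed

lemma kato_continuous_compact:
  fixes \<psi> :: "complex \<Rightarrow> complex"
  assumes \<psi>: "continuous_on UNIV \<psi>" and K: "compact K" and out: "\<And>z. z \<notin> K \<Longrightarrow> \<psi> z = 0"
  shows "\<exists>M\<ge>0. kato (1 / 4) M \<psi>"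
proof -
  have "integrable lebesgue (\<lambda>w. \<psi> w ^ 4)"
    by (rule integrable_continuous_compact[OF continuous_on_power[OF \<psi>] K]) (simp add: out)
  from integrable_norm[OF this] have "integrable lebesgue (\<lambda>w. norm (\<psi> w) powr 4)"
    by (simp add: norm_power powr_numeral)
  then have "\<exists>M\<ge>0. kato ((4 - 2) / (2 * 4)) M \<psi>"
    by (intro kato_of_Lp[where S = K] continuous_measurable_lebesgue[OF \<psi>] borel_compact[OF K] emeasure_compact_finite[OF K] out) simp_all
  then show ?thesis by simp
qed

lemma integrable_continuous_divide_diff:
  fixes \<psi> :: "complex \<Rightarrow> complex"
  assumes \<psi>: "continuous_on UNIV \<psi>" and K: "compact K" and out: "\<And>z. z \<notin> K \<Longrightarrow> \<psi> z = 0"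
  shows "integrable lebesgue (\<lambda>z. \<psi> z / (z - w))"
proof -
  have "\<exists>M\<ge>0. kato (1 / 4) M \<psi>"
    by (rule kato_continuous_compact[OF \<psi> K]) (rule out)
  then obtain M where M: "M \<ge> 0" "kato (1 / 4) M \<psi>" by blast
  have "integrable lebesgue (\<lambda>z. - (\<psi> z / (w - z)))"
    using kato_integrable_divide[OF M(2) _ M(1)] by simp
  moreover have "- (\<psi> z / (w - z)) = \<psi> z / (z - w)" for z
    using minus_divide_right[of "\<psi> z" "w - z"] by simp
  ultimately show ?thesis by simp
qed

section \<open>Local representation of weak solutions\<close>

lemma continuous_on_mult_supported:
  fixes u \<psi> :: "complex \<Rightarrow> complex"
  assumes "open U" "continuous_on U u" "continuous_on UNIV \<psi>" "compact K" "K \<subseteq> U" "\<And>z. z \<notin> K \<Longrightarrow> \<psi> z = 0"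
  shows "continuous_on UNIV (\<lambda>z. u z * \<psi> z)"
proof -
  have "continuous_on (U \<union> - K) (\<lambda>z. u z * \<psi> z)"
  proof (rule continuous_on_open_Un)
    show "open (- K)"
      using assms(4) by (simp add: compact_imp_closed open_Compl)
    show "continuous_on U (\<lambda>z. u z * \<psi> z)"
      by (intro continuous_on_mult assms(2) continuous_on_subset[OF assms(3)]) simp
    show "continuous_on (- K) (\<lambda>z. u z * \<psi> z)"
      by (rule continuous_on_eq[of _ "\<lambda>_. 0"]) (use assms(6) in auto)
  qed (fact assms(1))
  moreover have "U \<union> - K = UNIV"
    using assms(5) by blast
  ultimately show ?thesis by simp
qed

lemma integral_reg_kernel_tendsto:
  fixes g :: "complex \<Rightarrow> complex"
  assumes g: "g \<in> borel_measurable lebesgue" and i: "integrable lebesgue (\<lambda>z. g z / (z - w))"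
  shows "integrable lebesgue (\<lambda>z. g z * reg_kernel (reg_seq n) w z)"
    and "(\<lambda>n. \<integral>z. g z * reg_kernel (reg_seq n) w z \<partial>lebesgue) \<longlonglongrightarrow> (\<integral>z. g z / (z - w) \<partial>lebesgue)"
proof -
  have m: "(\<lambda>z. g z * reg_kernel (reg_seq n) w z) \<in> borel_measurable lebesgue" for n
    by (intro borel_measurable_times g continuous_measurable_lebesgue continuous_reg_kernel reg_seq_pos)
  have "norm (g z * reg_kernel (reg_seq n) w z) \<le> norm (g z / (z - w))" for n z
    using mult_left_mono[OF norm_reg_kernel_le(1)[OF reg_seq_pos[of n], of w z], of "norm (g z)"]
    by (simp add: norm_mult norm_divide)
  then have b: "AE z in lebesgue. norm (g z * reg_kernel (reg_seq n) w z) \<le> norm (g z / (z - w))" for n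
    by simp
  show "integrable lebesgue (\<lambda>z. g z * reg_kernel (reg_seq n) w z)"
    by (rule Bochner_Integration.integrable_bound[OF i m b])
  have "(\<lambda>n. g z * reg_kernel (reg_seq n) w z) \<longlonglongrightarrow> g z * (1 / (z - w))" for z
    by (intro tendsto_intros reg_kernel_tendsto)
  then have l: "AE z in lebesgue. (\<lambda>n. g z * reg_kernel (reg_seq n) w z) \<longlonglongrightarrow> g z / (z - w)"
    by simp
  show "(\<lambda>n. \<integral>z. g z * reg_kernel (reg_seq n) w z \<partial>lebesgue) \<longlonglongrightarrow> (\<integral>z. g z / (z - w) \<partial>lebesgue)"
    by (rule integral_dominated_convergence[OF borel_measurable_integrable[OF i] m integrable_norm[OF i] l b])
qed

text \<open>Cauchy--Pompeiu for weak solutions: multiplying a test function by the regularised kernel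
  gives another test function, so the formula with the singular kernel is a limit of instances of
  the weak equation.\<close>

proposition weak_cauchy_pompeiu:
  assumes U: "open U" and u: "continuous_on U u" and eq: "dbar_eq_distributionally U u v"
    and \<phi>: "test_function U \<phi>" and i: "integrable lebesgue (\<lambda>z. v z * \<phi> z / (z - w))"
  shows "(\<integral>z. u z * dbar \<phi> z / (z - w) \<partial>lebesgue) + (\<integral>z. v z * \<phi> z / (z - w) \<partial>lebesgue)
    = - (of_real cauchy_mass * (u w * \<phi> w))"
proof -
  obtain K where K: "compact K" "K \<subseteq> U" "\<And>z. z \<notin> K \<Longrightarrow> \<phi> z = 0" "\<And>z. z \<notin> K \<Longrightarrow> dbar \<phi> z = 0"
    using test_function_support[OF \<phi>] by blast
  have \<phi>1: "Ck (Suc 0) \<phi>"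
    by (rule test_function_Ck[OF \<phi>])
  have lv: "locally_integrable U v"
    and weak: "\<And>\<phi>. test_function U \<phi> \<Longrightarrow> (\<integral>z. u z * dbar \<phi> z \<partial>lebesgue) = - (\<integral>z. v z * \<phi> z \<partial>lebesgue)"
    using eq unfolding dbar_eq_distributionally_iff[OF U] by blast+
  have c1: "continuous_on UNIV (\<lambda>z. u z * dbar \<phi> z)"
    by (rule continuous_on_mult_supported[OF U u continuous_on_dbar[OF \<phi>1] K(1,2)]) (rule K(4))
  have c2: "continuous_on UNIV (\<lambda>z. u z * \<phi> z)"
    by (rule continuous_on_mult_supported[OF U u Ck_imp_continuous_on[OF \<phi>1] K(1,2)]) (rule K(3))
  have i1: "integrable lebesgue (\<lambda>z. u z * dbar \<phi> z / (z - w))"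
    by (rule integrable_continuous_divide_diff[OF c1 K(1)]) (simp add: K(4))
  have m2: "(\<lambda>z. v z * \<phi> z) \<in> borel_measurable lebesgue"
    by (rule borel_measurable_integrable[OF integrable_mult_test(1)[OF lv \<phi>]])
  have id: "(\<integral>z. (u z * dbar \<phi> z) * reg_kernel (reg_seq n) w z \<partial>lebesgue)
      + (\<integral>z. (u z * \<phi> z) * dbar (reg_kernel (reg_seq n) w) z \<partial>lebesgue)
      = - (\<integral>z. (v z * \<phi> z) * reg_kernel (reg_seq n) w z \<partial>lebesgue)" for n
  proof -
    let ?k = "reg_kernel (reg_seq n) w"
    have k: "Ck k ?k" for k
      by (rule Ck_reg_kernel[OF reg_seq_pos])
    have t: "test_function U (\<lambda>z. \<phi> z * ?k z)"
      by (rule test_function_mult[OF \<phi> k])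
    have d: "u z * dbar (\<lambda>z. \<phi> z * ?k z) z = (u z * dbar \<phi> z) * ?k z + (u z * \<phi> z) * dbar ?k z" for z
      unfolding dbar_mult_Ck[OF \<phi>1 k] by (simp add: algebra_simps)
    have j: "integrable lebesgue (\<lambda>z. (u z * \<phi> z) * dbar ?k z)"
      by (rule integrable_continuous_compact[OF continuous_on_mult[OF c2 continuous_on_dbar[OF k]] K(1)])
        (simp add: K(3))
    have "(\<integral>z. (u z * dbar \<phi> z) * ?k z \<partial>lebesgue) + (\<integral>z. (u z * \<phi> z) * dbar ?k z \<partial>lebesgue)
        = (\<integral>z. u z * dbar (\<lambda>z. \<phi> z * ?k z) z \<partial>lebesgue)"
      unfolding d
      by (rule Bochner_Integration.integral_add[symmetric,
            OF integral_reg_kernel_tendsto(1)[OF continuous_measurable_lebesgue[OF c1] i1] j])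
    also have "\<dots> = - (\<integral>z. (v z * \<phi> z) * ?k z \<partial>lebesgue)"
      unfolding weak[OF t] by (simp add: mult.assoc)
    finally show ?thesis .
  qed
  have "(\<lambda>n. (\<integral>z. (u z * dbar \<phi> z) * reg_kernel (reg_seq n) w z \<partial>lebesgue)
      + (\<integral>z. (u z * \<phi> z) * dbar (reg_kernel (reg_seq n) w) z \<partial>lebesgue))
      \<longlonglongrightarrow> (\<integral>z. u z * dbar \<phi> z / (z - w) \<partial>lebesgue) + of_real cauchy_mass * (u w * \<phi> w)"
    by (intro tendsto_add integral_reg_kernel_tendsto(2)[OF continuous_measurable_lebesgue[OF c1] i1]
        integral_dbar_reg_kernel_tendsto[OF c2 K(1)]) (simp add: K(3))
  moreover have "(\<lambda>n. - (\<integral>z. (v z * \<phi> z) * reg_kernel (reg_seq n) w z \<partial>lebesgue))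
      \<longlonglongrightarrow> - (\<integral>z. v z * \<phi> z / (z - w) \<partial>lebesgue)"
    by (intro tendsto_minus integral_reg_kernel_tendsto(2)[OF m2 i])
  ultimately have "(\<integral>z. u z * dbar \<phi> z / (z - w) \<partial>lebesgue) + of_real cauchy_mass * (u w * \<phi> w)
      = - (\<integral>z. v z * \<phi> z / (z - w) \<partial>lebesgue)"
    unfolding id by (rule LIMSEQ_unique)
  then show ?thesis
    by (simp add: algebra_simps eq_neg_iff_add_eq_0)
qed

text \<open>Off the support of the density the difference quotient at w0 is again a Cauchy transform, of
  the density divided by w0 - z. Its continuity gives the complex derivative.\<close>

lemma holomorphic_cauchy_transform:
  assumes \<psi>: "continuous_on UNIV \<psi>" and K: "compact K" and out: "\<And>z. z \<notin> K \<Longrightarrow> \<psi> z = 0"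
    and zero: "\<And>z. z \<in> ball a r \<Longrightarrow> \<psi> z = 0"
  shows "cauchy_transform \<psi> holomorphic_on ball a r"
proof (rule holomorphic_onI)
  fix w0 assume w0: "w0 \<in> ball a r"
  define \<psi>1 where "\<psi>1 z = \<psi> z / (w0 - z)" for z
  have "continuous_on (ball a r \<union> - {w0}) \<psi>1"
  proof (intro continuous_on_open_Un)
    show "continuous_on (ball a r) \<psi>1"
      by (rule continuous_on_eq[of _ "\<lambda>_. 0"]) (use zero in \<open>auto simp: \<psi>1_def\<close>)
    show "continuous_on (- {w0}) \<psi>1"
      unfolding \<psi>1_def[abs_def] by (intro continuous_intros continuous_on_subset[OF \<psi>]) auto
  qed auto
  moreover have "ball a r \<union> - {w0} = UNIV"
    using w0 by blast
  ultimately have c1: "continuous_on UNIV \<psi>1" by simp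
  have "\<exists>M\<ge>0. kato (1 / 4) M \<psi>"
    by (rule kato_continuous_compact[OF \<psi> K]) (rule out)
  then obtain M where M: "M \<ge> 0" "kato (1 / 4) M \<psi>" by blast
  have "\<exists>M\<ge>0. kato (1 / 4) M \<psi>1"
    by (rule kato_continuous_compact[OF c1 K]) (simp add: \<psi>1_def out)
  then obtain M1 where M1: "M1 \<ge> 0" "kato (1 / 4) M1 \<psi>1" by blast
  have quot: "(cauchy_transform \<psi> w - cauchy_transform \<psi> w0) / (w - w0) = - cauchy_transform \<psi>1 w"
    if w: "w \<in> ball a r" "w \<noteq> w0" for w
  proof -
    have "\<psi> z / (w - z) - \<psi> z / (w0 - z) = (w0 - w) * (\<psi>1 z / (w - z))" for z
    proof (cases "z \<in> ball a r")
      case False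
      then have "w - z \<noteq> 0" "w0 - z \<noteq> 0"
        using w w0 by auto
      moreover have "c / x - c / y = (y - x) * (c / y / x)" if "x \<noteq> 0" "y \<noteq> 0" for c x y :: complex
        using that by (simp add: field_simps)
      from this[of "w - z" "w0 - z" "\<psi> z"] show ?thesis
        using calculation by (simp add: \<psi>1_def)
    qed (simp add: zero \<psi>1_def)
    then have "(\<integral>z. \<psi> z / (w - z) \<partial>lebesgue) - (\<integral>z. \<psi> z / (w0 - z) \<partial>lebesgue) = (\<integral>z. (w0 - w) * (\<psi>1 z / (w - z)) \<partial>lebesgue)"
      using kato_integrable_divide[OF M(2) _ M(1), of w] kato_integrable_divide[OF M(2) _ M(1), of w0]
      by (simp flip: Bochner_Integration.integral_diff)
    also have "\<dots> = - ((w - w0) * (\<integral>z. \<psi>1 z / (w - z) \<partial>lebesgue))"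
      by (subst integral_mult_right_zero) (simp add: algebra_simps)
    finally show ?thesis
      using w(2) unfolding cauchy_transform_def by (simp flip: diff_divide_distrib)
  qed
  have "continuous_on UNIV (\<lambda>w. - cauchy_transform \<psi>1 w)"
    by (intro continuous_on_minus continuous_cauchy_transform[OF M1(2) _ M1(1)]) simp_all
  then have "((\<lambda>w. - cauchy_transform \<psi>1 w) \<longlongrightarrow> - cauchy_transform \<psi>1 w0) (at w0)"
    by (simp add: continuous_on_def)
  then have "((\<lambda>w. (cauchy_transform \<psi> w - cauchy_transform \<psi> w0) / (w - w0)) \<longlongrightarrow> - cauchy_transform \<psi>1 w0) (at w0)"
    by (rule Lim_transform_within_open[OF _ open_ball w0]) (simp add: quot)
  then have "(cauchy_transform \<psi> has_field_derivative - cauchy_transform \<psi>1 w0) (at w0)"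
    by (simp add: has_field_derivative_iff)
  then show "cauchy_transform \<psi> field_differentiable at w0 within ball a r"
    unfolding field_differentiable_def using has_field_derivative_at_within by blast
qed

text \<open>Weyl's lemma. Where a cutoff equals 1, the Cauchy--Pompeiu formula exhibits u as the Cauchy
  transform of u times the dbar-derivative of the cutoff, which vanishes there.\<close>

proposition weyl_lemma:
  assumes U: "open U" and u: "continuous_on U u" and eq: "dbar_eq_distributionally U u (\<lambda>_. 0)"
  shows "u holomorphic_on U"
proof -
  have "\<exists>r>0. u holomorphic_on ball a r" if a: "a \<in> U" for a
  proof -
    obtain s where s: "s > 0" "cball a s \<subseteq> U"
      using U a open_contains_cball by blast
    define r where "r = s / 2"
    have r: "r > 0" "cball a (2 * r) \<subseteq> U"
      using s by (auto simp: r_def)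
    define \<phi> where "\<phi> = bump a r"
    have out: "\<phi> z = 0" if "z \<notin> cball a (2 * r)" for z
      unfolding \<phi>_def using that r by (intro bump_eq_0) (auto simp: dist_norm norm_minus_commute)
    have one: "\<phi> z = 1" if "z \<in> ball a r" for z
      unfolding \<phi>_def using that r by (intro bump_eq_1) (auto simp: dist_norm norm_minus_commute)
    have \<phi>: "test_function U \<phi>"
      unfolding test_function_iff using out r(2) Ck_bump by (auto simp: \<phi>_def intro!: exI[of _ "cball a (2 * r)"])
    have d0: "dbar \<phi> z = 0" if "z \<in> ball a r" for z
    proof -
      have "(\<phi> has_derivative (\<lambda>_. 0)) (at z)"
        by (rule has_derivative_transform_within_open[of "\<lambda>_. 1" _ _ UNIV "ball a r"]) (use that one in auto)
      from dbar_eqI[OF this] show ?thesis by simp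
    qed
    have d1: "dbar \<phi> z = 0" if "z \<notin> cball a (2 * r)" for z
      by (rule dbar_zero_outside[OF closed_cball _ that]) (rule out)
    have c: "continuous_on UNIV (\<lambda>z. u z * dbar \<phi> z)"
      by (rule continuous_on_mult_supported[OF U u continuous_on_dbar[OF test_function_Ck[OF \<phi>]] compact_cball r(2)]) (rule d1)
    have "cauchy_transform (\<lambda>z. u z * dbar \<phi> z) holomorphic_on ball a r"
      by (rule holomorphic_cauchy_transform[OF c compact_cball[of a "2 * r"]]) (simp_all add: d0 d1)
    moreover have "cauchy_transform (\<lambda>z. u z * dbar \<phi> z) w = u w" if "w \<in> ball a r" for w
    proof -
      have "u z * dbar \<phi> z / (z - w) = - (u z * dbar \<phi> z / (w - z))" for z
        using minus_divide_right[of "u z * dbar \<phi> z" "w - z"] by simp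
      then show ?thesis
        using weak_cauchy_pompeiu[OF U u eq \<phi>, of w] one[OF that] cauchy_mass_pos by (simp add: cauchy_transform_def)
    qed
    ultimately show ?thesis
      using r(1) holomorphic_transform by blast
  qed
  then show ?thesis
    by (metis (no_types, lifting) U centre_in_ball field_differentiable_at_within holomorphic_onI holomorphic_on_imp_differentiable_at open_ball)
qed

section \<open>The Leibniz rule for Cauchy transforms\<close>

lemma sigma_finite_lebesgue: "sigma_finite_measure (lebesgue :: 'a::euclidean_space measure)"
proof
  show "\<exists>A. countable A \<and> A \<subseteq> sets (lebesgue :: 'a measure) \<and> \<Union>A = space lebesgue \<and> (\<forall>a\<in>A. emeasure lebesgue a \<noteq> \<infinity>)"
  proof (intro exI[of _ "range (\<lambda>n::nat. ball (0::'a) (real n))"] conjI)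
    show "\<Union> (range (\<lambda>n::nat. ball (0::'a) (real n))) = space lebesgue"
      using reals_Archimedean2 by auto
    show "\<forall>a\<in>range (\<lambda>n::nat. ball (0::'a) (real n)). emeasure lebesgue a \<noteq> \<infinity>"
      using emeasure_lborel_ball_finite[of "0::'a"] by (auto simp: less_top)
  qed auto
qed

interpretation lebesgue_plane: sigma_finite_measure "lebesgue :: complex measure"
  by (rule sigma_finite_lebesgue)

interpretation lebesgue_plane_pair: pair_sigma_finite "lebesgue :: complex measure" "lebesgue :: complex measure" ..

lemma integrable_cauchy_product:
  assumes g: "integrable lebesgue g" and k: "kato s M a" "s > 0" "M \<ge> 0"
  shows "integrable (lebesgue \<Otimes>\<^sub>M lebesgue) (\<lambda>(z, w). g z * (a w / (z - w)))"
proof (rule integrableI_bounded)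
  have ia: "integrable lebesgue a"
    using k by (simp add: kato_def)
  have [measurable]: "g \<in> borel_measurable lebesgue" "a \<in> borel_measurable lebesgue"
    using g ia by auto
  have id: "(\<lambda>x. x) \<in> lebesgue \<rightarrow>\<^sub>M (borel :: complex measure)"
    by (intro continuous_measurable_lebesgue continuous_intros)
  have [measurable]: "fst \<in> (lebesgue \<Otimes>\<^sub>M lebesgue) \<rightarrow>\<^sub>M (borel :: complex measure)"
    "snd \<in> (lebesgue \<Otimes>\<^sub>M lebesgue) \<rightarrow>\<^sub>M (borel :: complex measure)"
    using measurable_compose[OF measurable_fst id] measurable_compose[OF measurable_snd id] by auto
  have "(\<lambda>p. g (fst p) * (a (snd p) / (fst p - snd p))) \<in> borel_measurable (lebesgue \<Otimes>\<^sub>M lebesgue)"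
    by measurable
  then show m[measurable]: "(\<lambda>(z, w). g z * (a w / (z - w))) \<in> borel_measurable (lebesgue \<Otimes>\<^sub>M lebesgue)"
    by (simp add: case_prod_beta')
  define C where "C = (\<integral>w. norm (a w) \<partial>lebesgue) + M"
  have "(\<integral>\<^sup>+p. ennreal (norm ((\<lambda>(z, w). g z * (a w / (z - w))) p)) \<partial>(lebesgue \<Otimes>\<^sub>M lebesgue))
      = (\<integral>\<^sup>+z. (\<integral>\<^sup>+w. ennreal (norm (g z * (a w / (z - w)))) \<partial>lebesgue) \<partial>lebesgue)"
    using lebesgue_plane.nn_integral_fst[OF measurable_compose[OF measurable_compose[OF m borel_measurable_norm] measurable_ennreal], symmetric]
    by simp
  also have "\<dots> \<le> (\<integral>\<^sup>+z. ennreal (norm (g z)) * ennreal C \<partial>lebesgue)"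
  proof (rule nn_integral_mono)
    fix z :: complex
    have [measurable]: "(\<lambda>w. a w / (z - w)) \<in> borel_measurable lebesgue"
      by (rule measurable_divide_diff) measurable
    have "(\<integral>\<^sup>+w. ennreal (norm (g z * (a w / (z - w)))) \<partial>lebesgue)
        = (\<integral>\<^sup>+w. ennreal (norm (g z)) * ennreal (norm (a w / (z - w))) \<partial>lebesgue)"
      by (simp only: norm_mult ennreal_mult[OF norm_ge_zero norm_ge_zero])
    also have "\<dots> = ennreal (norm (g z)) * (\<integral>\<^sup>+w. ennreal (norm (a w / (z - w))) \<partial>lebesgue)"
      by (intro nn_integral_cmult) measurable
    also have "\<dots> \<le> ennreal (norm (g z)) * ennreal C"
      unfolding C_def by (intro mult_left_mono kato_nn_integral_le[OF k]) simp
    finally show "(\<integral>\<^sup>+w. ennreal (norm (g z * (a w / (z - w)))) \<partial>lebesgue) \<le> ennreal (norm (g z)) * ennreal C" .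
  qed
  also have "\<dots> = (\<integral>\<^sup>+z. ennreal (norm (g z)) \<partial>lebesgue) * ennreal C"
    by (intro nn_integral_multc) measurable
  also have "\<dots> < \<infinity>"
    using g by (simp add: integrable_iff_bounded ennreal_mult_less_top)
  finally show "(\<integral>\<^sup>+p. ennreal (norm ((\<lambda>(z, w). g z * (a w / (z - w))) p)) \<partial>(lebesgue \<Otimes>\<^sub>M lebesgue)) < \<infinity>" .
qed

text \<open>Fubini's theorem for the Cauchy kernel.\<close>

lemma cauchy_transform_pairing:
  assumes g: "integrable lebesgue g" and k: "kato s M a" "s > 0" "M \<ge> 0"
  shows "integrable lebesgue (\<lambda>z. g z * cauchy_transform a z)"
    and "AE w in lebesgue. integrable lebesgue (\<lambda>z. a w * (g z / (z - w)))"
    and "integrable lebesgue (\<lambda>w. a w * (\<integral>z. g z / (z - w) \<partial>lebesgue))"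
    and "of_real cauchy_mass * (\<integral>z. g z * cauchy_transform a z \<partial>lebesgue)
      = (\<integral>w. a w * (\<integral>z. g z / (z - w) \<partial>lebesgue) \<partial>lebesgue)"
proof -
  note int = integrable_cauchy_product[OF g k]
  have comm: "g z * (a w / (z - w)) = a w * (g z / (z - w))" for z w
    by simp
  have inner1: "(\<integral>w. g z * (a w / (z - w)) \<partial>lebesgue) = of_real cauchy_mass * (g z * cauchy_transform a z)" for z
    unfolding integral_mult_right_zero cauchy_transform_def using cauchy_mass_pos by simp
  have inner2: "(\<integral>z. g z * (a w / (z - w)) \<partial>lebesgue) = a w * (\<integral>z. g z / (z - w) \<partial>lebesgue)" for w
    unfolding comm by (rule integral_mult_right_zero)
  have "integrable lebesgue (\<lambda>z. of_real cauchy_mass * (g z * cauchy_transform a z))"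
    using lebesgue_plane_pair.integrable_fst[OF int] unfolding inner1 .
  from integrable_mult_right[OF this, of "inverse (of_real cauchy_mass)"]
  show "integrable lebesgue (\<lambda>z. g z * cauchy_transform a z)"
    using cauchy_mass_pos by (simp flip: mult.assoc)
  show "AE w in lebesgue. integrable lebesgue (\<lambda>z. a w * (g z / (z - w)))"
    using lebesgue_plane_pair.AE_integrable_snd[OF int] unfolding comm .
  show "integrable lebesgue (\<lambda>w. a w * (\<integral>z. g z / (z - w) \<partial>lebesgue))"
    using lebesgue_plane_pair.integrable_snd[OF int] unfolding inner2 .
  show "of_real cauchy_mass * (\<integral>z. g z * cauchy_transform a z \<partial>lebesgue)
      = (\<integral>w. a w * (\<integral>z. g z / (z - w) \<partial>lebesgue) \<partial>lebesgue)"
    using lebesgue_plane_pair.Fubini_integral[OF int] unfolding inner1 inner2 by simp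
qed

lemma integrable_imp_locally_integrable:
  assumes "integrable lebesgue v"
  shows "locally_integrable U v"
  unfolding locally_integrable_def
proof safe
  fix K :: "complex set" assume "compact K"
  from borel_compact[OF this] have "K \<in> sets lebesgue"
    by simp
  with assms show "integrable (lebesgue_on K) v"
    by (simp add: integrable_restrict_space integrable_mult_indicator)
qed

lemma locally_integrable_add:
  "locally_integrable U u \<Longrightarrow> locally_integrable U v \<Longrightarrow> locally_integrable U (\<lambda>z. u z + v z)"
  unfolding locally_integrable_def by simp

text \<open>Writing the Cauchy transform as an integral and exchanging the order of integration reduces
  the Leibniz rule to the Cauchy--Pompeiu formula of the second factor. That formula is applied
  only at points w where the inner integral exists; these are almost all w with a w distinct from
  0, by Fubini's theorem.\<close>

proposition weak_leibniz_cauchy_transform: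
  assumes U: "open U" and u: "continuous_on U u" and eq: "dbar_eq_distributionally U u v"
    and k: "kato s M a" "s > 0" "M \<ge> 0" "s \<le> 2"
  shows "dbar_eq_distributionally U (\<lambda>z. (c + cauchy_transform a z) * u z)
    (\<lambda>z. a z * u z + (c + cauchy_transform a z) * v z)"
  unfolding dbar_eq_distributionally_iff[OF U]
proof (intro conjI allI impI)
  let ?T = "cauchy_transform a"
  have lv: "locally_integrable U v" and lu: "locally_integrable U u"
    and weak: "\<And>\<phi>. test_function U \<phi> \<Longrightarrow> (\<integral>z. u z * dbar \<phi> z \<partial>lebesgue) = - (\<integral>z. v z * \<phi> z \<partial>lebesgue)"
    using eq unfolding dbar_eq_distributionally_iff[OF U] by blast+
  have contT: "continuous_on U (\<lambda>z. c + ?T z)"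
    by (intro continuous_intros continuous_on_subset[OF continuous_cauchy_transform[OF k]]) simp
  have ia: "integrable lebesgue a"
    using k by (simp add: kato_def)
  show "locally_integrable U (\<lambda>z. (c + ?T z) * u z)"
    by (rule locally_integrable_mult_continuous[OF lu contT])
  have l1: "locally_integrable U (\<lambda>z. a z * u z)"
    using locally_integrable_mult_continuous[OF integrable_imp_locally_integrable[OF ia] u] by (simp add: mult.commute)
  have l2: "locally_integrable U (\<lambda>z. (c + ?T z) * v z)"
    by (rule locally_integrable_mult_continuous[OF lv contT])
  show "locally_integrable U (\<lambda>z. a z * u z + (c + ?T z) * v z)"
    by (rule locally_integrable_add[OF l1 l2])
  fix \<phi> assume \<phi>: "test_function U \<phi>"
  let ?g = "\<lambda>z. u z * dbar \<phi> z" and ?h = "\<lambda>z. v z * \<phi> z" and ?m = "complex_of_real cauchy_mass"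
  have ig: "integrable lebesgue ?g"
    by (rule integrable_mult_test(2)[OF lu \<phi>])
  have ih: "integrable lebesgue ?h"
    by (rule integrable_mult_test(1)[OF lv \<phi>])
  have iau: "integrable lebesgue (\<lambda>z. a z * u z * \<phi> z)"
    by (rule integrable_mult_test(1)[OF l1 \<phi>])
  note pg = cauchy_transform_pairing[OF ig k(1-3)] and ph = cauchy_transform_pairing[OF ih k(1-3)]
  have "?m * (\<integral>z. ?g z * ?T z \<partial>lebesgue) = (\<integral>w. a w * (\<integral>z. ?g z / (z - w) \<partial>lebesgue) \<partial>lebesgue)"
    by (rule pg(4))
  also have "\<dots> = (\<integral>w. - (?m * (a w * u w * \<phi> w)) - a w * (\<integral>z. ?h z / (z - w) \<partial>lebesgue) \<partial>lebesgue)"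
  proof (rule integral_cong_AE)
    show "(\<lambda>w. a w * (\<integral>z. ?g z / (z - w) \<partial>lebesgue)) \<in> borel_measurable lebesgue"
      using pg(3) by (rule borel_measurable_integrable)
    show "(\<lambda>w. - (?m * (a w * u w * \<phi> w)) - a w * (\<integral>z. ?h z / (z - w) \<partial>lebesgue)) \<in> borel_measurable lebesgue"
      using ph(3) iau by (intro borel_measurable_integrable) auto
    show "AE w in lebesgue. a w * (\<integral>z. ?g z / (z - w) \<partial>lebesgue)
        = - (?m * (a w * u w * \<phi> w)) - a w * (\<integral>z. ?h z / (z - w) \<partial>lebesgue)"
      using ph(2)
    proof (rule eventually_mono)
      fix w assume i: "integrable lebesgue (\<lambda>z. a w * (?h z / (z - w)))"
      show "a w * (\<integral>z. ?g z / (z - w) \<partial>lebesgue) = - (?m * (a w * u w * \<phi> w)) - a w * (\<integral>z. ?h z / (z - w) \<partial>lebesgue)"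
      proof (cases "a w = 0")
        case False
        from integrable_mult_right[OF i, of "inverse (a w)"] False have "integrable lebesgue (\<lambda>z. ?h z / (z - w))"
          by (simp flip: mult.assoc)
        from weak_cauchy_pompeiu[OF U u eq \<phi> this]
        have "(\<integral>z. ?g z / (z - w) \<partial>lebesgue) = - (?m * (u w * \<phi> w)) - (\<integral>z. ?h z / (z - w) \<partial>lebesgue)"
          by (simp add: algebra_simps eq_neg_iff_add_eq_0)
        then show ?thesis
          by (simp only: ring_distribs) (simp add: mult_ac)
      qed simp
    qed
  qed
  also have "\<dots> = - (?m * (\<integral>w. a w * u w * \<phi> w \<partial>lebesgue)) - ?m * (\<integral>z. ?h z * ?T z \<partial>lebesgue)"
    unfolding ph(4) using ph(3) iau by simp
  finally have "?m * (\<integral>z. ?g z * ?T z \<partial>lebesgue) = ?m * (- (\<integral>w. a w * u w * \<phi> w \<partial>lebesgue) - (\<integral>z. ?h z * ?T z \<partial>lebesgue))"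
    by (simp add: algebra_simps)
  then have main: "(\<integral>z. ?g z * ?T z \<partial>lebesgue) = - (\<integral>w. a w * u w * \<phi> w \<partial>lebesgue) - (\<integral>z. ?h z * ?T z \<partial>lebesgue)"
    using cauchy_mass_pos by (simp only: mult_cancel_left of_real_eq_0_iff) auto
  have "(\<integral>z. (c + ?T z) * u z * dbar \<phi> z \<partial>lebesgue) = (\<integral>z. c * ?g z + ?g z * ?T z \<partial>lebesgue)"
    by (simp add: algebra_simps)
  also have "\<dots> = c * (\<integral>z. ?g z \<partial>lebesgue) + (\<integral>z. ?g z * ?T z \<partial>lebesgue)"
    using ig pg(1) by simp
  also have "\<dots> = - ((\<integral>w. a w * u w * \<phi> w \<partial>lebesgue) + (c * (\<integral>z. ?h z \<partial>lebesgue) + (\<integral>z. ?h z * ?T z \<partial>lebesgue)))"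
    unfolding weak[OF \<phi>] main by simp
  also have "c * (\<integral>z. ?h z \<partial>lebesgue) + (\<integral>z. ?h z * ?T z \<partial>lebesgue) = (\<integral>z. c * ?h z + ?h z * ?T z \<partial>lebesgue)"
    using ih ph(1) by simp
  also have "(\<integral>w. a w * u w * \<phi> w \<partial>lebesgue) + (\<integral>z. c * ?h z + ?h z * ?T z \<partial>lebesgue)
      = (\<integral>z. a z * u z * \<phi> z + (c * ?h z + ?h z * ?T z) \<partial>lebesgue)"
    using ih ph(1) iau by simp
  also have "\<dots> = (\<integral>z. (a z * u z + (c + ?T z) * v z) * \<phi> z \<partial>lebesgue)"
    by (simp add: algebra_simps)
  finally show "(\<integral>z. (c + ?T z) * u z * dbar \<phi> z \<partial>lebesgue) = - (\<integral>z. (a z * u z + (c + ?T z) * v z) * \<phi> z \<partial>lebesgue)" .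
qed

section \<open>Local integrating factors\<close>

lemma norm_cauchy_transform_sum_le:
  fixes a :: "'m::finite \<Rightarrow> complex \<Rightarrow> complex"
  assumes k: "\<And>j. kato s M (a j)" "s > 0" "M \<ge> 0"
    and small: "\<And>j z. (\<integral>\<^sup>+w. ennreal (norm (a j w / (z - w))) \<partial>lebesgue) \<le> ennreal \<kappa>" "\<kappa> \<ge> 0"
    and b: "\<And>j. b j \<in> borel_measurable lebesgue" "\<And>j w. norm (b j w) \<le> B" "B \<ge> 0"
  shows "kato s (real CARD('m) * (B * M)) (\<lambda>w. \<Sum>j\<in>UNIV. b j w * a j w)"
    and "norm (cauchy_transform (\<lambda>w. \<Sum>j\<in>UNIV. b j w * a j w) z) \<le> real CARD('m) * \<kappa> / cauchy_mass * B"
proof -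
  have kj: "kato s (B * M) (\<lambda>w. b j w * a j w)" for j
    by (rule kato_mult_bounded[OF k(1,3) b])
  have BM: "0 \<le> B * M"
    using k(3) b(3) by simp
  show kk: "kato s (real CARD('m) * (B * M)) (\<lambda>w. \<Sum>j\<in>UNIV. b j w * a j w)"
    using kato_sum[of UNIV s "B * M" "\<lambda>j w. b j w * a j w"] kj BM by simp
  have ia: "integrable lebesgue (a j)" for j
    using k(1) by (simp add: kato_def)
  have [measurable]: "(\<lambda>w. a j w / (z - w)) \<in> borel_measurable lebesgue" for j
    by (intro measurable_divide_diff borel_measurable_integrable ia)
  have int: "integrable lebesgue (\<lambda>w. (\<Sum>j\<in>UNIV. b j w * a j w) / (z - w))"
    using BM by (intro kato_integrable_divide[OF kk k(2)]) simp
  have "ennreal (norm (\<integral>w. (\<Sum>j\<in>UNIV. b j w * a j w) / (z - w) \<partial>lebesgue))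
      \<le> (\<integral>\<^sup>+w. ennreal (norm ((\<Sum>j\<in>UNIV. b j w * a j w) / (z - w))) \<partial>lebesgue)"
    by (rule integral_norm_bound_ennreal[OF int])
  also have "\<dots> \<le> (\<integral>\<^sup>+w. (\<Sum>j\<in>UNIV. ennreal B * ennreal (norm (a j w / (z - w)))) \<partial>lebesgue)"
  proof (rule nn_integral_mono)
    fix w
    have "norm ((\<Sum>j\<in>UNIV. b j w * a j w) / (z - w)) = norm (\<Sum>j\<in>UNIV. b j w * (a j w / (z - w)))"
      by (simp add: sum_divide_distrib)
    also have "\<dots> \<le> (\<Sum>j\<in>UNIV. norm (b j w * (a j w / (z - w))))"
      by (rule norm_sum)
    also have "\<dots> \<le> (\<Sum>j\<in>UNIV. B * norm (a j w / (z - w)))"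
      unfolding norm_mult by (intro sum_mono mult_right_mono b) simp
    finally have "ennreal (norm ((\<Sum>j\<in>UNIV. b j w * a j w) / (z - w))) \<le> ennreal (\<Sum>j\<in>UNIV. B * norm (a j w / (z - w)))"
      by (rule ennreal_leI)
    also have "\<dots> = (\<Sum>j\<in>UNIV. ennreal (B * norm (a j w / (z - w))))"
      using b(3) by (intro sum_ennreal[symmetric]) simp
    also have "\<dots> = (\<Sum>j\<in>UNIV. ennreal B * ennreal (norm (a j w / (z - w))))"
      using b(3) by (simp only: ennreal_mult norm_ge_zero)
    finally show "ennreal (norm ((\<Sum>j\<in>UNIV. b j w * a j w) / (z - w))) \<le> (\<Sum>j\<in>UNIV. ennreal B * ennreal (norm (a j w / (z - w))))" .
  qed
  also have "\<dots> = (\<Sum>j\<in>UNIV. ennreal B * (\<integral>\<^sup>+w. ennreal (norm (a j w / (z - w))) \<partial>lebesgue))"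
    by (subst nn_integral_sum, measurable, intro sum.cong refl nn_integral_cmult, measurable)
  also have "\<dots> \<le> (\<Sum>j\<in>(UNIV :: 'm set). ennreal B * ennreal \<kappa>)"
    by (intro sum_mono mult_left_mono small) simp
  also have "\<dots> = ennreal (real CARD('m) * \<kappa> * B)"
    using small(2) b(3) by (simp add: ennreal_mult ennreal_of_nat_eq_real_of_nat mult_ac)
  finally have "norm (\<integral>w. (\<Sum>j\<in>UNIV. b j w * a j w) / (z - w) \<partial>lebesgue) \<le> real CARD('m) * \<kappa> * B"
    using small(2) b(3) by simp
  then show "norm (cauchy_transform (\<lambda>w. \<Sum>j\<in>UNIV. b j w * a j w) z) \<le> real CARD('m) * \<kappa> / cauchy_mass * B"
    unfolding cauchy_transform_def norm_divide norm_of_real abs_of_pos[OF cauchy_mass_pos]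
    using cauchy_mass_pos by (simp add: divide_right_mono)
qed

lemma cauchy_transform_diff:
  assumes "kato s M a" "kato s N b" "s > 0" "M \<ge> 0" "N \<ge> 0"
  shows "cauchy_transform a z - cauchy_transform b z = cauchy_transform (\<lambda>w. a w - b w) z"
proof -
  have "(\<integral>w. a w / (z - w) \<partial>lebesgue) - (\<integral>w. b w / (z - w) \<partial>lebesgue) = (\<integral>w. (a w - b w) / (z - w) \<partial>lebesgue)"
    using kato_integrable_divide[OF assms(1,3,4), of z] kato_integrable_divide[OF assms(2,3,5), of z]
    by (simp add: diff_divide_distrib)
  then show ?thesis
    unfolding cauchy_transform_def by (simp add: diff_divide_distrib[symmetric])
qed

lemma norm_vec_le_card_mult:
  fixes x :: "complex ^ 'm"
  assumes "\<And>k. norm (x $ k) \<le> B"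
  shows "norm x \<le> real CARD('m) * B"
proof -
  have "norm x \<le> (\<Sum>k\<in>UNIV. norm (x $ k))"
    unfolding norm_vec_def by (rule L2_set_le_sum) simp
  also have "\<dots> \<le> (\<Sum>k\<in>(UNIV :: 'm set). B)"
    by (intro sum_mono assms)
  finally show ?thesis by simp
qed

text \<open>One row of the integrating factor: the integral equation is a contraction for the supremum
  norm because the kernel has small mass. The bound in the conclusion makes the matrix formed by
  these rows strictly diagonally dominant.\<close>

lemma integrating_row_exists:
  fixes a :: "'m::finite \<Rightarrow> 'm \<Rightarrow> complex \<Rightarrow> complex" and e :: "complex ^ 'm"
  assumes k: "\<And>j k. kato s M (a j k)" "s > 0" "M \<ge> 0" "s \<le> 2" and e: "norm e = 1"
    and small: "\<And>j k z. (\<integral>\<^sup>+w. ennreal (norm (a j k w / (z - w))) \<partial>lebesgue)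
      \<le> ennreal (cauchy_mass / (4 * real CARD('m) ^ 3))"
  shows "\<exists>c B. continuous_on UNIV c \<and> (\<forall>z. norm (c z) \<le> B) \<and>
    (\<forall>z k. c z $ k = e $ k - cauchy_transform (\<lambda>w. \<Sum>j\<in>UNIV. c w $ j * a j k w) z) \<and>
    (\<forall>z. norm (c z - e) \<le> 1 / (3 * real CARD('m)))"
proof -
  let ?m = "real CARD('m)"
  \<comment> \<open>The bound for one component of the transform is m kappa / cauchy_mass; summing over the m
    components gives the contraction constant q.\<close>
  define \<kappa> where "\<kappa> = cauchy_mass / (4 * ?m ^ 3)"
  define q where "q = 1 / (4 * ?m)"
  have m1: "?m \<ge> 1"
    by (simp add: Suc_leI)
  have \<kappa>: "\<kappa> \<ge> 0"
    using cauchy_mass_pos by (simp add: \<kappa>_def)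
  have q: "0 < q" "q \<le> 1 / 4"
    using m1 by (auto simp: q_def field_simps)
  have mq: "?m * (?m * \<kappa> / cauchy_mass * B) = q * B" for B
    using m1 cauchy_mass_pos by (simp add: \<kappa>_def q_def field_simps power3_eq_cube)
  define T where "T c k z = cauchy_transform (\<lambda>w. \<Sum>j\<in>UNIV. c w $ j * a j k w) z"
    for c :: "complex \<Rightarrow> complex ^ 'm" and k z
  have meas: "(\<lambda>w. c w $ j) \<in> borel_measurable lebesgue" if "continuous_on UNIV c" for c :: "complex \<Rightarrow> complex ^ 'm" and j
    using that by (intro continuous_measurable_lebesgue continuous_on_component)
  have kT: "kato s (?m * (B * M)) (\<lambda>w. \<Sum>j\<in>UNIV. c w $ j * a j k w)"
    and Tb: "norm (T c k z) \<le> ?m * \<kappa> / cauchy_mass * B"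
    if c: "continuous_on UNIV c" "\<And>z. norm (c z) \<le> B" "B \<ge> 0" for c :: "complex \<Rightarrow> complex ^ 'm" and B k z
    unfolding T_def
    by (rule norm_cauchy_transform_sum_le[where a = "\<lambda>j. a j k" and b = "\<lambda>j w. c w $ j", OF k(1-3) small[folded \<kappa>_def] \<kappa>
          meas[OF c(1)] order_trans[OF Finite_Cartesian_Product.norm_nth_le c(2)] c(3)])+
  define \<Phi> where "\<Phi> c z = (\<chi> k. e $ k - T c k z)" for c z
  have \<Phi>_e: "norm (\<Phi> c z - e) \<le> q * B"
    if c: "continuous_on UNIV c" "\<And>z. norm (c z) \<le> B" "B \<ge> 0" for c :: "complex \<Rightarrow> complex ^ 'm" and B z
  proof -
    have "norm (\<Phi> c z - e) \<le> ?m * (?m * \<kappa> / cauchy_mass * B)"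
      by (rule norm_vec_le_card_mult) (use Tb[OF c] in \<open>simp add: \<Phi>_def\<close>)
    then show ?thesis by (simp only: mq)
  qed
  have \<Phi>_cont: "continuous_on UNIV (\<Phi> c)"
    if c: "continuous_on UNIV c" "\<And>z. norm (c z) \<le> B" "B \<ge> 0" for c :: "complex \<Rightarrow> complex ^ 'm" and B
  proof -
    have "0 \<le> ?m * (B * M)"
      using c(3) k(3) by simp
    then have "continuous_on UNIV (\<lambda>z. T c k z)" for k
      unfolding T_def by (rule continuous_cauchy_transform[OF kT[OF c] k(2) _ k(4)])
    then show ?thesis
      unfolding \<Phi>_def[abs_def] by (intro continuous_on_vec_lambda continuous_on_diff continuous_on_const)
  qed
  have bcont: "\<exists>B\<ge>0. \<forall>z. norm (apply_bcontfun c z) \<le> B" for c :: "complex \<Rightarrow>\<^sub>C (complex ^ 'm)"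
    using bounded_apply_bcontfun[of c] unfolding bounded_pos by (auto intro: less_imp_le)
  have \<Phi>_b: "\<Phi> (apply_bcontfun c) \<in> bcontfun" for c :: "complex \<Rightarrow>\<^sub>C (complex ^ 'm)"
  proof -
    obtain B where B: "B \<ge> 0" "\<And>z. norm (apply_bcontfun c z) \<le> B"
      using bcont by blast
    have cc: "continuous_on UNIV (apply_bcontfun c)" by simp
    have "norm (\<Phi> (apply_bcontfun c) z) \<le> q * B + 1" for z
      using norm_triangle_ineq[of "\<Phi> (apply_bcontfun c) z - e" e] \<Phi>_e[OF cc B(2,1), of z] e by simp
    then have "bounded (range (\<Phi> (apply_bcontfun c)))"
      unfolding bounded_iff by auto
    then show ?thesis
      using \<Phi>_cont[OF cc B(2,1)] by (simp add: bcontfun_def)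
  qed
  define F where "F c = Bcontfun (\<Phi> (apply_bcontfun c))" for c :: "complex \<Rightarrow>\<^sub>C (complex ^ 'm)"
  have F: "apply_bcontfun (F c) = \<Phi> (apply_bcontfun c)" for c
    unfolding F_def by (rule Bcontfun_inverse[OF \<Phi>_b])
  have lip: "dist (F c) (F d) \<le> q * dist c d" for c d
  proof (rule dist_bound)
    fix z
    obtain B where B: "B \<ge> 0" "\<And>z. norm (apply_bcontfun c z) \<le> B"
      using bcont by blast
    obtain B' where B': "B' \<ge> 0" "\<And>z. norm (apply_bcontfun d z) \<le> B'"
      using bcont by blast
    have cc: "continuous_on UNIV (apply_bcontfun c)" "continuous_on UNIV (apply_bcontfun d)"
      by simp_all
    have cd: "continuous_on UNIV (\<lambda>w. apply_bcontfun d w - apply_bcontfun c w)"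
      by (intro continuous_on_diff cc)
    have bd: "norm (apply_bcontfun d w - apply_bcontfun c w) \<le> dist c d" for w
      using dist_bounded[of c w d] by (simp add: dist_norm norm_minus_commute)
    have "T (apply_bcontfun d) k z - T (apply_bcontfun c) k z = T (\<lambda>w. apply_bcontfun d w - apply_bcontfun c w) k z" for k
      unfolding T_def using k(3) B(1) B'(1)
      by (subst cauchy_transform_diff[OF kT[OF cc(2) B'(2,1)] kT[OF cc(1) B(2,1)] k(2)])
        (simp_all add: left_diff_distrib sum_subtractf)
    then have "\<Phi> (apply_bcontfun c) z - \<Phi> (apply_bcontfun d) z = (\<chi> k. T (\<lambda>w. apply_bcontfun d w - apply_bcontfun c w) k z)"
      unfolding \<Phi>_def by (simp add: vec_eq_iff algebra_simps)
    also have "norm \<dots> \<le> ?m * (?m * \<kappa> / cauchy_mass * dist c d)"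
      by (rule norm_vec_le_card_mult) (use Tb[OF cd bd] in simp)
    finally show "dist (apply_bcontfun (F c) z) (apply_bcontfun (F d) z) \<le> q * dist c d"
      unfolding F dist_norm by (simp only: mq)
  qed
  have "\<exists>!c. F c = c"
    by (rule banach_fix_type[of q]) (use q lip in auto)
  then obtain c where c: "F c = c" by blast
  obtain B0 where B0: "B0 \<ge> 0" "\<And>z. norm (apply_bcontfun c z) \<le> B0"
    using bcont by blast
  have cc: "continuous_on UNIV (apply_bcontfun c)" by simp
  have fix_eq: "apply_bcontfun c z = \<Phi> (apply_bcontfun c) z" for z
    using F[of c] c by simp
  \<comment> \<open>The supremum norm B of the fixed point is at most q B + 1, and q is at most 1/4; hence B is at
    most 4/3.\<close>
  define B where "B = norm c"
  have B: "norm (apply_bcontfun c z) \<le> B" for z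
    unfolding B_def by (rule norm_bounded)
  have B0': "B \<ge> 0" by (simp add: B_def)
  have ce: "norm (apply_bcontfun c z - e) \<le> q * B" for z
    using \<Phi>_e[OF cc B B0', of z] fix_eq[of z] by simp
  have "norm (apply_bcontfun c z) \<le> q * B + 1" for z
    using norm_triangle_ineq[of "apply_bcontfun c z - e" e] ce[of z] e by simp
  then have "B \<le> q * B + 1"
    unfolding B_def by (rule norm_bound)
  moreover have "q * B \<le> 1 / 4 * B"
    using q B0' by (intro mult_right_mono) auto
  ultimately have "B \<le> 4 / 3" by linarith
  then have "q * B \<le> q * (4 / 3)"
    using q by (intro mult_left_mono) auto
  also have "\<dots> = 1 / (3 * ?m)"
    by (simp add: q_def)
  finally have qB: "q * B \<le> 1 / (3 * ?m)" .
  have fix_k: "apply_bcontfun c z $ k = e $ k - cauchy_transform (\<lambda>w. \<Sum>j\<in>UNIV. apply_bcontfun c w $ j * a j k w) z" for z k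
    by (subst fix_eq) (simp add: \<Phi>_def T_def)
  show ?thesis
    by (rule exI[of _ "apply_bcontfun c"], rule exI[of _ B])
      (use B fix_k order_trans[OF ce qB] cc in blast)
qed

text \<open>The sum of the moduli of the entries of a vector in the kernel is at most a third of itself.\<close>

lemma near_identity_matrix_injective:
  fixes C :: "'m::finite \<Rightarrow> complex ^ 'm" and x :: "complex ^ 'm"
  assumes near: "\<And>i. norm (C i - axis i 1) \<le> 1 / (3 * real CARD('m))"
    and zero: "\<And>i. (\<Sum>j\<in>UNIV. C i $ j * x $ j) = 0"
  shows "x = 0"
proof -
  let ?m = "real CARD('m)"
  define S where "S = (\<Sum>j\<in>UNIV. norm (x $ j))"
  have m1: "?m \<ge> 1"
    by (simp add: Suc_leI)
  have xi: "norm (x $ i) \<le> 1 / (3 * ?m) * S" for i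
  proof -
    have "(\<Sum>j\<in>UNIV. axis i 1 $ j * x $ j) = (\<Sum>j\<in>UNIV. if j = i then x $ j else 0)"
      by (intro sum.cong) (auto simp: axis_def)
    then have "(\<Sum>j\<in>UNIV. (C i - axis i 1) $ j * x $ j) = - x $ i"
      using zero[of i] by (simp add: left_diff_distrib sum_subtractf)
    then have "norm (x $ i) = norm (\<Sum>j\<in>UNIV. (C i - axis i 1) $ j * x $ j)"
      by (metis norm_minus_cancel)
    also have "\<dots> \<le> (\<Sum>j\<in>UNIV. norm ((C i - axis i 1) $ j * x $ j))"
      by (rule norm_sum)
    also have "\<dots> \<le> (\<Sum>j\<in>UNIV. 1 / (3 * ?m) * norm (x $ j))"
      unfolding norm_mult by (intro sum_mono mult_right_mono order_trans[OF Finite_Cartesian_Product.norm_nth_le near]) simp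
    finally show ?thesis
      by (simp add: S_def sum_distrib_left)
  qed
  have "S \<le> (\<Sum>j\<in>(UNIV :: 'm set). 1 / (3 * ?m) * S)"
    unfolding S_def[symmetric] using xi by (subst S_def) (intro sum_mono)
  also have "\<dots> = S / 3"
    using m1 by simp
  finally have "S \<le> 0" by simp
  moreover have "norm (x $ j) \<le> S" for j
    unfolding S_def by (rule member_le_sum) auto
  ultimately have "norm (x $ j) \<le> 0" for j
    by (meson order_trans)
  then show ?thesis
    by (simp add: vec_eq_iff)
qed

section \<open>Rado's theorem\<close>

text \<open>The localised form of Ck (Suc 0), for functions that are regular only off the zero set.\<close>

definition C1_on :: "complex set \<Rightarrow> (complex \<Rightarrow> complex) \<Rightarrow> bool" where
  "C1_on W f \<longleftrightarrow> (\<forall>z\<in>W. f differentiable (at z)) \<and>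
    (\<forall>v. continuous_on W (\<lambda>z. frechet_derivative f (at z) v))"

lemma C1_onI:
  assumes "\<And>z. z \<in> W \<Longrightarrow> (f has_derivative D z) (at z)" "\<And>v. continuous_on W (\<lambda>z. D z v)"
  shows "C1_on W f"
proof -
  have "frechet_derivative f (at z) = D z" if "z \<in> W" for z
    using frechet_derivative_at[OF assms(1)[OF that]] by (rule sym)
  then have "continuous_on W (\<lambda>z. frechet_derivative f (at z) v)" for v
    by (intro continuous_on_eq[OF assms(2)[of v]]) simp
  then show ?thesis
    unfolding C1_on_def using assms(1) by (auto intro: differentiableI)
qed

lemma C1_on_has_derivative:
  assumes "C1_on W f" "z \<in> W"
  shows "(f has_derivative frechet_derivative f (at z)) (at z)"
  using assms by (simp add: C1_on_def frechet_derivative_works)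

lemma C1_on_imp_continuous_on:
  assumes "C1_on W f"
  shows "continuous_on W f"
  using has_derivative_continuous[OF C1_on_has_derivative[OF assms]]
  by (simp add: continuous_at_imp_continuous_on)

lemma C1_on_mult:
  assumes f: "C1_on W f" and g: "C1_on W g"
  shows "C1_on W (\<lambda>z. f z * g z)"
proof (rule C1_onI)
  show "((\<lambda>z. f z * g z) has_derivative
      (\<lambda>h. f z * frechet_derivative g (at z) h + frechet_derivative f (at z) h * g z)) (at z)" if "z \<in> W" for z
    by (rule has_derivative_mult[OF C1_on_has_derivative[OF f that] C1_on_has_derivative[OF g that]])
  show "continuous_on W (\<lambda>z. f z * frechet_derivative g (at z) v + frechet_derivative f (at z) v * g z)" for v
    using f g by (intro continuous_on_add continuous_on_mult C1_on_imp_continuous_on[OF f] C1_on_imp_continuous_on[OF g])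
      (auto simp: C1_on_def)
qed

lemma C1_on_dbar_mult:
  assumes "C1_on W f" "C1_on W g" "z \<in> W"
  shows "dbar (\<lambda>z. f z * g z) z = dbar f z * g z + f z * dbar g z"
  by (rule dbar_mult[OF C1_on_has_derivative[OF assms(1,3)] C1_on_has_derivative[OF assms(2,3)]])

lemma C1_on_Ck: "Ck (Suc 0) f \<Longrightarrow> C1_on W f"
  by (rule C1_onI[OF Ck_Suc_has_derivative Ck_imp_continuous_on[OF Ck_SucD]])

lemma Ck_if_C1_on_supported:
  assumes W: "open W" and f: "C1_on W f" and S: "compact S" "S \<subseteq> W" "\<And>z. z \<notin> S \<Longrightarrow> f z = 0"
  shows "Ck (Suc 0) f"
proof (rule Ck_SucI)
  have "(f has_derivative frechet_derivative f (at z)) (at z)" if "z \<notin> W" for z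
  proof -
    have "(f has_derivative (\<lambda>_. 0)) (at z)"
      by (rule has_derivative_zero_outside[OF compact_imp_closed[OF S(1)]]) (use S that in auto)
    then show ?thesis
      by (metis differentiableI frechet_derivative_works)
  qed
  then show "(f has_derivative frechet_derivative f (at z)) (at z)" for z
    using C1_on_has_derivative[OF f] by blast
  show "Ck 0 (\<lambda>z. frechet_derivative f (at z) v)" for v
  proof -
    have c: "continuous_on W (\<lambda>z. frechet_derivative f (at z) v)"
      using f by (simp add: C1_on_def)
    have z: "frechet_derivative f (at z) v = 0" if "z \<notin> S" for z
      by (rule frechet_derivative_zero_outside[OF compact_imp_closed[OF S(1)] _ that]) (rule S(3))
    have "continuous_on (W \<union> - S) (\<lambda>z. frechet_derivative f (at z) v)"
    proof (rule continuous_on_open_Un[OF W _ c])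
      show "open (- S)"
        using S(1) by (simp add: compact_imp_closed open_Compl)
      show "continuous_on (- S) (\<lambda>z. frechet_derivative f (at z) v)"
        by (rule continuous_on_eq[of _ "\<lambda>_. 0"]) (use z in auto)
    qed
    moreover have "W \<union> - S = UNIV" using S(2) by blast
    ultimately show ?thesis by simp
  qed
qed

lemma C1_on_holomorphic:
  assumes "open W" "f holomorphic_on W"
  shows "C1_on W f" "\<And>z. z \<in> W \<Longrightarrow> dbar f z = 0"
proof -
  have d: "(f has_derivative (\<lambda>h. deriv f z * h)) (at z)" if "z \<in> W" for z
    using holomorphic_derivI[OF assms(2,1) that] by (simp add: has_field_derivative_def)
  show "C1_on W f"
  proof (rule C1_onI[OF d])
    show "continuous_on W (\<lambda>z. deriv f z * v)" for v
      by (intro continuous_intros holomorphic_on_imp_continuous_on holomorphic_deriv assms)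
  qed
  show "dbar f z = 0" if "z \<in> W" for z
    unfolding dbar_eqI[OF d[OF that]] by (simp add: complex_eq_iff)
qed

lemma C1_on_cnj_holomorphic:
  assumes "open W" "f holomorphic_on W"
  shows "C1_on W (\<lambda>z. cnj (f z))" "\<And>z. z \<in> W \<Longrightarrow> dbar (\<lambda>z. cnj (f z)) z = cnj (deriv f z)"
proof -
  have d: "((\<lambda>z. cnj (f z)) has_derivative (\<lambda>h. cnj (deriv f z * h))) (at z)" if "z \<in> W" for z
    by (intro bounded_linear.has_derivative[OF bounded_linear_cnj])
      (use holomorphic_derivI[OF assms(2,1) that] in \<open>simp add: has_field_derivative_def\<close>)
  show "C1_on W (\<lambda>z. cnj (f z))"
  proof (rule C1_onI[OF d])
    show "continuous_on W (\<lambda>z. cnj (deriv f z * v))" for v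
      by (intro continuous_intros holomorphic_on_imp_continuous_on holomorphic_deriv assms)
  qed
  show "dbar (\<lambda>z. cnj (f z)) z = cnj (deriv f z)" if "z \<in> W" for z
    unfolding dbar_eqI[OF d[OF that]] by (simp add: complex_eq_iff)
qed

text \<open>A smooth cutoff in the target of \<^emph>\<open>g\<close>: it vanishes where N |g|^2 is at most 1.\<close>

definition level_cutoff :: "(complex \<Rightarrow> complex) \<Rightarrow> real \<Rightarrow> complex \<Rightarrow> complex" where
  "level_cutoff g N z = of_real (flat 0 (N * (norm (g z))\<^sup>2 - 1))"

lemma continuous_on_flat: "continuous_on S (flat n)"
  by (rule Ck_imp_continuous_on[OF Ck_flat])

lemma level_cutoff_C1:
  assumes W: "open W" and g: "g holomorphic_on W"
  shows "C1_on W (level_cutoff g N)"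
    and "\<And>z. z \<in> W \<Longrightarrow> dbar (level_cutoff g N) z
      = of_real (N * flat 2 (N * (norm (g z))\<^sup>2 - 1)) * (g z * cnj (deriv g z))"
proof -
  define D where "D z h = complex_of_real (flat 2 (N * (norm (g z))\<^sup>2 - 1) * (N * (2 * Re (cnj (g z) * (deriv g z * h)))))" for z h
  have d: "(level_cutoff g N has_derivative D z) (at z)" if z: "z \<in> W" for z
  proof -
    have gd: "(g has_derivative (\<lambda>h. deriv g z * h)) (at z)"
      using holomorphic_derivI[OF g W z] by (simp add: has_field_derivative_def)
    have "((\<lambda>z. inner (g z) (g z)) has_derivative (\<lambda>h. inner (g z) (deriv g z * h) + inner (deriv g z * h) (g z))) (at z)"
      by (rule has_derivative_inner[OF gd gd])
    moreover have "inner (g z) (deriv g z * h) + inner (deriv g z * h) (g z) = 2 * Re (cnj (g z) * (deriv g z * h))" for h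
      by (simp add: inner_complex_def)
    ultimately have n: "((\<lambda>z. (norm (g z))\<^sup>2) has_derivative (\<lambda>h. 2 * Re (cnj (g z) * (deriv g z * h)))) (at z)"
      by (simp add: power2_norm_eq_inner)
    have t: "((\<lambda>z. N * (norm (g z))\<^sup>2 - 1) has_derivative (\<lambda>h. N * (2 * Re (cnj (g z) * (deriv g z * h))))) (at z)"
      using has_derivative_diff[OF has_derivative_mult_right[OF n, of N] has_derivative_const[of 1]] by simp
    have f: "(flat 0 has_derivative (\<lambda>h. flat 2 y * h)) (at y)" for y
      using flat_has_derivative[of 0 y] by (simp add: has_field_derivative_def numeral_2_eq_2)
    show ?thesis
      unfolding level_cutoff_def[abs_def] D_def[abs_def]
      by (rule bounded_linear.has_derivative[OF bounded_linear_of_real has_derivative_compose[OF t f]])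
  qed
  show "C1_on W (level_cutoff g N)"
  proof (rule C1_onI[OF d])
    have "continuous_on W g" "continuous_on W (deriv g)"
      by (intro holomorphic_on_imp_continuous_on holomorphic_deriv W g)+
    then show "continuous_on W (\<lambda>z. D z v)" for v
      unfolding D_def
      by (intro continuous_intros continuous_on_compose2[OF continuous_on_flat[of UNIV]]) auto
  qed
  show "dbar (level_cutoff g N) z = of_real (N * flat 2 (N * (norm (g z))\<^sup>2 - 1)) * (g z * cnj (deriv g z))"
    if z: "z \<in> W" for z
  proof -
    have "of_real (c * (N * (2 * Re a))) + \<i> * of_real (c * (N * (2 * Re (a * \<i>)))) = 2 * (of_real (N * c) * cnj a)"
      for a :: complex and c :: real
      by (simp add: complex_eq_iff)
    from this[of "flat 2 (N * (norm (g z))\<^sup>2 - 1)" "cnj (g z) * deriv g z"]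
    show ?thesis
      unfolding dbar_eqI[OF d[OF z]] D_def by (simp add: mult.assoc)
  qed
qed

lemma flat_0_le_1: "flat 0 x \<le> 1"
  by (simp add: flat_def)

lemma flat_2_nonneg: "0 \<le> flat 2 x"
  by (simp add: flat_def)

lemma flat_0_tendsto: "((\<lambda>t. flat 0 (t - 1)) \<longlongrightarrow> 1) at_top"
proof -
  have "((\<lambda>t::real. exp (- inverse (t - 1))) \<longlongrightarrow> 1) at_top"
    by real_asymp
  then show ?thesis
    by (rule Lim_transform_eventually)
      (rule eventually_mono[OF eventually_gt_at_top[of 1]], simp add: flat_def)
qed

lemma mult_flat_2_tendsto: "((\<lambda>t. t * flat 2 (t - 1)) \<longlongrightarrow> 0) at_top"
proof -
  have "((\<lambda>t::real. t * (inverse (t - 1) ^ 2 * exp (- inverse (t - 1)))) \<longlongrightarrow> 0) at_top"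
    by real_asymp
  then show ?thesis
    by (rule Lim_transform_eventually)
      (rule eventually_mono[OF eventually_gt_at_top[of 1]], simp add: flat_def)
qed

lemma mult_flat_2_le: "t * flat 2 (t - 1) \<le> 3"
proof (cases "t > 1")
  case True
  define x where "x = inverse (t - 1)"
  have x: "x > 0" "t = 1 + inverse x"
    using True by (auto simp: x_def)
  have tx: "t * x = x + 1"
    using x by (simp add: field_simps)
  have "t * x\<^sup>2 = (t * x) * x"
    by (simp add: power2_eq_square)
  then have "t * x\<^sup>2 = x\<^sup>2 + x"
    unfolding tx by (simp add: power2_eq_square algebra_simps)
  moreover have "flat 2 (t - 1) = x\<^sup>2 * exp (- x)"
    using True by (simp add: flat_def x_def)
  ultimately have "t * flat 2 (t - 1) = (x\<^sup>2 + x) * exp (- x)"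
    by (simp flip: mult.assoc)
  also have "\<dots> \<le> (3 * exp x) * exp (- x)"
  proof (rule mult_right_mono)
    have "1 + x + x\<^sup>2 / 2 \<le> exp x"
      using x by (intro exp_lower_Taylor_quadratic) simp
    then show "x\<^sup>2 + x \<le> 3 * exp x"
      using x zero_le_power2[of x] by linarith
  qed simp
  also have "\<dots> = 3"
    by (simp add: exp_minus)
  finally show ?thesis .
qed (simp add: flat_def)

lemma level_arg_at_top:
  assumes "g \<noteq> (0::complex)"
  shows "filterlim (\<lambda>n. real n * (norm g)\<^sup>2) at_top sequentially"
  using assms by (intro filterlim_at_top_mult_tendsto_pos[OF tendsto_const _ filterlim_real_sequentially]) simp

lemma compact_superlevel:
  fixes g :: "complex \<Rightarrow> complex"
  assumes K: "compact K" "K \<subseteq> D" and g: "continuous_on D g"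
  shows "compact {z \<in> K. 1 \<le> real n * (norm (g z))\<^sup>2}" "{z \<in> K. 1 \<le> real n * (norm (g z))\<^sup>2} \<subseteq> {z \<in> D. g z \<noteq> 0}"
proof -
  have "continuous_on K (\<lambda>z. real n * (norm (g z))\<^sup>2)"
    by (intro continuous_intros continuous_on_subset[OF g K(2)])
  then have "closedin (top_of_set K) (K \<inter> (\<lambda>z. real n * (norm (g z))\<^sup>2) -` {1..})"
    by (intro continuous_closedin_preimage) auto
  from closedin_compact[OF K(1) this] show "compact {z \<in> K. 1 \<le> real n * (norm (g z))\<^sup>2}"
    by (simp add: vimage_def Int_def)
qed (use K(2) in auto)

text \<open>The energy estimate. Integrating the dbar-derivative of eta^2 g' cnj(g) times the level cutoff
  gives the Caccioppoli inequality on the set where |g| is not small. The term in which the level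
  cutoff is differentiated has a favourable sign, so the constants do not depend on the level, and
  Fatou's lemma lets the level tend to 0.\<close>

lemma energy_finite_off_zeros:
  assumes D: "open D" and g: "continuous_on D g" and W: "W = {z \<in> D. g z \<noteq> 0}" and hol: "g holomorphic_on W"
    and \<eta>: "\<And>k. Ck k \<eta>" "\<And>z. \<eta> z \<in> \<real>" and K: "compact K" "K \<subseteq> D" "\<And>z. z \<notin> K \<Longrightarrow> \<eta> z = 0"
  shows "integrable lebesgue (\<lambda>z. if z \<in> W then (norm (\<eta> z * deriv g z))\<^sup>2 else 0)"
proof -
  have oW: "open W"
    unfolding W by (rule open_nonzero_set[OF g D])
  define E where "E n = level_cutoff g (real n)" for n
  define S where "S n = {z \<in> K. 1 \<le> real n * (norm (g z))\<^sup>2}" for n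
  have S: "compact (S n)" "S n \<subseteq> W" for n
    unfolding S_def using compact_superlevel[OF K(1,2) g, of n] by (auto simp: W)
  have E0: "\<eta> z = 0 \<or> E n z = 0" if "z \<notin> S n" for n z
    using that K(3)[of z] by (auto simp: S_def E_def level_cutoff_def flat_def)
  have Er: "E n z = of_real (flat 0 (real n * (norm (g z))\<^sup>2 - 1))" for n z
    by (simp add: E_def level_cutoff_def)
  have hol': "deriv g holomorphic_on W"
    by (intro holomorphic_deriv hol oW)
  have c\<eta>: "C1_on W \<eta>" by (rule C1_on_Ck[OF \<eta>(1)])
  have cX: "C1_on W (\<lambda>z. \<eta> z * \<eta> z)" by (rule C1_on_mult[OF c\<eta> c\<eta>])
  have ch: "C1_on W (deriv g)" by (rule C1_on_holomorphic(1)[OF oW hol'])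
  have cgb: "C1_on W (\<lambda>z. cnj (g z))" by (rule C1_on_cnj_holomorphic(1)[OF oW hol])
  have chb: "C1_on W (\<lambda>z. cnj (deriv g z))" by (rule C1_on_cnj_holomorphic(1)[OF oW hol'])
  have cE: "C1_on W (E n)" for n unfolding E_def by (rule level_cutoff_C1(1)[OF oW hol])
  define \<psi> where "\<psi> n z = (\<eta> z * \<eta> z) * (deriv g z * (cnj (g z) * E n z))" for n z
  have c1: "C1_on W (\<lambda>z. cnj (g z) * E n z)" for n by (rule C1_on_mult[OF cgb cE])
  have c2: "C1_on W (\<lambda>z. deriv g z * (cnj (g z) * E n z))" for n by (rule C1_on_mult[OF ch c1])
  have \<psi>0: "\<psi> n z = 0" if "z \<notin> S n" for n z
    using E0[OF that] by (auto simp: \<psi>_def)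
  have \<psi>: "Ck (Suc 0) (\<psi> n)" for n
    by (rule Ck_if_C1_on_supported[OF oW _ S]) (use \<psi>0 C1_on_mult[OF cX c2] in \<open>auto simp: \<psi>_def[abs_def]\<close>)
  have int\<psi>: "(\<integral>z. dbar (\<psi> n) z \<partial>lebesgue) = 0" for n
    by (rule integral_dbar_eq_0[OF \<psi> S(1)]) (rule \<psi>0)
  have d\<psi>0: "dbar (\<psi> n) z = 0" if "z \<notin> S n" for n z
    by (rule dbar_zero_outside[OF compact_imp_closed[OF S(1)] _ that]) (rule \<psi>0)
  have i\<psi>: "integrable lebesgue (dbar (\<psi> n))" for n
    by (rule integrable_continuous_compact[OF continuous_on_dbar[OF \<psi>] S(1)]) (rule d\<psi>0)
  define R where "R n z = (norm (\<eta> z * deriv g z))\<^sup>2 * flat 0 (real n * (norm (g z))\<^sup>2 - 1)" for n z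
  have Rc: "of_real (R n z) = (\<eta> z * \<eta> z) * (deriv g z * (cnj (deriv g z) * E n z))" for n z
  proof -
    have "of_real ((norm (\<eta> z))\<^sup>2) = \<eta> z * \<eta> z"
      using complex_norm_square[of "\<eta> z"] \<eta>(2)[of z] unfolding Reals_cnj_iff by (simp only:)
    then show ?thesis
      unfolding R_def Er norm_mult power_mult_distrib of_real_mult complex_norm_square[of "deriv g z"] by simp
  qed
  have R0: "R n z = 0" if "z \<notin> S n" for n z
    using E0[OF that] by (auto simp: R_def Er)
  have Rnn: "R n z \<ge> 0" for n z
    by (simp add: R_def flat_0_nonneg)
  have iRc: "integrable lebesgue (\<lambda>z. complex_of_real (R n z))" for n
  proof -
    have "C1_on W (\<lambda>z. complex_of_real (R n z))"
      unfolding Rc by (intro C1_on_mult cX ch chb cE)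
    then have "Ck (Suc 0) (\<lambda>z. complex_of_real (R n z))"
      by (rule Ck_if_C1_on_supported[OF oW _ S[of n]]) (simp add: R0)
    from Ck_imp_continuous_on[OF this] show ?thesis
      by (rule integrable_continuous_compact[OF _ S(1)[of n]]) (simp add: R0)
  qed
  then have iR: "integrable lebesgue (R n)" for n
    using integrable_Re[OF iRc, of n] by simp
  define P where "P z = (norm (g z * dbar \<eta> z))\<^sup>2" for z
  have d\<eta>0: "dbar \<eta> z = 0" if "z \<notin> K" for z
    by (rule dbar_zero_outside[OF compact_imp_closed[OF K(1)] _ that]) (rule K(3))
  have "continuous_on UNIV (\<lambda>z. g z * dbar \<eta> z)"
    by (rule continuous_on_mult_supported[OF D g continuous_on_dbar[OF \<eta>(1)] K(1,2)]) (rule d\<eta>0)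
  then have "continuous_on UNIV (\<lambda>z. complex_of_real (P z))"
    unfolding P_def by (intro continuous_on_of_real continuous_on_power continuous_on_norm)
  then have "integrable lebesgue (\<lambda>z. complex_of_real (P z))"
    by (rule integrable_continuous_compact[OF _ K(1)]) (simp add: P_def d\<eta>0)
  from integrable_Re[OF this] have iP: "integrable lebesgue P"
    by simp
  have pw: "R n z \<le> 2 * Re (dbar (\<psi> n) z) + 4 * P z" for n z
  proof (cases "z \<in> S n")
    case False
    then show ?thesis by (simp add: R0 d\<psi>0 P_def)
  next
    case True
    then have z: "z \<in> W" using S(2) by blast
    define x where "x = norm (\<eta> z * deriv g z)"
    define y where "y = norm (g z * dbar \<eta> z)"
    define e where "e = flat 0 (real n * (norm (g z))\<^sup>2 - 1)"
    define f where "f = real n * flat 2 (real n * (norm (g z))\<^sup>2 - 1)"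
    have e: "0 \<le> e" "e \<le> 1" and f: "0 \<le> f"
      by (auto simp: e_def f_def flat_0_nonneg flat_0_le_1 flat_2_nonneg)
    have dE: "dbar (E n) z = of_real f * (g z * cnj (deriv g z))"
      unfolding E_def f_def by (rule level_cutoff_C1(2)[OF oW hol z])
    have dX: "dbar (\<lambda>z. \<eta> z * \<eta> z) z = 2 * \<eta> z * dbar \<eta> z"
      unfolding C1_on_dbar_mult[OF c\<eta> c\<eta> z] by simp
    have dgE: "dbar (\<lambda>z. cnj (g z) * E n z) z = cnj (deriv g z) * E n z + cnj (g z) * (of_real f * (g z * cnj (deriv g z)))"
      unfolding C1_on_dbar_mult[OF cgb cE z] C1_on_cnj_holomorphic(2)[OF oW hol z] dE ..
    have dh: "dbar (\<lambda>z. deriv g z * (cnj (g z) * E n z)) z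
        = deriv g z * (cnj (deriv g z) * E n z + cnj (g z) * (of_real f * (g z * cnj (deriv g z))))"
      unfolding C1_on_dbar_mult[OF ch c1 z] C1_on_holomorphic(2)[OF oW hol' z] dgE by simp
    have "dbar (\<psi> n) z = 2 * \<eta> z * dbar \<eta> z * (deriv g z * (cnj (g z) * E n z))
        + (\<eta> z * \<eta> z) * (deriv g z * (cnj (deriv g z) * E n z + cnj (g z) * (of_real f * (g z * cnj (deriv g z)))))"
      unfolding \<psi>_def[abs_def] C1_on_dbar_mult[OF cX c2 z] dX dh ..
    also have "\<dots> = 2 * \<eta> z * dbar \<eta> z * (deriv g z * (cnj (g z) * E n z))
        + (of_real (R n z) + of_real f * ((\<eta> z * \<eta> z) * (deriv g z * cnj (deriv g z)) * (g z * cnj (g z))))"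
      unfolding Rc by (simp add: algebra_simps)
    also have "(\<eta> z * \<eta> z) * (deriv g z * cnj (deriv g z)) * (g z * cnj (g z)) = of_real (x\<^sup>2 * (norm (g z))\<^sup>2)"
    proof -
      have "of_real ((norm (\<eta> z))\<^sup>2) = \<eta> z * \<eta> z"
        using complex_norm_square[of "\<eta> z"] \<eta>(2)[of z] unfolding Reals_cnj_iff by (simp only:)
      then show ?thesis
        unfolding x_def norm_mult power_mult_distrib of_real_mult complex_norm_square[of "deriv g z"] complex_norm_square[of "g z"]
        by simp
    qed
    finally have "Re (dbar (\<psi> n) z) = Re (2 * \<eta> z * dbar \<eta> z * (deriv g z * (cnj (g z) * E n z)))
        + R n z + f * (x\<^sup>2 * (norm (g z))\<^sup>2)"
      by simp
    moreover have "0 \<le> f * (x\<^sup>2 * (norm (g z))\<^sup>2)"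
      using f by simp
    moreover have "- (2 * x * y * e) \<le> Re (2 * \<eta> z * dbar \<eta> z * (deriv g z * (cnj (g z) * E n z)))"
    proof -
      have "norm (2 * \<eta> z * dbar \<eta> z * (deriv g z * (cnj (g z) * E n z))) = 2 * x * y * e"
        unfolding x_def y_def Er e_def[symmetric] norm_mult using e by simp
      then show ?thesis
        using abs_Re_le_cmod[of "2 * \<eta> z * dbar \<eta> z * (deriv g z * (cnj (g z) * E n z))"] by linarith
    qed
    moreover have "R n z = x\<^sup>2 * e" "P z = y\<^sup>2"
      by (simp_all add: R_def P_def x_def y_def e_def)
    moreover have "2 * x * y * e \<le> x\<^sup>2 * e / 2 + 2 * y\<^sup>2"
    proof -
      \<comment> \<open>The cross term is absorbed into half of the energy.\<close>
      have "2 * x * y \<le> x\<^sup>2 / 2 + 2 * y\<^sup>2"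
        using zero_le_power2[of "x - 2 * y"] by (simp add: power2_diff power_mult_distrib)
      then have "(2 * x * y) * e \<le> (x\<^sup>2 / 2 + 2 * y\<^sup>2) * e"
        using e by (intro mult_right_mono)
      moreover have "2 * y\<^sup>2 * e \<le> 2 * y\<^sup>2 * 1"
        using e by (intro mult_left_mono) auto
      ultimately show ?thesis
        by (simp add: distrib_right)
    qed
    ultimately show ?thesis by linarith
  qed
  have intR: "(\<integral>z. R n z \<partial>lebesgue) \<le> 4 * (\<integral>z. P z \<partial>lebesgue)" for n
  proof -
    have "(\<integral>z. R n z \<partial>lebesgue) \<le> (\<integral>z. 2 * Re (dbar (\<psi> n) z) + 4 * P z \<partial>lebesgue)"
      using iR iP integrable_Re[OF i\<psi>[of n]] pw by (intro integral_mono) auto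
    also have "\<dots> = 2 * (\<integral>z. Re (dbar (\<psi> n) z) \<partial>lebesgue) + 4 * (\<integral>z. P z \<partial>lebesgue)"
      using iP integrable_Re[OF i\<psi>[of n]] by simp
    also have "(\<integral>z. Re (dbar (\<psi> n) z) \<partial>lebesgue) = 0"
      using integral_Re[OF i\<psi>[of n]] int\<psi>[of n] by simp
    finally show ?thesis by simp
  qed
  define Q where "Q z = (if z \<in> W then (norm (\<eta> z * deriv g z))\<^sup>2 else 0)" for z
  have lim: "(\<lambda>n. R n z) \<longlonglongrightarrow> Q z" for z
  proof (cases "z \<in> W")
    case True
    then have "(\<lambda>n. flat 0 (real n * (norm (g z))\<^sup>2 - 1)) \<longlonglongrightarrow> 1"
      by (intro filterlim_compose[OF flat_0_tendsto] level_arg_at_top) (simp add: W)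
    then have "(\<lambda>n. R n z) \<longlonglongrightarrow> (norm (\<eta> z * deriv g z))\<^sup>2 * 1"
      unfolding R_def by (intro tendsto_intros)
    then show ?thesis using True by (simp add: Q_def)
  next
    case False
    then have "R n z = 0" for n
      using S(2) by (intro R0) blast
    then show ?thesis using False by (simp add: Q_def)
  qed
  have mR: "R n \<in> borel_measurable lebesgue" for n
    using iR by (rule borel_measurable_integrable)
  have mQ: "Q \<in> borel_measurable lebesgue"
    by (rule borel_measurable_LIMSEQ_real[OF lim mR])
  have "(\<integral>\<^sup>+z. ennreal (Q z) \<partial>lebesgue) = (\<integral>\<^sup>+z. liminf (\<lambda>n. ennreal (R n z)) \<partial>lebesgue)"
    using lim by (intro nn_integral_cong lim_imp_Liminf[symmetric] tendsto_ennrealI) auto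
  also have "\<dots> \<le> liminf (\<lambda>n. \<integral>\<^sup>+z. ennreal (R n z) \<partial>lebesgue)"
    using mR by (intro nn_integral_liminf) auto
  also have "\<dots> \<le> ennreal (4 * (\<integral>z. P z \<partial>lebesgue))"
  proof -
    have "(\<integral>\<^sup>+z. ennreal (R n z) \<partial>lebesgue) \<le> ennreal (4 * (\<integral>z. P z \<partial>lebesgue))" for n
      using nn_integral_eq_integral[OF iR] Rnn intR by (simp add: ennreal_leI)
    then show ?thesis
      by (intro Liminf_le) auto
  qed
  also have "\<dots> < \<infinity>"
    by simp
  finally have "integrable lebesgue Q"
    using mQ by (intro integrableI_nonneg) (auto simp: Q_def)
  then show ?thesis
    unfolding Q_def[abs_def] .
qed

text \<open>The weak equation for the product of g and the level cutoff has an error term that tends to 0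
  pointwise and is bounded by a multiple of |g'|, which is locally integrable by the energy
  estimate. So the integral of the error tends to 0, and Weyl's lemma applies to g itself.\<close>

theorem rado:
  assumes D: "open D" and g: "continuous_on D g" and hol: "g holomorphic_on {z \<in> D. g z \<noteq> 0}"
  shows "g holomorphic_on D"
proof -
  define W where "W = {z \<in> D. g z \<noteq> 0}"
  have holW: "g holomorphic_on W" using hol by (simp add: W_def)
  have oW: "open W"
    unfolding W_def by (rule open_nonzero_set[OF g D])
  have "\<exists>r>0. g holomorphic_on ball a r" if a: "a \<in> D" for a
  proof -
    obtain s where s: "s > 0" "cball a s \<subseteq> D"
      using D a open_contains_cball by blast
    define r where "r = s / 2"
    have r: "r > 0" "cball a (2 * r) \<subseteq> D"
      using s by (auto simp: r_def)
    have ballD: "ball a r \<subseteq> D"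
    proof -
      have "ball a r \<subseteq> cball a (2 * r)"
        using r(1) by (intro subset_trans[OF ball_subset_cball subset_cball]) auto
      then show ?thesis using r(2) by blast
    qed
    define Q where "Q z = (if z \<in> W then (norm (bump a r z * deriv g z))\<^sup>2 else 0)" for z
    have iQ: "integrable lebesgue Q"
      unfolding Q_def[abs_def]
    proof (rule energy_finite_off_zeros[OF D g W_def holW Ck_bump _ compact_cball r(2)])
      show "bump a r z \<in> \<real>" for z
        by (simp add: bump_def)
      show "bump a r z = 0" if "z \<notin> cball a (2 * r)" for z
        using that r by (intro bump_eq_0) (auto simp: dist_norm norm_minus_commute)
    qed
    have "dbar_eq_distributionally (ball a r) g (\<lambda>_. 0)"
      unfolding dbar_eq_distributionally_iff[OF open_ball]
    proof (intro conjI allI impI)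
      show "locally_integrable (ball a r) g"
        by (rule locally_integrable_continuous_on[OF continuous_on_subset[OF g ballD]])
      show "locally_integrable (ball a r) (\<lambda>_. 0)"
        by (rule locally_integrable_continuous_on) simp
      fix \<phi> assume \<phi>: "test_function (ball a r) \<phi>"
      obtain K where K: "compact K" "K \<subseteq> ball a r" "\<And>z. z \<notin> K \<Longrightarrow> \<phi> z = 0" "\<And>z. z \<notin> K \<Longrightarrow> dbar \<phi> z = 0"
        using test_function_support[OF \<phi>] by blast
      have \<phi>1: "Ck (Suc 0) \<phi>" by (rule test_function_Ck[OF \<phi>])
      have KD: "K \<subseteq> D" using K(2) ballD by blast
      define E where "E n = level_cutoff g (real n)" for n
      have Er: "E n z = of_real (flat 0 (real n * (norm (g z))\<^sup>2 - 1))" for n z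
        by (simp add: E_def level_cutoff_def)
      define S where "S n = {z \<in> K. 1 \<le> real n * (norm (g z))\<^sup>2}" for n
      have S: "compact (S n)" "S n \<subseteq> W" for n
        unfolding S_def using compact_superlevel[OF K(1) KD g, of n] by (auto simp: W_def)
      have c\<phi>: "C1_on W \<phi>" by (rule C1_on_Ck[OF \<phi>1])
      have cg: "C1_on W g" by (rule C1_on_holomorphic(1)[OF oW holW])
      have cE: "C1_on W (E n)" for n unfolding E_def by (rule level_cutoff_C1(1)[OF oW holW])
      have cgE: "C1_on W (\<lambda>z. g z * E n z)" for n by (rule C1_on_mult[OF cg cE])
      define \<psi> where "\<psi> n z = \<phi> z * (g z * E n z)" for n z
      have E0: "\<phi> z = 0 \<or> E n z = 0" if "z \<notin> S n" for n z
        using that K(3)[of z] by (auto simp: S_def Er flat_def)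
      have \<psi>0: "\<psi> n z = 0" if "z \<notin> S n" for n z
        using E0[OF that] by (auto simp: \<psi>_def)
      have \<psi>: "Ck (Suc 0) (\<psi> n)" for n
        by (rule Ck_if_C1_on_supported[OF oW _ S]) (use \<psi>0 C1_on_mult[OF c\<phi> cgE] in \<open>auto simp: \<psi>_def[abs_def]\<close>)
      have int\<psi>: "(\<integral>z. dbar (\<psi> n) z \<partial>lebesgue) = 0" for n
        by (rule integral_dbar_eq_0[OF \<psi> S(1)]) (rule \<psi>0)
      have d\<psi>0: "dbar (\<psi> n) z = 0" if "z \<notin> S n" for n z
        by (rule dbar_zero_outside[OF compact_imp_closed[OF S(1)] _ that]) (rule \<psi>0)
      have "\<exists>B>0. \<forall>z. norm (\<phi> z) \<le> B"
        by (rule bounded_continuous_compact_support[OF Ck_imp_continuous_on[OF \<phi>1] K(1)]) (rule K(3))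
      then obtain B where B: "B > 0" "\<And>z. norm (\<phi> z) \<le> B"
        by blast
      have c0: "continuous_on UNIV (\<lambda>z. g z * dbar \<phi> z)"
        by (rule continuous_on_mult_supported[OF D g continuous_on_dbar[OF \<phi>1] K(1) KD]) (rule K(4))
      have i0: "integrable lebesgue (\<lambda>z. g z * dbar \<phi> z)"
        by (rule integrable_continuous_compact[OF c0 K(1)]) (simp add: K(4))
      have formula: "dbar (\<psi> n) z = g z * dbar \<phi> z * E n z
          + \<phi> z * (g z * (of_real (real n * flat 2 (real n * (norm (g z))\<^sup>2 - 1)) * (g z * cnj (deriv g z))))"
        if z: "z \<in> W" for n z
      proof -
        have dE: "dbar (E n) z = of_real (real n * flat 2 (real n * (norm (g z))\<^sup>2 - 1)) * (g z * cnj (deriv g z))"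
          unfolding E_def by (rule level_cutoff_C1(2)[OF oW holW z])
        show ?thesis
          unfolding \<psi>_def[abs_def] C1_on_dbar_mult[OF c\<phi> cgE z] C1_on_dbar_mult[OF cg cE z]
            C1_on_holomorphic(2)[OF oW holW z] dE by simp
      qed
      have "(\<lambda>n. \<integral>z. dbar (\<psi> n) z \<partial>lebesgue) \<longlonglongrightarrow> (\<integral>z. g z * dbar \<phi> z \<partial>lebesgue)"
      proof (rule integral_dominated_convergence[where w = "\<lambda>z. norm (g z * dbar \<phi> z) + 3 * B * (indicator K z + Q z)"])
        show "(\<lambda>z. g z * dbar \<phi> z) \<in> borel_measurable lebesgue"
          using i0 by (rule borel_measurable_integrable)
        show "dbar (\<psi> n) \<in> borel_measurable lebesgue" for n
          by (rule continuous_measurable_lebesgue[OF continuous_on_dbar[OF \<psi>]])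
        have "integrable lebesgue (indicator K :: complex \<Rightarrow> real)"
          using borel_compact[OF K(1)] emeasure_compact_finite[OF K(1)]
          by (intro integrable_real_indicator) auto
        then show "integrable lebesgue (\<lambda>z. norm (g z * dbar \<phi> z) + 3 * B * (indicator K z + Q z))"
          using i0 iQ by (intro Bochner_Integration.integrable_add integrable_norm integrable_mult_right) auto
        have "(\<lambda>n. dbar (\<psi> n) z) \<longlonglongrightarrow> g z * dbar \<phi> z" for z
        proof (cases "z \<in> W")
          case True
          then have gz: "g z \<noteq> 0" by (simp add: W_def)
          have "(\<lambda>n. flat 0 (real n * (norm (g z))\<^sup>2 - 1)) \<longlonglongrightarrow> 1"
            by (rule filterlim_compose[OF flat_0_tendsto level_arg_at_top[OF gz]])
          then have l1: "(\<lambda>n. E n z) \<longlonglongrightarrow> of_real 1"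
            unfolding Er by (rule tendsto_of_real)
          have "(\<lambda>n. (real n * (norm (g z))\<^sup>2) * flat 2 (real n * (norm (g z))\<^sup>2 - 1)) \<longlonglongrightarrow> 0"
            by (rule filterlim_compose[OF mult_flat_2_tendsto level_arg_at_top[OF gz]])
          from tendsto_mult[OF tendsto_const[of "inverse ((norm (g z))\<^sup>2)"] this]
          have "(\<lambda>n. real n * flat 2 (real n * (norm (g z))\<^sup>2 - 1)) \<longlonglongrightarrow> 0"
            using gz by (simp add: field_simps)
          then have l2: "(\<lambda>n. complex_of_real (real n * flat 2 (real n * (norm (g z))\<^sup>2 - 1))) \<longlonglongrightarrow> of_real 0"
            by (rule tendsto_of_real)
          have "(\<lambda>n. g z * dbar \<phi> z * E n z
              + \<phi> z * (g z * (of_real (real n * flat 2 (real n * (norm (g z))\<^sup>2 - 1)) * (g z * cnj (deriv g z)))))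
              \<longlonglongrightarrow> g z * dbar \<phi> z * of_real 1 + \<phi> z * (g z * (of_real 0 * (g z * cnj (deriv g z))))"
            by (intro tendsto_add tendsto_mult tendsto_const l1 l2)
          then show ?thesis
            unfolding formula[OF True] by simp
        next
          case False
          then have "dbar (\<psi> n) z = 0" for n
            using S(2) by (intro d\<psi>0) blast
          moreover have "g z * dbar \<phi> z = 0"
            using False K(4)[of z] KD by (auto simp: W_def)
          ultimately show ?thesis by (simp only: tendsto_const)
        qed
        then show "AE z in lebesgue. (\<lambda>n. dbar (\<psi> n) z) \<longlonglongrightarrow> g z * dbar \<phi> z"
          by simp
        have "norm (dbar (\<psi> n) z) \<le> norm (g z * dbar \<phi> z) + 3 * B * (indicator K z + Q z)" for n z
        proof (cases "z \<in> S n")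
          case False
          then show ?thesis
            using B(1) by (auto simp: d\<psi>0 Q_def intro!: add_nonneg_nonneg mult_nonneg_nonneg)
        next
          case True
          then have z: "z \<in> W" "z \<in> K" using S(2) by (auto simp: S_def)
          define f where "f = flat 2 (real n * (norm (g z))\<^sup>2 - 1)"
          have f: "0 \<le> f" by (simp add: f_def flat_2_nonneg)
          have t1: "norm (g z * dbar \<phi> z * E n z) \<le> norm (g z * dbar \<phi> z) * 1"
            unfolding norm_mult[of _ "E n z"]
            by (rule mult_left_mono) (auto simp: Er flat_0_nonneg flat_0_le_1)
          have "norm (\<phi> z * (g z * (of_real (real n * f) * (g z * cnj (deriv g z)))))
              = norm (\<phi> z) * ((real n * (norm (g z))\<^sup>2) * f) * norm (deriv g z)"
            using f by (simp add: norm_mult power2_eq_square)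
          also have "\<dots> \<le> B * 3 * (1 + (norm (deriv g z))\<^sup>2)"
          proof (intro mult_mono)
            show "(real n * (norm (g z))\<^sup>2) * f \<le> 3"
              unfolding f_def by (rule mult_flat_2_le)
            have "2 * norm (deriv g z) \<le> 1 + (norm (deriv g z))\<^sup>2"
              using sum_squares_bound[of 1 "norm (deriv g z)"] by simp
            then show "norm (deriv g z) \<le> 1 + (norm (deriv g z))\<^sup>2"
              using norm_ge_zero[of "deriv g z"] by linarith
          qed (use B f in auto)
          also have "1 + (norm (deriv g z))\<^sup>2 = indicator K z + Q z"
          proof -
            have "bump a r z = 1"
              using z(2) K(2) r(1) by (intro bump_eq_1) (auto simp: dist_norm norm_minus_commute intro: less_imp_le)
            then show ?thesis
              using z by (simp add: Q_def)
          qed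
          finally have t2: "norm (\<phi> z * (g z * (of_real (real n * f) * (g z * cnj (deriv g z))))) \<le> 3 * B * (indicator K z + Q z)"
            by (simp add: mult_ac)
          show ?thesis
            unfolding formula[OF z(1)] f_def[symmetric]
            by (rule order_trans[OF norm_triangle_ineq add_mono[OF order_trans[OF t1] t2]]) simp
        qed
        then show "AE z in lebesgue. norm (dbar (\<psi> n) z) \<le> norm (g z * dbar \<phi> z) + 3 * B * (indicator K z + Q z)" for n
          by simp
      qed
      then have "(\<integral>z. g z * dbar \<phi> z \<partial>lebesgue) = 0"
        unfolding int\<psi> by (simp add: LIMSEQ_const_iff)
      then show "(\<integral>z. g z * dbar \<phi> z \<partial>lebesgue) = - (\<integral>z. 0 * \<phi> z \<partial>lebesgue)"
        by simp
    qed
    then have "g holomorphic_on ball a r"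
      by (rule weyl_lemma[OF open_ball continuous_on_subset[OF g ballD]])
    then show ?thesis using r(1) by blast
  qed
  then show ?thesis
    by (metis (no_types, lifting) D centre_in_ball field_differentiable_at_within holomorphic_onI holomorphic_on_imp_differentiable_at open_ball)
qed

section \<open>Isolated points are removable for the weak equation\<close>

lemma dbar_eq_mono:
  assumes "open U" "open V" "V \<subseteq> U" "dbar_eq_distributionally U u v"
  shows "dbar_eq_distributionally V u v"
  using assms(4) unfolding dbar_eq_distributionally_iff[OF assms(1)] dbar_eq_distributionally_iff[OF assms(2)]
  using assms(3) test_function_mono[of V _ U] by (auto simp: locally_integrable_def)

lemma locally_integrable_cong:
  assumes "locally_integrable U v" "\<And>z. z \<in> U \<Longrightarrow> v z = w z"
  shows "locally_integrable U w"
  unfolding locally_integrable_def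
proof safe
  fix K assume K: "compact K" "K \<subseteq> U"
  have "integrable (lebesgue_on K) v \<longleftrightarrow> integrable (lebesgue_on K) w"
    using K assms(2) by (intro Bochner_Integration.integrable_cong) auto
  then show "integrable (lebesgue_on K) w"
    using assms(1) K by (simp add: locally_integrable_def)
qed

lemma dbar_eq_cong:
  assumes U: "open U" and eq: "dbar_eq_distributionally U u v"
    and "\<And>z. z \<in> U \<Longrightarrow> u z = u' z" "\<And>z. z \<in> U \<Longrightarrow> v z = v' z"
  shows "dbar_eq_distributionally U u' v'"
proof -
  have "(\<integral>z. u' z * dbar \<phi> z \<partial>lebesgue) = - (\<integral>z. v' z * \<phi> z \<partial>lebesgue)" if \<phi>: "test_function U \<phi>" for \<phi>
  proof -
    obtain K where K: "K \<subseteq> U" "\<And>z. z \<notin> K \<Longrightarrow> \<phi> z = 0" "\<And>z. z \<notin> K \<Longrightarrow> dbar \<phi> z = 0"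
      using test_function_support[OF \<phi>] by blast
    have "(\<lambda>z. u z * dbar \<phi> z) = (\<lambda>z. u' z * dbar \<phi> z)" "(\<lambda>z. v z * \<phi> z) = (\<lambda>z. v' z * \<phi> z)"
      using K assms(3,4) by (auto simp: fun_eq_iff) (metis subsetD)+
    then show ?thesis
      using eq \<phi> unfolding dbar_eq_distributionally_iff[OF U] by metis
  qed
  then show ?thesis
    using eq locally_integrable_cong[of U u u'] locally_integrable_cong[of U v v'] assms(3,4)
    unfolding dbar_eq_distributionally_iff[OF U] by simp
qed

lemma dbar_eq_add:
  assumes U: "open U" and "dbar_eq_distributionally U u v" "dbar_eq_distributionally U u' v'"
  shows "dbar_eq_distributionally U (\<lambda>z. u z + u' z) (\<lambda>z. v z + v' z)"
  unfolding dbar_eq_distributionally_iff[OF U]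
proof (intro conjI allI impI)
  have l: "locally_integrable U u" "locally_integrable U v" "locally_integrable U u'" "locally_integrable U v'"
    using assms(2,3) by (simp_all add: dbar_eq_distributionally_def)
  show "locally_integrable U (\<lambda>z. u z + u' z)" "locally_integrable U (\<lambda>z. v z + v' z)"
    by (intro locally_integrable_add l)+
  fix \<phi> assume \<phi>: "test_function U \<phi>"
  have "(\<integral>z. u z * dbar \<phi> z \<partial>lebesgue) = - (\<integral>z. v z * \<phi> z \<partial>lebesgue)"
    "(\<integral>z. u' z * dbar \<phi> z \<partial>lebesgue) = - (\<integral>z. v' z * \<phi> z \<partial>lebesgue)"
    using assms(2,3) \<phi> unfolding dbar_eq_distributionally_iff[OF U] by blast+
  then show "(\<integral>z. (u z + u' z) * dbar \<phi> z \<partial>lebesgue) = - (\<integral>z. (v z + v' z) * \<phi> z \<partial>lebesgue)"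
    using l[THEN integrable_mult_test(1), OF \<phi>] l[THEN integrable_mult_test(2), OF \<phi>]
    by (simp add: distrib_right)
qed

lemma dbar_eq_sum:
  assumes U: "open U" and "finite I" "\<And>i. i \<in> I \<Longrightarrow> dbar_eq_distributionally U (u i) (v i)"
  shows "dbar_eq_distributionally U (\<lambda>z. \<Sum>i\<in>I. u i z) (\<lambda>z. \<Sum>i\<in>I. v i z)"
  using assms(2,3)
proof (induction I rule: finite_induct)
  case empty
  have "locally_integrable U (\<lambda>_. 0)"
    by (rule locally_integrable_continuous_on) simp
  then show ?case
    by (simp add: dbar_eq_distributionally_iff[OF U])
next
  case (insert i I)
  then show ?case
    using dbar_eq_add[OF U, of "u i" "v i" "\<lambda>z. \<Sum>i\<in>I. u i z" "\<lambda>z. \<Sum>i\<in>I. v i z"] by simp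
qed

lemma dbar_eq_holomorphic:
  assumes U: "open U" and h: "h holomorphic_on U"
  shows "dbar_eq_distributionally U h (\<lambda>_. 0)"
  unfolding dbar_eq_distributionally_iff[OF U]
proof (intro conjI allI impI)
  show "locally_integrable U h"
    by (rule locally_integrable_continuous_on[OF holomorphic_on_imp_continuous_on[OF h]])
  show "locally_integrable U (\<lambda>_. 0)"
    by (rule locally_integrable_continuous_on) simp
  fix \<phi> assume \<phi>: "test_function U \<phi>"
  obtain K where K: "compact K" "K \<subseteq> U" "\<And>z. z \<notin> K \<Longrightarrow> \<phi> z = 0" "\<And>z. z \<notin> K \<Longrightarrow> dbar \<phi> z = 0"
    using test_function_support[OF \<phi>] by blast
  have c: "C1_on U h" "C1_on U \<phi>"
    by (rule C1_on_holomorphic(1)[OF U h], rule C1_on_Ck[OF test_function_Ck[OF \<phi>]])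
  have C1: "Ck (Suc 0) (\<lambda>z. h z * \<phi> z)"
    by (rule Ck_if_C1_on_supported[OF U C1_on_mult[OF c] K(1,2)]) (simp add: K(3))
  have "dbar (\<lambda>z. h z * \<phi> z) z = h z * dbar \<phi> z" for z
  proof (cases "z \<in> U")
    case True
    then show ?thesis
      by (simp add: C1_on_dbar_mult[OF c] C1_on_holomorphic(2)[OF U h])
  next
    case False
    then have z: "z \<notin> K" using K(2) by blast
    have "dbar (\<lambda>z. h z * \<phi> z) z = 0"
      by (rule dbar_zero_outside[OF compact_imp_closed[OF K(1)] _ z]) (simp add: K(3))
    then show ?thesis by (simp add: K(4)[OF z])
  qed
  moreover have "(\<integral>z. dbar (\<lambda>z. h z * \<phi> z) z \<partial>lebesgue) = 0"
    by (rule integral_dbar_eq_0[OF C1 K(1)]) (simp add: K(3))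
  ultimately show "(\<integral>z. h z * dbar \<phi> z \<partial>lebesgue) = - (\<integral>z. 0 * \<phi> z \<partial>lebesgue)"
    by simp
qed

text \<open>Subtracting a Cauchy transform of the right-hand side leaves a continuous function that is
  holomorphic off finitely many points, so Riemann's theorem on removable singularities applies.\<close>

lemma dbar_eq_insert_finite:
  assumes U: "open U" and F: "finite F" and u: "continuous_on U u"
    and k: "kato s M v" "s > 0" "M \<ge> 0" "s \<le> 2" and eq: "dbar_eq_distributionally (U - F) u v"
  shows "dbar_eq_distributionally U u v"
proof -
  let ?T = "cauchy_transform v"
  have O: "open (U - F)"
    using U F by (intro open_Diff finite_imp_closed)
  have T: "dbar_eq_distributionally D (\<lambda>z. ?T z * c) (\<lambda>z. v z * c)" if D: "open D" for D c
  proof -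
    have "dbar_eq_distributionally D (\<lambda>_. c) (\<lambda>_. 0)"
      using D by (rule dbar_eq_holomorphic) simp
    from weak_leibniz_cauchy_transform[OF D _ this k, of 0] show ?thesis
      by simp
  qed
  define h where "h z = u z + ?T z * (-1)" for z
  have h: "continuous_on U h"
    unfolding h_def[abs_def]
    by (intro continuous_intros u continuous_on_subset[OF continuous_cauchy_transform[OF k]]) simp
  have "dbar_eq_distributionally (U - F) h (\<lambda>_. 0)"
    using dbar_eq_add[OF O eq T[OF O, of "-1"]] by (simp add: h_def[abs_def])
  then have "h holomorphic_on U - F"
    by (rule weyl_lemma[OF O continuous_on_subset[OF h Diff_subset]])
  then have "h holomorphic_on U"
    by (rule no_isolated_singularity[OF h _ U F])
  from dbar_eq_add[OF U dbar_eq_holomorphic[OF U this] T[OF U, of 1]] show ?thesis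
    by (simp add: h_def)
qed

section \<open>The zero set of a solution\<close>

text \<open>On a bounded set an essentially bounded function belongs to every Lebesgue space, so an
  infinite exponent is replaced by 3, an arbitrary finite exponent above 2.\<close>

lemma in_Lp_localize:
  assumes p: "2 < p" and V: "open V" and b: "in_Lp p V b"
  defines "q \<equiv> (if p = \<infinity> then 3 else enn2real p)"
  shows "q > 2" and "(\<lambda>w. indicator (V \<inter> ball c R) w * b w) \<in> borel_measurable lebesgue"
    and "integrable lebesgue (\<lambda>w. norm (indicator (V \<inter> ball c R) w * b w) powr q)"
proof -
  show q: "q > 2"
  proof (cases p)
    case (real r)
    then show ?thesis
      using p by (simp add: q_def)
  qed (simp add: q_def)
  have Vl: "V \<in> sets lebesgue" "V \<inter> space lebesgue \<in> sets lebesgue"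
    using V by auto
  have B: "ball c R \<in> sets lebesgue" by simp
  have "(\<lambda>w. indicator V w *\<^sub>R b w) \<in> borel_measurable lebesgue"
    using b borel_measurable_restrict_space_iff[OF Vl(2), of b] by (simp add: in_Lp_def)
  then have "(\<lambda>w. indicator (ball c R) w *\<^sub>R (indicator V w *\<^sub>R b w)) \<in> borel_measurable lebesgue"
    using B by measurable
  moreover have "(\<lambda>w. indicator (ball c R) w *\<^sub>R (indicator V w *\<^sub>R b w)) = (\<lambda>w. indicator (V \<inter> ball c R) w * b w)"
    by (auto simp: fun_eq_iff indicator_def)
  ultimately show m: "(\<lambda>w. indicator (V \<inter> ball c R) w * b w) \<in> borel_measurable lebesgue"
    by simp
  show "integrable lebesgue (\<lambda>w. norm (indicator (V \<inter> ball c R) w * b w) powr q)"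
  proof (cases "p = \<infinity>")
    case True
    then obtain C where "AE z in lebesgue_on V. norm (b z) \<le> C"
      using b by (auto simp: in_Lp_def)
    then have C: "AE z in lebesgue. z \<in> V \<longrightarrow> norm (b z) \<le> C"
      using AE_restrict_space_iff[OF Vl(2)] by simp
    show ?thesis
    proof (rule integrableI_bounded_set[where A = "ball c R" and B = "\<bar>C\<bar> powr q"])
      show "(\<lambda>w. norm (indicator (V \<inter> ball c R) w * b w) powr q) \<in> borel_measurable lebesgue"
        using m by measurable
      show "emeasure lebesgue (ball c R) < \<infinity>"
        using emeasure_lborel_ball_finite[of c R] by simp
      show "AE w in lebesgue. w \<in> ball c R \<longrightarrow> norm (norm (indicator (V \<inter> ball c R) w * b w) powr q) \<le> \<bar>C\<bar> powr q"
        using C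
      proof (rule eventually_mono)
        fix w assume w: "w \<in> V \<longrightarrow> norm (b w) \<le> C"
        have "norm (indicator (V \<inter> ball c R) w * b w) \<le> \<bar>C\<bar>"
          using w by (auto simp: indicator_def)
        then have "norm (indicator (V \<inter> ball c R) w * b w) powr q \<le> \<bar>C\<bar> powr q"
          using q by (intro powr_mono2) auto
        then show "w \<in> ball c R \<longrightarrow> norm (norm (indicator (V \<inter> ball c R) w * b w) powr q) \<le> \<bar>C\<bar> powr q"
          by simp
      qed
    qed auto
  next
    case False
    then have "integrable (lebesgue_on V) (\<lambda>z. norm (b z) powr q)"
      using b by (simp add: in_Lp_def q_def)
    then have "integrable lebesgue (\<lambda>z. indicator V z *\<^sub>R norm (b z) powr q)"
      using Vl by (simp add: integrable_restrict_space)
    from integrable_mult_indicator[OF B this]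
    have "integrable lebesgue (\<lambda>z. indicator (ball c R) z *\<^sub>R (indicator V z *\<^sub>R norm (b z) powr q))" .
    moreover have "(\<lambda>z. indicator (ball c R) z *\<^sub>R (indicator V z *\<^sub>R norm (b z) powr q))
        = (\<lambda>w. norm (indicator (V \<inter> ball c R) w * b w) powr q)"
      by (auto simp: fun_eq_iff indicator_def)
    ultimately show ?thesis by simp
  qed
qed

lemma kato_mono: "kato s M a \<Longrightarrow> M \<le> N \<Longrightarrow> kato s N a"
  unfolding kato_def by (meson ennreal_leI order_trans)

lemma Lp_matrix_kato:
  fixes A :: "complex \<Rightarrow> complex ^ 'm ^ 'm"
  assumes p: "2 < p" and V: "open V" and A: "\<And>i j. in_Lp p V (\<lambda>z. A z $ i $ j)"
  shows "\<exists>s N. 0 < s \<and> s \<le> 2 \<and> 0 \<le> N \<and> (\<forall>j k. kato s N (\<lambda>w. indicator (V \<inter> ball c R) w * A w $ j $ k))"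
proof -
  define q where "q = (if p = \<infinity> then 3 else enn2real p)"
  define s where "s = (q - 2) / (2 * q)"
  have q: "q > 2"
    unfolding q_def by (rule in_Lp_localize(1)[OF p V A])
  have "\<exists>M\<ge>0. kato s M (\<lambda>w. indicator (V \<inter> ball c R) w * A w $ j $ k)" for j k
    unfolding s_def
  proof (rule kato_of_Lp[OF q])
    show "(\<lambda>w. indicator (V \<inter> ball c R) w * A w $ j $ k) \<in> borel_measurable lebesgue"
      by (rule in_Lp_localize(2)[OF p V A])
    show "integrable lebesgue (\<lambda>w. norm (indicator (V \<inter> ball c R) w * A w $ j $ k) powr q)"
      unfolding q_def by (rule in_Lp_localize(3)[OF p V A])
    show "ball c R \<in> sets borel" by simp
    show "emeasure lborel (ball c R) < \<infinity>"
      by (rule emeasure_lborel_ball_finite)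
  qed simp
  then obtain M where M: "\<And>j k. M j k \<ge> 0" "\<And>j k. kato s (M j k) (\<lambda>w. indicator (V \<inter> ball c R) w * A w $ j $ k)"
    by metis
  define N where "N = (\<Sum>j\<in>UNIV. \<Sum>k\<in>UNIV. M j k)"
  have "M j k \<le> N" for j k
  proof -
    have "M j k \<le> (\<Sum>k\<in>UNIV. M j k)"
      using M(1) by (intro member_le_sum) auto
    also have "\<dots> \<le> N"
      unfolding N_def using M(1) by (intro member_le_sum[where f = "\<lambda>j. \<Sum>k\<in>UNIV. M j k"]) (auto intro: sum_nonneg)
    finally show ?thesis .
  qed
  then have "kato s N (\<lambda>w. indicator (V \<inter> ball c R) w * A w $ j $ k)" for j k
    using M(2) kato_mono by blast
  moreover have "0 < s" "s \<le> 2"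
    using q by (auto simp: s_def field_simps)
  moreover have "0 \<le> N"
    unfolding N_def using M(1) by (intro sum_nonneg) auto
  ultimately show ?thesis by blast
qed

lemma rhs_kato_near_compact:
  fixes f :: "complex \<Rightarrow> complex ^ 'm" and A :: "complex \<Rightarrow> complex ^ 'm ^ 'm"
  assumes \<Omega>: "open \<Omega>" and f: "continuous_on \<Omega> f" and p: "2 < p" and V: "V = {z \<in> \<Omega>. f z \<noteq> 0}"
    and A: "\<And>i j. in_Lp p V (\<lambda>z. A z $ i $ j)" and K: "compact K" "K \<subseteq> \<Omega>"
  shows "\<exists>W v s M. open W \<and> K \<subseteq> W \<and> W \<subseteq> \<Omega> \<and> kato s M v \<and> 0 < s \<and> 0 \<le> M \<and> s \<le> 2 \<and> (\<forall>z\<in>W. v z = (A z *v f z) $ i)"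
proof -
  have oV: "open V"
    unfolding V by (rule open_nonzero_set[OF f \<Omega>])
  obtain e where e: "e > 0" "(\<Union>x\<in>K. cball x e) \<subseteq> \<Omega>"
    by (rule compact_subset_open_imp_cball_epsilon_subset[OF K(1) \<Omega> K(2)])
  define L where "L = {x + y |x y. x \<in> K \<and> y \<in> cball 0 e}"
  have L: "compact L"
    unfolding L_def by (rule compact_sums[OF K(1) compact_cball])
  have "L \<subseteq> (\<Union>x\<in>K. cball x e)"
    by (auto simp: L_def dist_norm)
  then have L\<Omega>: "L \<subseteq> \<Omega>" using e(2) by blast
  define W where "W = (\<Union>x\<in>K. ball x e)"
  have W: "open W" "K \<subseteq> W" using e(1) by (auto simp: W_def)
  have "z \<in> L" if "z \<in> ball x e" "x \<in> K" for x z
    unfolding L_def using that by (intro CollectI exI[of _ x] exI[of _ "z - x"]) (simp add: dist_norm norm_minus_commute)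
  then have WL: "W \<subseteq> L" by (auto simp: W_def)
  have "bounded (f ` L)"
    using L L\<Omega> f by (intro compact_imp_bounded compact_continuous_image continuous_on_subset[OF f])
  then obtain B where B: "B > 0" "\<And>z. z \<in> L \<Longrightarrow> norm (f z) \<le> B"
    by (auto simp: bounded_pos)
  obtain R where R: "L \<subseteq> ball 0 R"
    using compact_imp_bounded[OF L] bounded_subset_ballD by blast
  obtain s N where sN: "0 < s" "s \<le> 2" "0 \<le> N" and k: "\<And>j k. kato s N (\<lambda>w. indicator (V \<inter> ball 0 R) w * A w $ j $ k)"
    using Lp_matrix_kato[OF p oV A, of 0 R] by blast
  define b where "b l z = indicator W z *\<^sub>R f z $ l" for l z
  define v where "v z = (\<Sum>l\<in>UNIV. b l z * (indicator (V \<inter> ball 0 R) z * A z $ i $ l))" for z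
  have "kato s (B * N) (\<lambda>z. b l z * (indicator (V \<inter> ball 0 R) z * A z $ i $ l))" for l
  proof (rule kato_mult_bounded[OF k sN(3)])
    have "continuous_on W (\<lambda>z. f z $ l)"
      using WL L\<Omega> by (intro continuous_on_component continuous_on_subset[OF f]) blast
    then have "(\<lambda>z. indicator W z *\<^sub>R f z $ l) \<in> borel_measurable borel"
      using W(1) by (intro borel_measurable_continuous_on_indicator) auto
    then show "b l \<in> borel_measurable lebesgue"
      unfolding b_def[abs_def] by (intro measurable_completion) simp
    show "norm (b l z) \<le> B" for z
      using WL B order_trans[OF Finite_Cartesian_Product.norm_nth_le B(2), of z l] by (auto simp: b_def indicator_def)
    show "0 \<le> B" using B(1) by simp
  qed
  then have "kato s (real CARD('m) * (B * N)) v"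
    unfolding v_def[abs_def] using B(1) sN(3) by (intro kato_sum) auto
  moreover have "v z = (A z *v f z) $ i" if z: "z \<in> W" for z
  proof (cases "z \<in> V")
    case True
    then show ?thesis
      using z WL R by (auto simp: v_def b_def matrix_vector_mult_def mult.commute intro!: sum.cong)
  next
    case False
    then have "f z = 0" using z WL L\<Omega> by (auto simp: V)
    then show ?thesis by (simp add: v_def b_def)
  qed
  moreover have "0 \<le> real CARD('m) * (B * N)" using B(1) sN(3) by simp
  ultimately show ?thesis
    using W WL L\<Omega> sN(1,2) by (intro exI[of _ W] exI[of _ v] exI[of _ s] exI[of _ "real CARD('m) * (B * N)"]) auto
qed

text \<open>Multiplication by the integrating factor turns the solution into a vector of functions that
  are holomorphic off the zero set, hence everywhere by Rado's theorem, and that have the same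
  common zeros.\<close>

proposition zeros_locally_isolated_or_identically_zero:
  fixes f :: "complex \<Rightarrow> complex ^ 'm" and A :: "complex \<Rightarrow> complex ^ 'm ^ 'm"
  assumes \<Omega>: "open \<Omega>" and f: "continuous_on \<Omega> f" and p: "2 < p" and V: "V = {z \<in> \<Omega>. f z \<noteq> 0}"
    and A: "\<And>i j. in_Lp p V (\<lambda>z. A z $ i $ j)" and eq: "solves_dbar_system V A f" and c: "c \<in> \<Omega>"
  shows "c \<in> interior {z \<in> \<Omega>. f z = 0} \<or> \<not> c islimpt {z \<in> \<Omega>. f z = 0}"
proof -
  let ?m = "real CARD('m)"
  have oV: "open V"
    unfolding V by (rule open_nonzero_set[OF f \<Omega>])
  obtain R where R: "R > 0" "ball c R \<subseteq> \<Omega>"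
    using \<Omega> c open_contains_ball by blast
  obtain s N where sN: "0 < s" "s \<le> 2" "0 \<le> N"
    and kR: "\<And>j k. kato s N (\<lambda>w. indicator (V \<inter> ball c R) w * A w $ j $ k)"
    using Lp_matrix_kato[OF p oV A, of c R] by blast
  define \<kappa> where "\<kappa> = cauchy_mass / (4 * ?m ^ 3)"
  have \<kappa>: "\<kappa> > 0"
    using cauchy_mass_pos by (simp add: \<kappa>_def)
  define x where "x = \<kappa> / (2 * (N + 1))"
  have x: "x > 0"
    using \<kappa> sN by (simp add: x_def)
  \<comment> \<open>The second radius solves 2 (2 r)^s (N + 1) = kappa.\<close>
  define r where "r = min R (x powr (1 / s) / 2)"
  have r: "r > 0" "r \<le> R"
    using R x by (auto simp: r_def)
  have "(2 * r) powr s \<le> (x powr (1 / s)) powr s"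
    using r sN by (intro powr_mono2) (auto simp: r_def)
  also have "\<dots> = x"
    using x sN by (simp add: powr_powr)
  finally have "2 * (2 * r) powr s * N \<le> 2 * x * N"
    using sN by (intro mult_right_mono) auto
  also have "\<dots> \<le> \<kappa>"
    using \<kappa> sN by (simp add: x_def field_simps)
  finally have rk: "2 * (2 * r) powr s * N \<le> \<kappa>" .
  define D where "D = ball c r"
  have D: "open D" "connected D" "D \<subseteq> \<Omega>" "c \<in> D"
    using r R by (auto simp: D_def)
  define a where "a j k w = indicator D w * (indicator (V \<inter> ball c R) w * A w $ j $ k)" for j k w
  have ka: "kato s N (a j k)" for j k
    unfolding a_def[abs_def] using D(1) by (intro kato_restrict kR sN) auto
  have small: "(\<integral>\<^sup>+w. ennreal (norm (a j k w / (z - w))) \<partial>lebesgue) \<le> ennreal (cauchy_mass / (4 * ?m ^ 3))" for j k z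
    unfolding a_def D_def \<kappa>_def[symmetric]
    by (rule order_trans[OF kato_small_on_disc[OF kR sN(1,3) r(1)] ennreal_leI[OF rk]])
  have aA: "a j k w = A w $ j $ k" if "w \<in> D" "w \<in> V" for j k w
    using that r by (auto simp: a_def D_def)
  define row where "row i C B \<longleftrightarrow> continuous_on UNIV C \<and> (\<forall>z. norm (C z) \<le> B) \<and>
      (\<forall>z k. C z $ k = axis i 1 $ k - cauchy_transform (\<lambda>w. \<Sum>j\<in>UNIV. C w $ j * a j k w) z) \<and>
      (\<forall>z. norm (C z - axis i 1) \<le> 1 / (3 * ?m))" for i :: 'm and C :: "complex \<Rightarrow> complex ^ 'm" and B :: real
  have "\<exists>C B. row i C B" for i
    unfolding row_def by (rule integrating_row_exists[OF ka sN(1,3,2) _ small]) simp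
  then have "\<forall>i. \<exists>C. \<exists>B. row i C B" by blast
  from choice[OF this] obtain C where "\<forall>i. \<exists>B. row i (C i) B" by blast
  from choice[OF this] obtain B where row: "\<And>i. row i (C i) (B i)" by blast
  have C: "\<And>i. continuous_on UNIV (C i)" "\<And>i z. norm (C i z) \<le> B i"
    "\<And>i z k. C i z $ k = axis i 1 $ k - cauchy_transform (\<lambda>w. \<Sum>j\<in>UNIV. C i w $ j * a j k w) z"
    "\<And>i z. norm (C i z - axis i 1) \<le> 1 / (3 * ?m)"
    using row unfolding row_def by blast+
  define g where "g i z = (\<Sum>k\<in>UNIV. C i z $ k * f z $ k)" for i z
  define U where "U = D \<inter> V"
  have oU: "open U" using D(1) oV by (auto simp: U_def)
  have fk: "continuous_on S (\<lambda>z. f z $ k)" if "S \<subseteq> \<Omega>" for S k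
    by (intro continuous_on_component continuous_on_subset[OF f that])
  have U\<Omega>: "U \<subseteq> \<Omega>" using D(3) by (auto simp: U_def)
  have gD: "continuous_on D (g i)" for i
    unfolding g_def[abs_def]
    by (intro continuous_intros fk D(3) continuous_on_component continuous_on_subset[OF C(1)]) simp
  have weak: "dbar_eq_distributionally U (g i) (\<lambda>_. 0)" for i
  proof -
    define v where "v k w = (\<Sum>j\<in>UNIV. (- C i w $ j) * a j k w)" for k w
    have B0: "B i \<ge> 0"
      using C(2)[of i 0] norm_ge_zero order_trans by blast
    have kv: "kato s (?m * (B i * N)) (v k)" for k
    proof -
      have "kato s (B i * N) (\<lambda>w. (- C i w $ j) * a j k w)" for j
      proof (rule kato_mult_bounded[OF ka sN(3) _ _ B0])
        show "(\<lambda>w. - C i w $ j) \<in> borel_measurable lebesgue"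
          by (intro continuous_measurable_lebesgue continuous_on_minus continuous_on_component C)
        show "norm (- C i w $ j) \<le> B i" for w
          using order_trans[OF Finite_Cartesian_Product.norm_nth_le C(2)] by simp
      qed
      then show ?thesis
        unfolding v_def[abs_def] using kato_sum[of "UNIV :: 'm set" s "B i * N" "\<lambda>j w. (- C i w $ j) * a j k w"] B0 sN(3) by simp
    qed
    have Ck: "axis i 1 $ k + cauchy_transform (v k) z = C i z $ k" for k z
      unfolding C(3)[of i z k] v_def cauchy_transform_def by (simp add: sum_negf)
    have "dbar_eq_distributionally U (\<lambda>z. f z $ k) (\<lambda>z. (A z *v f z) $ k)" for k
      using eq unfolding solves_dbar_system_def by (intro dbar_eq_mono[OF oV oU]) (auto simp: U_def)
    then have "dbar_eq_distributionally U (\<lambda>z. (axis i 1 $ k + cauchy_transform (v k) z) * f z $ k)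
        (\<lambda>z. v k z * f z $ k + (axis i 1 $ k + cauchy_transform (v k) z) * (A z *v f z) $ k)" for k
      using B0 sN by (intro weak_leibniz_cauchy_transform[OF oU fk[OF U\<Omega>] _ kv]) auto
    then have sum_eq: "dbar_eq_distributionally U (\<lambda>z. \<Sum>k\<in>UNIV. C i z $ k * f z $ k)
        (\<lambda>z. \<Sum>k\<in>UNIV. v k z * f z $ k + C i z $ k * (A z *v f z) $ k)"
      unfolding Ck by (intro dbar_eq_sum oU) auto
    have cancel: "(\<Sum>k\<in>UNIV. v k z * f z $ k + C i z $ k * (A z *v f z) $ k) = 0" if z: "z \<in> U" for z
    proof -
      have "(\<Sum>k\<in>UNIV. v k z * f z $ k) = - (\<Sum>k\<in>UNIV. \<Sum>j\<in>UNIV. C i z $ j * (A z $ j $ k * f z $ k))"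
        using z aA unfolding v_def by (simp add: U_def sum_distrib_right sum_negf mult.assoc)
      also have "(\<Sum>k\<in>UNIV. \<Sum>j\<in>UNIV. C i z $ j * (A z $ j $ k * f z $ k)) = (\<Sum>j\<in>UNIV. \<Sum>k\<in>UNIV. C i z $ j * (A z $ j $ k * f z $ k))"
        by (rule sum.swap)
      also have "\<dots> = (\<Sum>j\<in>UNIV. C i z $ j * (A z *v f z) $ j)"
        by (simp add: matrix_vector_mult_def sum_distrib_left)
      finally show ?thesis
        by (simp add: sum.distrib)
    qed
    show ?thesis
      by (rule dbar_eq_cong[OF oU sum_eq]) (simp_all add: g_def cancel)
  qed
  have hol: "g i holomorphic_on D" for i
  proof (rule rado[OF D(1) gD])
    have "g i holomorphic_on U"
      by (rule weyl_lemma[OF oU continuous_on_subset[OF gD] weak]) (simp add: U_def)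
    moreover have "{z \<in> D. g i z \<noteq> 0} \<subseteq> U"
      using D(3) by (auto simp: U_def V g_def)
    ultimately show "g i holomorphic_on {z \<in> D. g i z \<noteq> 0}"
      by (rule holomorphic_on_subset)
  qed
  have zero_iff: "f z = 0" if "\<And>i. g i z = 0" for z
    by (rule near_identity_matrix_injective[of "\<lambda>i. C i z"]) (use C(4) that in \<open>auto simp: g_def\<close>)
  show ?thesis
  proof (cases "\<forall>z\<in>D. f z = 0")
    case True
    then have "D \<subseteq> {z \<in> \<Omega>. f z = 0}"
      using D(3) by blast
    then show ?thesis
      using D(1,4) interior_maximal by blast
  next
    case False
    then obtain \<beta> i where \<beta>: "\<beta> \<in> D" "g i \<beta> \<noteq> 0"
      using zero_iff by blast
    show ?thesis
    proof (cases "f c = 0")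
      case True
      then have "g i c = 0" by (simp add: g_def)
      from isolated_zeros[OF hol D(1,2,4) this \<beta>]
      obtain \<rho> where \<rho>: "0 < \<rho>" "ball c \<rho> \<subseteq> D" "\<And>z. z \<in> ball c \<rho> - {c} \<Longrightarrow> g i z \<noteq> 0"
        by blast
      have "f z \<noteq> 0" if "z \<in> ball c \<rho>" "z \<noteq> c" for z
        using \<rho>(3)[of z] that by (auto simp: g_def)
      then show ?thesis
        using \<rho>(1) unfolding islimpt_def by (metis (mono_tags, lifting) centre_in_ball mem_Collect_eq open_ball)
    next
      case False
      then have "c \<in> V" "V \<inter> {z \<in> \<Omega>. f z = 0} = {}"
        using c by (auto simp: V)
      then show ?thesis
        using oV unfolding islimpt_def by blast
    qed
  qed
qed

theorem propositionC:
  fixes \<Omega> :: "complex set"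
    and f :: "complex \<Rightarrow> complex ^ 'm"
    and A :: "complex \<Rightarrow> complex ^ 'm ^ 'm"
    and p :: ennreal
  assumes "open \<Omega>" and "connected \<Omega>"
    and "continuous_on \<Omega> f"
    and "2 < p"
    and "\<And>i j. in_Lp p (\<Omega> - {z \<in> \<Omega>. f z = 0}) (\<lambda>z. A z $ i $ j)"
    and "solves_dbar_system (\<Omega> - {z \<in> \<Omega>. f z = 0}) A f"
    and "\<exists>z \<in> \<Omega>. f z \<noteq> 0"
  shows "discrete {z \<in> \<Omega>. f z = 0} \<and>
    solves_dbar_system \<Omega> (\<lambda>z. if z \<in> {z \<in> \<Omega>. f z = 0} then 0 else A z) f"
proof -
  define Z where "Z = {z \<in> \<Omega>. f z = 0}"
  define V where "V = {z \<in> \<Omega>. f z \<noteq> 0}"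
  have VZ: "\<Omega> - {z \<in> \<Omega>. f z = 0} = V"
    by (auto simp: V_def)
  note A = assms(5)[unfolded VZ] and sol = assms(6)[unfolded VZ]
  have oV: "open V"
    unfolding V_def by (rule open_nonzero_set[OF assms(3,1)])
  have dich: "c \<in> interior Z \<or> \<not> c islimpt Z" if "c \<in> \<Omega>" for c
    unfolding Z_def by (rule zeros_locally_isolated_or_identically_zero[OF assms(1,3,4) V_def A sol that])
  have "interior Z \<inter> \<Omega> = {}"
  proof -
    have "open (- {x. x islimpt Z})"
      using closed_limpts by (rule open_Compl)
    moreover have "\<Omega> \<subseteq> interior Z \<union> - {x. x islimpt Z}" "interior Z \<inter> - {x. x islimpt Z} \<inter> \<Omega> = {}"
      using dich interior_limit_point by blast+
    ultimately have "interior Z \<inter> \<Omega> = {} \<or> - {x. x islimpt Z} \<inter> \<Omega> = {}"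
      using connectedD[OF assms(2) open_interior] by blast
    moreover have "- {x. x islimpt Z} \<inter> \<Omega> \<noteq> {}"
    proof -
      obtain z where "z \<in> \<Omega>" "f z \<noteq> 0" using assms(7) by blast
      then have "z \<notin> interior Z" using interior_subset by (auto simp: Z_def)
      then show ?thesis using dich[OF \<open>z \<in> \<Omega>\<close>] \<open>z \<in> \<Omega>\<close> by blast
    qed
    ultimately show ?thesis by blast
  qed
  then have isolated: "\<not> c islimpt Z" if "c \<in> \<Omega>" for c
    using dich that by blast
  have "discrete Z"
    by (rule discreteI) (use isolated in \<open>auto simp: isolated_in_islimpt_iff Z_def\<close>)
  moreover have "solves_dbar_system \<Omega> (\<lambda>z. if z \<in> Z then 0 else A z) f"
    unfolding solves_dbar_system_def
  proof
    fix i
    let ?u = "\<lambda>z. f z $ i" and ?v = "\<lambda>z. (A z *v f z) $ i"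
    have Av: "(\<lambda>z. ((if z \<in> Z then 0 else A z) *v f z) $ i) = ?v"
      by (auto simp: fun_eq_iff Z_def)
    have u: "continuous_on \<Omega> ?u"
      by (intro continuous_on_component assms(3))
    have lv: "locally_integrable \<Omega> ?v"
      unfolding locally_integrable_def
    proof safe
      fix K assume K: "compact K" "K \<subseteq> \<Omega>"
      obtain W v s M where v: "K \<subseteq> W" "kato s M v" "\<forall>z\<in>W. v z = ?v z"
        using rhs_kato_near_compact[OF assms(1,3,4) V_def A K, of i] by blast
      have "integrable (lebesgue_on K) v"
        using integrable_imp_locally_integrable[of v K] v(2) K(1) by (simp add: kato_def locally_integrable_def)
      then show "integrable (lebesgue_on K) ?v"
        by (rule Bochner_Integration.integrable_cong[OF refl, THEN iffD1, rotated]) (use v in auto)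
    qed
    have "(\<integral>z. ?u z * dbar \<phi> z \<partial>lebesgue) = - (\<integral>z. ?v z * \<phi> z \<partial>lebesgue)" if \<phi>: "test_function \<Omega> \<phi>" for \<phi>
    proof -
      obtain K where K: "compact K" "K \<subseteq> \<Omega>" "\<And>z. z \<notin> K \<Longrightarrow> \<phi> z = 0"
        using test_function_support[OF \<phi>] by blast
      obtain W v s M where W: "open W" "K \<subseteq> W" "W \<subseteq> \<Omega>" "\<forall>z\<in>W. v z = ?v z"
        and v: "kato s M v" "0 < s" "0 \<le> M" "s \<le> 2"
        using rhs_kato_near_compact[OF assms(1,3,4) V_def A K(1,2), of i] by blast
      define F where "F = K \<inter> Z"
      have "finite F"
      proof (rule ccontr)
        assume "infinite F"
        then obtain x where "x \<in> K" "x islimpt F"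
          using compact_eq_Bolzano_Weierstrass[of K] K(1) by (auto simp: F_def)
        then show False
          using isolated[of x] islimpt_subset[of x F Z] K(2) by (auto simp: F_def)
      qed
      \<comment> \<open>Only the zeros in the support of the test function are added back.\<close>
      define U where "U = W - closure (Z - F)"
      have oU: "open U" using W(1) by (simp add: U_def open_Diff)
      have cl: "closure (Z - F) \<inter> \<Omega> \<subseteq> Z - F"
        using isolated islimpt_subset[of _ "Z - F" Z] by (auto simp: closure_def)
      have KU: "K \<subseteq> U"
        using W(2) K(2) cl by (auto simp: U_def F_def)
      have UV: "U - F \<subseteq> V"
        using W(3) closure_subset[of "Z - F"] by (auto simp: U_def V_def Z_def)
      have U\<Omega>: "U \<subseteq> \<Omega>" using W(3) by (auto simp: U_def)
      have oUF: "open (U - F)"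
        using oU \<open>finite F\<close> by (intro open_Diff finite_imp_closed)
      have "dbar_eq_distributionally V ?u ?v"
        using sol unfolding solves_dbar_system_def by blast
      from dbar_eq_mono[OF oV oUF UV this]
      have "dbar_eq_distributionally (U - F) ?u v"
        by (rule dbar_eq_cong[OF oUF]) (use W(4) in \<open>auto simp: U_def\<close>)
      then have "dbar_eq_distributionally U ?u v"
        by (rule dbar_eq_insert_finite[OF oU \<open>finite F\<close> continuous_on_subset[OF u U\<Omega>] v])
      then have "dbar_eq_distributionally U ?u ?v"
        by (rule dbar_eq_cong[OF oU]) (use W(4) in \<open>auto simp: U_def\<close>)
      moreover have "test_function U \<phi>"
        using \<phi> K KU unfolding test_function_iff by blast
      ultimately show ?thesis
        unfolding dbar_eq_distributionally_iff[OF oU] by blast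
    qed
    then show "dbar_eq_distributionally \<Omega> ?u (\<lambda>z. ((if z \<in> Z then 0 else A z) *v f z) $ i)"
      unfolding Av dbar_eq_distributionally_iff[OF assms(1)]
      using lv locally_integrable_continuous_on[OF u] by blast
  qed
  ultimately show ?thesis
    unfolding Z_def by blast
qed

end
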